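(* Let $W:\mathbb{M}\to\mathbb{R}$ be a continuous, bounded from below function on the space $\mathbb{M}$ of real $m\times d$ matrices, and let $F_+,F_-\in\mathbb{M}$ be such that $W$ is of class $C^2$ in a neighborhood of $\{F_+,F_-\}$. Assume that $F_+-F_-=a\otimes n$ for some $a\in\mathbb{R}^m$ and some unit vector $n\in\mathbb{S}^{d-1}$. Then the interface $\Pi_n=\{z\in\mathbb{R}^d: z\cdot n=0\}$ determined by the pair $F_\pm$ is strongly locally stable if and only if both of the following conditions hold: (S) (material stability in the bulk) $QW(F_+)=W(F_+)$ and $QW(F_-)=W(F_-)$; (I) (interchange stability) $\mathfrak{N}:=(W_F(F_+)-W_F(F_-),\,F_+-F_-)\le 0$.
   Context: $\mathbb{M}$ is the space of real $m\times d$ matrices with the Frobenius inner product $(A,B)=\mathrm{Tr}(A^TB)$; $a\otimes n$ is the matrix $a n^T$; $W_F$ is the gradient of $W$. $B$ is the open unit ball of $\mathbb{R}^d$, $B_n^{\pm}=\{z\in B:\pm z\cdot n>0\}$, and $⨍$ (written below as $\frac{1}{|D|}\int_D$) is the average. Strongly locally stable interface: the pair $F_\pm$ with $F_+-F_-=a\otimes n$ determines a strongly locally stable interface $\Pi_n$ if $$\frac{1}{|B_n^+|}\int_{B_n^+}W(F_++\nabla\phi(z))\,dz+\frac{1}{|B_n^-|}\int_{B_n^-}W(F_-+\nabla\phi(z))\,dz\ \ge\ W(F_+)+W(F_-)$$ for all $\phi\in C_0^\infty(B;\mathbb{R}^m)$. Quasiconvex envelope: $QW$ is the largest quasiconvex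 function not exceeding $W$; equivalently $$QW(F)=\inf\Big\{\frac{1}{|B|}\int_B W(\nabla y(z))\,dz:\ y\in W^{1,\infty}(B;\mathbb{R}^m),\ y(z)=Fz \text{ on }\partial B\Big\}.$$ *)

theory Defs
  imports "HOL-Analysis.Analysis"
begin

text \<open>
  The space of real \<open>m \<times> d\<close> matrices is \<^typ>\<open>real^'d^'m\<close>; its library inner product is the
  Frobenius inner product:
\<close>

lemma inner_eq_trace: "(A :: real^'d^'m) \<bullet> B = trace (transpose A ** B)"
proof -
  have "A \<bullet> B = (\<Sum>i\<in>UNIV. \<Sum>j\<in>UNIV. A $ i $ j * B $ i $ j)"
    by (simp add: inner_vec_def)
  also have "\<dots> = (\<Sum>j\<in>UNIV. \<Sum>i\<in>UNIV. A $ i $ j * B $ i $ j)"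
    by (rule sum.swap)
  finally show ?thesis
    by (simp add: trace_def transpose_def matrix_matrix_mult_def)
qed

definition outer :: "real^'m \<Rightarrow> real^'d \<Rightarrow> real^'d^'m" (infixr "\<otimes>" 75)
  where "a \<otimes> n = (\<chi> i j. a $ i * n $ j)"

definition gradient :: "('a::real_inner \<Rightarrow> real) \<Rightarrow> 'a \<Rightarrow> 'a"
  where "gradient f x = (THE D. GDERIV f x :> D)"

lemma gradient_eqI: "GDERIV f x :> D \<Longrightarrow> gradient f x = D"
  unfolding gradient_def
proof (rule the_equality)
  fix E assume D: "GDERIV f x :> D" and E: "GDERIV f x :> E"
  have "(\<lambda>h. h \<bullet> E) = (\<lambda>h. h \<bullet> D)"
    using has_derivative_unique D E unfolding gderiv_def by blast
  then show "E = D" by (metis vector_eq_ldot)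
qed

text \<open>
  Class \<open>C\<^sup>k\<close>, for open sets \<open>S\<close>: in finite dimension, continuity of the derivative is the
  same as continuity of all directional derivatives.
\<close>

primrec Ck_on :: "nat \<Rightarrow> 'a::euclidean_space set \<Rightarrow> ('a \<Rightarrow> 'b::euclidean_space) \<Rightarrow> bool"
  where
    "Ck_on 0 S f \<longleftrightarrow> continuous_on S f"
  | "Ck_on (Suc k) S f \<longleftrightarrow>
       (\<forall>x\<in>S. f differentiable (at x)) \<and> (\<forall>v. Ck_on k S (\<lambda>x. frechet_derivative f (at x) v))"

text \<open>\<open>C\<^sub>0\<^sup>\<infinity>(U)\<close>, its elements being extended by zero to the whole space.\<close>

definition test_functions :: "'a::euclidean_space set \<Rightarrow> ('a \<Rightarrow> 'b::euclidean_space) set"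
  where "test_functions U =
    {\<phi>. (\<forall>k. Ck_on k UNIV \<phi>) \<and> compact (closure {z. \<phi> z \<noteq> 0}) \<and> closure {z. \<phi> z \<noteq> 0} \<subseteq> U}"

definition average :: "'a::euclidean_space set \<Rightarrow> ('a \<Rightarrow> real) \<Rightarrow> real"
  where "average D f = (\<integral>z. f z \<partial>lebesgue_on D) / measure lebesgue D"

definition L_infinity :: "'a::euclidean_space set \<Rightarrow> ('a \<Rightarrow> 'b::euclidean_space) set"
  where "L_infinity U =
    {f. f \<in> borel_measurable (lebesgue_on U) \<and> (\<exists>C. AE z in lebesgue_on U. norm (f z) \<le> C)}"

definition weak_gradient_on ::
    "(real^'d) set \<Rightarrow> (real^'d \<Rightarrow> real^'m) \<Rightarrow> (real^'d \<Rightarrow> real^'d^'m) \<Rightarrow> bool"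
  where "weak_gradient_on U y G \<longleftrightarrow>
    (\<forall>\<psi> :: real^'d \<Rightarrow> real. \<psi> \<in> test_functions U \<longrightarrow> (\<forall>i j.
       (\<integral>z. y z $ i * frechet_derivative \<psi> (at z) (axis j 1) \<partial>lebesgue_on U) =
       - (\<integral>z. G z $ i $ j * \<psi> z \<partial>lebesgue_on U)))"

text \<open>\<open>y \<in> W\<^sup>1\<^sup>,\<^sup>\<infinity>(U)\<close> with \<open>\<nabla>y = G\<close> almost everywhere.\<close>

definition W1_infinity ::
    "(real^'d) set \<Rightarrow> (real^'d \<Rightarrow> real^'m) \<Rightarrow> (real^'d \<Rightarrow> real^'d^'m) \<Rightarrow> bool"
  where "W1_infinity U y G \<longleftrightarrow>
    y \<in> L_infinity U \<and> G \<in> L_infinity U \<and> weak_gradient_on U y G"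

text \<open>
  The boundary values of \<open>y\<close> are those of its representative that is continuous up to the
  boundary; every element of \<open>W\<^sup>1\<^sup>,\<^sup>\<infinity>\<close> of a ball has exactly one (it is Lipschitz).
  For continuous \<open>W\<close> bounded from below the infimum is that of a nonempty set of reals that is
  bounded from below.
\<close>

definition quasiconvex_envelope :: "(real^'d^'m \<Rightarrow> real) \<Rightarrow> real^'d^'m \<Rightarrow> real"
  where "quasiconvex_envelope W F =
    Inf {average (ball 0 1) (\<lambda>z. W (G z)) | y G.
      W1_infinity (ball 0 1) y G \<and> continuous_on (cball 0 1) y \<and> (\<forall>z\<in>sphere 0 1. y z = F *v z)}"

definition strongly_locally_stable ::
    "(real^'d^'m \<Rightarrow> real) \<Rightarrow> real^'d^'m \<Rightarrow> real^'d^'m \<Rightarrow> real^'d \<Rightarrow> bool"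
  where "strongly_locally_stable W Fp Fm n \<longleftrightarrow>
    (\<forall>\<phi> :: real^'d \<Rightarrow> real^'m. \<phi> \<in> test_functions (ball 0 1) \<longrightarrow>
       average {z \<in> ball 0 1. z \<bullet> n > 0} (\<lambda>z. W (Fp + jacobian \<phi> (at z))) +
       average {z \<in> ball 0 1. - z \<bullet> n > 0} (\<lambda>z. W (Fm + jacobian \<phi> (at z)))
       \<ge> W Fp + W Fm)"

end

theory Submission
  imports Defs
begin

text \<open>
  Necessity. A test function supported in one half of the ball sees only one of the two phases, which
  gives quasiconvexity at \<open>F\<^sub>\<plusminus>\<close> on smooth functions; competitors in \<open>W\<^sup>1\<^sup>,\<^sup>\<infinity>\<close> are reached by
  extending \<open>y - F z\<close> by zero and mollifying. The vanishing of the first variation, tested with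
  \<open>\<psi>(|z|) a\<close> for a decreasing profile \<open>\<psi>\<close>, gives the sign of \<open>\<NN>\<close>.

  Sufficiency. Insert a layer of thickness 1 of the phase \<open>F\<^sub>-\<close> into the phase \<open>F\<^sub>+\<close>, compensated by the
  gradient \<open>F\<^sub>+ + (1/H) a \<otimes> n\<close> on a layer of thickness \<open>H\<close> above it, and put a copy of the test function
  \<open>\<phi>\<close> at each of the \<open>N\<^sup>d\<^sup>-\<^sup>1\<close> points of a lattice on one face of the layer. Lateral truncation costs only
  \<open>o(N\<^sup>d\<^sup>-\<^sup>1)\<close>, so as \<open>N \<rightarrow> \<infinity>\<close> and then \<open>H \<rightarrow> \<infinity>\<close>, quasiconvexity at \<open>F\<^sub>+\<close> yields
  \<open>0 \<le> \<kappa> (W F\<^sub>- - W F\<^sub>+ + (W\<^sub>F F\<^sub>+, a \<otimes> n)) + E(\<phi>)\<close>, where \<open>E(\<phi>)\<close> is the energy excess of the interface.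
  For \<open>\<phi> = 0\<close> this is the Weierstrass inequality; adding it for the two phases gives \<open>\<NN> \<ge> 0\<close>, hence
  under interchange stability both are equalities, and then the inequality for \<open>\<phi>\<close> says \<open>E(\<phi>) \<ge> 0\<close>.
\<close>

section \<open>Smooth functions and test functions\<close>

text \<open>Stability is tested across two phases, whereas quasiconvexity speaks of perturbations of
  a single affine map, so the interface has to be planted inside the phase F_+. Write A = a
  \<otimes> n. Lowering the gradient from F_+ to F_- = F_+ - A on a layer displaces the map by a,
  and this displacement must be taken back before quasiconvexity applies. Spread over a thickness H,
  the return costs H (W(F_+ + A/H) - W(F_+)) per unit area, which tends to the linear term
  (W_F(F_+), A). This is how the gradient of W, and with it interchange stability, meets the
  envelope. The cost of the layer and the contribution of the copies of \<phi> have the same order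
  in N, so refining the lattice cannot suppress the former: it has to vanish exactly, and (S) and
  (I) together force that. The number \<kappa> is the volume of the unit layer over one lattice
  cell. Copies of \<phi> sit only on the face where F_- lies below F_+ with respect to n; on the
  other face of the unit layer the phases come in the opposite order.\<close>

lemma Ck_on_SucI:
  assumes "\<And>x. (f has_derivative D x) (at x)"
    and "\<And>v. Ck_on k UNIV (\<lambda>x. D x v)"
  shows "Ck_on (Suc k) UNIV f"
proof -
  \<comment> \<open>By uniqueness of derivatives any derivative known in closed form may stand for
    \<open>frechet_derivative\<close>; every smoothness induction below gets its step this
    way.\<close>
  have "frechet_derivative f (at x) = D x" for x
    using assms(1) by (metis frechet_derivative_at)
  then show ?thesis
    using assms by (auto simp: differentiable_def)
qed

lemma Ck_on_continuous: "Ck_on k UNIV f \<Longrightarrow> continuous_on UNIV f"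
proof (cases k)
  case (Suc j)
  assume "Ck_on k UNIV f"
  then show ?thesis
    using Suc by (simp add: continuous_on_eq_continuous_at differentiable_imp_continuous_within)
qed simp

text \<open>Product and chain rules put the functions themselves next to their derivatives, so an
  induction hypothesis at order k must also accept functions known to be of order k + 1.\<close>

lemma Ck_on_SucD: "Ck_on (Suc k) UNIV f \<Longrightarrow> Ck_on k UNIV f"
proof (induction k arbitrary: f)
  case 0
  from Ck_on_continuous[OF this] show ?case by simp
next
  case (Suc k)
  then show ?case using Ck_on.simps(2) by blast
qed

lemma Ck_on_has_derivative:
  "Ck_on (Suc k) UNIV f \<Longrightarrow> (f has_derivative frechet_derivative f (at x)) (at x)"
  using frechet_derivative_works by auto

lemma Ck_on_derivative:
  "Ck_on (Suc k) UNIV f \<Longrightarrow> Ck_on k UNIV (\<lambda>x. frechet_derivative f (at x) v)"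
  by simp

lemma Ck_on_const: "Ck_on k UNIV (\<lambda>x. c)"
proof (induction k arbitrary: c)
  case (Suc k)
  show ?case by (rule Ck_on_SucI[where D = "\<lambda>x v. 0"]) (auto intro: Suc)
qed simp

lemma Ck_on_linear:
  assumes "bounded_linear f"
  shows "Ck_on k UNIV f"
proof (cases k)
  case 0
  then show ?thesis using assms by (simp add: linear_continuous_on)
next
  case (Suc j)
  have "Ck_on (Suc j) UNIV f"
    by (rule Ck_on_SucI[where D = "\<lambda>_. f"])
      (auto intro: bounded_linear_imp_has_derivative assms Ck_on_const)
  then show ?thesis using Suc by simp
qed

lemma Ck_on_add:
  "Ck_on k UNIV f \<Longrightarrow> Ck_on k UNIV g \<Longrightarrow> Ck_on k UNIV (\<lambda>x. f x + g x)"
proof (induction k arbitrary: f g)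
  case 0
  then show ?case by (simp add: continuous_on_add)
next
  case (Suc k)
  show ?case
    by (rule Ck_on_SucI[OF has_derivative_add[OF Ck_on_has_derivative[OF Suc.prems(1)]
          Ck_on_has_derivative[OF Suc.prems(2)]]])
      (use Suc in auto)
qed

lemma Ck_on_linear_compose:
  assumes "bounded_linear L"
  shows "Ck_on k UNIV f \<Longrightarrow> Ck_on k UNIV (\<lambda>x. L (f x))"
proof (induction k arbitrary: f)
  case 0
  then show ?case
    using assms by (auto intro: continuous_on_compose2[OF linear_continuous_on])
next
  case (Suc k)
  show ?case
    by (rule Ck_on_SucI[OF bounded_linear.has_derivative[OF assms Ck_on_has_derivative[OF Suc.prems]]])
      (use Suc in auto)
qed

lemma Ck_on_affine_compose:
  assumes "bounded_linear A"
  shows "Ck_on k UNIV f \<Longrightarrow> Ck_on k UNIV (\<lambda>x. f (A x + t))"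
proof (induction k arbitrary: f)
  case 0
  then have "continuous_on UNIV f" by simp
  then have "continuous_on UNIV (\<lambda>x. f (A x + t))"
    by (rule continuous_on_compose2)
      (auto simp: continuous_on_add[OF linear_continuous_on[OF assms] continuous_on_const])
  then show ?case by simp
next
  case (Suc k)
  have "((\<lambda>x. A x + t) has_derivative A) (at x)" for x
    using has_derivative_add[OF bounded_linear_imp_has_derivative[OF assms] has_derivative_const]
    by simp
  from has_derivative_compose[OF this Ck_on_has_derivative[OF Suc.prems]]
  show ?case
    by (rule Ck_on_SucI) (use Suc in auto)
qed

lemma Ck_on_scaleR:
  "Ck_on k UNIV f \<Longrightarrow> Ck_on k UNIV g \<Longrightarrow> Ck_on k UNIV (\<lambda>x. f x *\<^sub>R g x)"
proof (induction k arbitrary: f g)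
  case 0
  then show ?case by (simp add: continuous_on_scaleR)
next
  case (Suc k)
  note D = has_derivative_scaleR[OF Ck_on_has_derivative[OF Suc.prems(1)]
      Ck_on_has_derivative[OF Suc.prems(2)]]
  show ?case
    by (rule Ck_on_SucI[OF D])
      (intro Ck_on_add Suc.IH Suc.prems Ck_on_derivative Ck_on_SucD)
qed

lemma Ck_on_mult:
  fixes f g :: "'a::euclidean_space \<Rightarrow> real"
  shows "Ck_on k UNIV f \<Longrightarrow> Ck_on k UNIV g \<Longrightarrow> Ck_on k UNIV (\<lambda>x. f x * g x)"
  using Ck_on_scaleR[of k f g] by simp

text \<open>The derivative of the composite is a product of the derivative of g with s'(g), so the
  induction replaces s by s'. This is why s is generalised and assumed smooth of every order, while
  g only has the order of the conclusion.\<close>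

lemma Ck_on_real_compose:
  fixes s :: "real \<Rightarrow> real"
  shows "(\<And>j. Ck_on j UNIV s) \<Longrightarrow> Ck_on k UNIV g \<Longrightarrow> Ck_on k UNIV (\<lambda>x. s (g x))"
proof (induction k arbitrary: s g)
  case 0
  then have "continuous_on UNIV s" using Ck_on_continuous by blast
  then have "continuous_on UNIV (\<lambda>x. s (g x))"
    by (rule continuous_on_compose2) (use 0 in auto)
  then show ?case by simp
next
  case (Suc k)
  define s' where "s' t = frechet_derivative s (at t) 1" for t
  have s1: "Ck_on (Suc 0) UNIV s" by (rule Suc.prems)
  have lin: "frechet_derivative s (at t) h = h * s' t" for t h
    using linear_scale[OF has_derivative_linear[OF Ck_on_has_derivative[OF s1]], of t h 1]
    by (simp add: s'_def)
  have s': "Ck_on j UNIV s'" for j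
    unfolding s'_def by (rule Ck_on_derivative, rule Suc.prems)
  note D = has_derivative_compose[OF Ck_on_has_derivative[OF Suc.prems(2)] Ck_on_has_derivative[OF s1]]
  have *: "Ck_on k UNIV (\<lambda>x. frechet_derivative g (at x) v * s' (g x))" for v
    by (rule Ck_on_mult[OF Ck_on_derivative[OF Suc.prems(2)]
          Suc.IH[OF s' Ck_on_SucD[OF Suc.prems(2)]]])
  show ?case
    by (rule Ck_on_SucI[OF D]) (simp only: lin *)
qed

lemma Ck_on_norm_square: "Ck_on k UNIV (\<lambda>x :: 'a::euclidean_space. x \<bullet> x)"
proof -
  \<comment> \<open>One order more than asked is proved and then given up, which avoids a separate
    case at order 0.\<close>
  have "Ck_on (Suc k) UNIV (\<lambda>x :: 'a. x \<bullet> x)"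
  proof (rule Ck_on_SucI)
    show "((\<lambda>x. x \<bullet> x) has_derivative (\<lambda>h. 2 * (h \<bullet> x))) (at x)" for x :: 'a
      by (auto intro!: derivative_eq_intros simp: inner_commute)
    show "Ck_on k UNIV (\<lambda>x. 2 * (v \<bullet> x))" for v :: 'a
      by (intro Ck_on_linear bounded_linear_const_mult bounded_linear_inner_right)
  qed
  then show ?thesis by (rule Ck_on_SucD)
qed

lemma test_functionsI:
  assumes "\<And>k. Ck_on k UNIV f" and "compact K" and "K \<subseteq> U" and "\<And>z. z \<notin> K \<Longrightarrow> f z = 0"
  shows "f \<in> test_functions U"
proof -
  have "closure {z. f z \<noteq> 0} \<subseteq> K"
    using assms by (intro closure_minimal) (auto simp: compact_imp_closed)
  moreover have "compact (closure {z. f z \<noteq> 0})"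
    using calculation assms(2)
    by (meson closed_closure compact_eq_bounded_closed bounded_subset)
  ultimately show ?thesis
    using assms unfolding test_functions_def by blast
qed

section \<open>The flat exponential and a smooth step\<close>

definition flat :: "nat \<Rightarrow> real \<Rightarrow> real"
  where "flat n t = (if t > 0 then exp (- (1 / t)) / t ^ n else 0)"

text \<open>From the right, the substitution x = 1/t turns this into the decay of x^n / exp x at
  infinity.\<close>

lemma flat_limit: "(flat n \<longlongrightarrow> 0) (at 0)"
proof -
  have "((\<lambda>x::real. x ^ n / exp x) \<longlongrightarrow> 0) at_top"
    by (rule tendsto_power_div_exp_0)
  then have "((\<lambda>t. inverse t ^ n / exp (inverse t)) \<longlongrightarrow> 0) (at_right (0::real))"
    using filterlim_inverse_at_top_right by (rule filterlim_compose)
  then have "(flat n \<longlongrightarrow> 0) (at_right 0)"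
    by (rule Lim_transform_eventually)
      (auto simp: flat_def eventually_at_right_less exp_minus field_simps
        intro!: eventually_mono[OF eventually_at_right_less])
  moreover have "(flat n \<longlongrightarrow> 0) (at_left 0)"
    by (rule Lim_transform_eventually[OF tendsto_const])
      (auto simp: flat_def eventually_at_filter)
  ultimately show ?thesis
    by (simp add: filterlim_split_at)
qed

text \<open>The derivative of each member is a linear combination of members. The weights 1/t^n are
  carried along for this reason, although only \<open>flat 0\<close>, the classical exp(-1/t)
  extended by zero, is wanted in the end.\<close>

lemma flat_derivative:
  "(flat n has_real_derivative flat (n + 2) t - n * flat (Suc n) t) (at t)"
proof -
  consider "t > 0" | "t < 0" | "t = 0" by linarith
  then show ?thesis
  proof cases
    case 1
    \<comment> \<open>Removes the truncated exponent left by the power rule; at n = 0 both sides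
      vanish.\<close>
    have p: "real n * t ^ (n - Suc 0) = real n * t ^ n / t"
      using 1 by (cases n) auto
    have "((\<lambda>t. exp (- (1 / t)) / t ^ n) has_real_derivative
        ((exp (- (1 / t)) * (1 / t\<^sup>2)) * t ^ n - exp (- (1 / t)) * (real n * t ^ (n - Suc 0)))
          / (t ^ n * t ^ n)) (at t)"
      using 1 by (auto intro!: derivative_eq_intros simp: power2_eq_square)
    moreover have "((exp (- (1 / t)) * (1 / t\<^sup>2)) * t ^ n - exp (- (1 / t)) * (real n * t ^ (n - Suc 0)))
          / (t ^ n * t ^ n) = flat (n + 2) t - n * flat (Suc n) t"
      unfolding p using 1 by (simp add: flat_def divide_simps power2_eq_square) (simp add: algebra_simps)
    ultimately have "((\<lambda>t. exp (- (1 / t)) / t ^ n) has_real_derivative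
        flat (n + 2) t - n * flat (Suc n) t) (at t)"
      by simp
    then show ?thesis
      by (rule has_field_derivative_transform_within_open[where S = "{0<..}"])
        (use 1 in \<open>auto simp: flat_def\<close>)
  next
    case 2
    have "((\<lambda>t. 0) has_real_derivative flat (n + 2) t - n * flat (Suc n) t) (at t)"
      using 2 by (simp add: flat_def)
    then show ?thesis
      by (rule has_field_derivative_transform_within_open[where S = "{..<0}"])
        (use 2 in \<open>auto simp: flat_def\<close>)
  next
    case 3
    \<comment> \<open>The difference quotient of \<open>flat n\<close> at 0 is
      \<open>flat (Suc n)\<close>, whose limit is known.\<close>
    have "((\<lambda>h. (flat n h - flat n 0) / h) \<longlongrightarrow> 0) (at 0)"
      by (rule Lim_transform_eventually[OF flat_limit[of "Suc n"]])
        (auto simp: flat_def eventually_at_filter)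
    then have "(flat n has_real_derivative 0) (at 0)"
      by (simp add: DERIV_def flat_def)
    then show ?thesis
      using 3 by (simp add: flat_def)
  qed
qed

lemma Ck_on_flat: "Ck_on k UNIV (flat n)"
proof (induction k arbitrary: n)
  case 0
  show ?case
    using flat_derivative by (auto intro!: DERIV_continuous_on simp: has_field_derivative_at_within)
next
  case (Suc k)
  have *: "Ck_on k UNIV (\<lambda>t. (flat (n + 2) t + (- real n) * flat (Suc n) t) * v)" for v
    by (intro Ck_on_mult Ck_on_add Ck_on_const Suc)
  show ?case
    by (rule Ck_on_SucI[OF flat_derivative[unfolded has_field_derivative_def]]) (use * in simp)
qed

definition bump :: "real \<Rightarrow> real"
  where "bump t = flat 0 t * flat 0 (1 - t)"

lemma Ck_on_bump: "Ck_on k UNIV bump"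
proof -
  have "Ck_on k UNIV (\<lambda>t. flat 0 (- t + 1))"
    by (intro Ck_on_affine_compose Ck_on_flat bounded_linear_minus bounded_linear_ident)
  then have "Ck_on k UNIV (\<lambda>t. flat 0 t * flat 0 (- t + 1))"
    by (intro Ck_on_mult Ck_on_flat)
  then show ?thesis
    by (simp add: bump_def[abs_def])
qed

lemma bump_nonneg: "bump t \<ge> 0"
  and bump_pos_iff: "bump t > 0 \<longleftrightarrow> 0 < t \<and> t < 1"
  by (auto simp: bump_def flat_def)

lemma bump_continuous: "continuous_on S bump"
  using Ck_on_continuous[OF Ck_on_bump] continuous_on_subset by blast

text \<open>The normalised primitive of \<open>bump\<close>. Strict positivity of s' inside the unit
  interval will make the constant in the interchange inequality positive; its vanishing outside
  confines the gradient of a cutoff to a thin shell.\<close>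

lemma smooth_step:
  obtains s :: "real \<Rightarrow> real" and s' where "\<And>k. Ck_on k UNIV s"
    and "\<And>t. (s has_real_derivative s' t) (at t)" and "continuous_on UNIV s'"
    and "\<And>t. t \<le> 0 \<Longrightarrow> s t = 0" and "\<And>t. t \<ge> 1 \<Longrightarrow> s t = 1" and "mono s"
    and "\<And>t. 0 < t \<Longrightarrow> t < 1 \<Longrightarrow> s' t > 0" and "\<And>t. s' t \<ge> 0"
    and "\<And>t. t \<le> 0 \<or> t \<ge> 1 \<Longrightarrow> s' t = 0"
proof -
  define I where "I = integral {0..1} bump"
  \<comment> \<open>The clamp keeps the interval from shrinking below {-1..0}, on which
    \<open>bump\<close> vanishes, so \<open>S\<close> is 0 on the negative half-line without a case
    of an empty interval.\<close>
  define S where "S t = integral {-1..max t 0} bump" for t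
  have S0: "S t = 0" if "t \<le> 0" for t
  proof -
    have "integral {-1..0} bump = integral {-1..0} (\<lambda>x::real. 0)"
      by (rule Henstock_Kurzweil_Integration.integral_cong) (auto simp: bump_def flat_def)
    then show ?thesis using that by (simp add: S_def)
  qed
  have deriv_pos: "(S has_real_derivative bump t) (at t)" for t
  proof -
    \<comment> \<open>A window with t in its interior and long enough to contain -1, where the
      integral is split.\<close>
    define m where "m = \<bar>t\<bar> + 2"
    have "((\<lambda>u. integral {-m..u} bump) has_real_derivative bump t) (at t within {-m..m})"
      by (rule integral_has_real_derivative) (auto simp: m_def bump_continuous)
    then have "((\<lambda>u. integral {-m..u} bump) has_real_derivative bump t) (at t)"
      by (simp add: at_within_Icc_at m_def)
    then show ?thesis
    proof (rule has_field_derivative_transform_within_open[where S = "{-m<..<m}"])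
      fix u assume u: "u \<in> {-m<..<m}"
      have int: "bump integrable_on {x..y}" for x y
        by (intro integrable_continuous_interval bump_continuous)
      have neg: "integral {x..y} bump = 0" if "y \<le> 0" for x y
      proof -
        have "integral {x..y} bump = integral {x..y} (\<lambda>x. 0)"
          by (rule Henstock_Kurzweil_Integration.integral_cong) (use that in \<open>auto simp: bump_def flat_def\<close>)
        then show ?thesis by simp
      qed
      show "integral {-m..u} bump = S u"
      proof (cases "u \<le> 0")
        case True
        then show ?thesis using neg S0 by simp
      next
        case False
        have "integral {-m..u} bump = integral {-m..-1} bump + integral {-1..u} bump"
          using False by (intro Henstock_Kurzweil_Integration.integral_combine[symmetric] int) (auto simp: m_def)
        then show ?thesis using neg[of "-1" "-m"] False by (simp add: S_def max_def)
      qed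
    qed (auto simp: m_def)
  qed
  have I: "S t = S 1" if "t \<ge> 1" for t
  proof (cases "t = 1")
    case False
    then have "1 < t" using that by simp
    from MVT2[OF this deriv_pos] obtain z where z: "1 < z" "S t - S 1 = (t - 1) * bump z" by metis
    have "bump z = 0" using z(1) by (simp add: bump_def flat_def)
    with z(2) show ?thesis by simp
  qed simp
  \<comment> \<open>The mean value theorem gives an interior point where \<open>bump\<close> equals
    \<open>S 1\<close>, hence \<open>S 1\<close> is positive and may be divided by.\<close>
  obtain z where z: "0 < z" "z < 1" "S 1 - S 0 = (1 - 0) * bump z"
    using MVT2[of 0 1 S bump] deriv_pos by auto
  have pos: "S 1 > 0" using z bump_pos_iff[of z] S0[of 0] by simp
  have mono: "mono S"
    by (rule monoI) (metis DERIV_nonneg_imp_nondecreasing deriv_pos bump_nonneg)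
  have smooth: "Ck_on k UNIV S" for k
  proof -
    have "Ck_on (Suc k) UNIV S"
      by (rule Ck_on_SucI[OF deriv_pos[unfolded has_field_derivative_def]])
        (intro Ck_on_mult Ck_on_bump Ck_on_const)
    then show ?thesis by (rule Ck_on_SucD)
  qed
  show thesis
  proof (rule that[of "\<lambda>t. S t * inverse (S 1)" "\<lambda>t. bump t * inverse (S 1)"])
    show "Ck_on k UNIV (\<lambda>t. S t * inverse (S 1))" for k
      by (intro Ck_on_mult Ck_on_const smooth)
    show "((\<lambda>t. S t * inverse (S 1)) has_real_derivative bump t * inverse (S 1)) (at t)" for t
      by (auto intro!: derivative_eq_intros deriv_pos)
    show "continuous_on UNIV (\<lambda>t. bump t * inverse (S 1))"
      by (intro continuous_intros bump_continuous)
    show "mono (\<lambda>t. S t * inverse (S 1))"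
      using mono pos by (auto simp: mono_def mult_right_mono)
    show "S t * inverse (S 1) = 1" if "t \<ge> 1" for t
      using I[OF that] pos by simp
    show "bump t * inverse (S 1) = 0" if "t \<le> 0 \<or> t \<ge> 1" for t
      using that by (auto simp: bump_def flat_def)
  qed (use pos S0 bump_nonneg bump_pos_iff in \<open>auto simp del: I\<close>)
qed

section \<open>Integration of directional derivatives\<close>

text \<open>The coordinatewise scaling of Lebesgue measure, specialised to one factor c for all
  coordinates. The completed measure is used because weak gradients are only Lebesgue
  measurable.\<close>

lemma lebesgue_affine:
  assumes "c \<noteq> 0"
  shows "(\<lambda>x::'a::euclidean_space. t + c *\<^sub>R x) \<in> lebesgue \<rightarrow>\<^sub>M lebesgue"
    and "lebesgue = density (distr lebesgue lebesgue (\<lambda>x::'a. t + c *\<^sub>R x)) (\<lambda>_. ennreal (\<bar>c\<bar> ^ DIM('a)))"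
proof -
  have eq: "t + (\<Sum>j\<in>Basis. (c * (x \<bullet> j)) *\<^sub>R j) = t + c *\<^sub>R x" for x :: 'a
    unfolding scaleR_scaleR[symmetric] scaleR_sum_right[symmetric] euclidean_representation ..
  show "(\<lambda>x::'a. t + c *\<^sub>R x) \<in> lebesgue \<rightarrow>\<^sub>M lebesgue"
    using lebesgue_affine_measurable[of "\<lambda>_. c" t] assms unfolding eq by blast
  show "lebesgue = density (distr lebesgue lebesgue (\<lambda>x::'a. t + c *\<^sub>R x)) (\<lambda>_. ennreal (\<bar>c\<bar> ^ DIM('a)))"
    using lebesgue_affine_euclidean[of "\<lambda>_. c" t] assms unfolding eq by (simp add: prod_constant)
qed

lemma integral_lebesgue_affine:
  fixes f :: "'a::euclidean_space \<Rightarrow> 'b::{banach, second_countable_topology}"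
  assumes [measurable]: "f \<in> borel_measurable lebesgue" and "c \<noteq> 0"
  shows "(\<integral>x. f x \<partial>lebesgue) = \<bar>c\<bar> ^ DIM('a) *\<^sub>R (\<integral>x. f (t + c *\<^sub>R x) \<partial>lebesgue)"
proof -
  note [measurable] = lebesgue_affine(1)[OF \<open>c \<noteq> 0\<close>, of t]
  show ?thesis
    by (subst lebesgue_affine(2)[OF \<open>c \<noteq> 0\<close>, of t]) (simp add: integral_density integral_distr)
qed

lemma integrable_lebesgue_affine:
  fixes f :: "'a::euclidean_space \<Rightarrow> 'b::{banach, second_countable_topology}"
  assumes "integrable lebesgue f" and "c \<noteq> 0"
  shows "integrable lebesgue (\<lambda>x. f (t + c *\<^sub>R x))"
proof -
  note [measurable] = lebesgue_affine(1)[OF \<open>c \<noteq> 0\<close>, of t] borel_measurable_integrable[OF assms(1)]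
  have "integrable (density (distr lebesgue lebesgue (\<lambda>x::'a. t + c *\<^sub>R x)) (\<lambda>_. ennreal (\<bar>c\<bar> ^ DIM('a)))) f"
    using assms lebesgue_affine(2)[OF \<open>c \<noteq> 0\<close>, of t] by simp
  then have "integrable lebesgue (\<lambda>x. (\<bar>c\<bar> ^ DIM('a)) *\<^sub>R f (t + c *\<^sub>R x))"
    by (simp add: integrable_density integrable_distr_eq)
  from integrable_scaleR_right[OF this, of "inverse (\<bar>c\<bar> ^ DIM('a))"] show ?thesis
    using \<open>c \<noteq> 0\<close> by simp
qed

lemma AE_lebesgue_affine:
  assumes "AE x in lebesgue. P x" and "c \<noteq> 0"
  shows "AE x::'a::euclidean_space in lebesgue. P (t + c *\<^sub>R x)"
proof -
  have "AE x in density (distr lebesgue lebesgue (\<lambda>x::'a. t + c *\<^sub>R x)) (\<lambda>_. ennreal (\<bar>c\<bar> ^ DIM('a))). P x"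
    using assms(1) by (subst (asm) lebesgue_affine(2)[OF \<open>c \<noteq> 0\<close>, of t])
  then have "AE x in distr lebesgue lebesgue (\<lambda>x::'a. t + c *\<^sub>R x). P x"
    using \<open>c \<noteq> 0\<close> by (simp add: AE_density)
  then show ?thesis
    by (rule AE_distrD[OF lebesgue_affine(1)[OF \<open>c \<noteq> 0\<close>]])
qed

text \<open>The pointwise \<open>lim\<close> is measurable whether or not the sequence converges,
  and completeness of the measure allows it to be changed on a null set.\<close>

lemma borel_measurable_AE_limit:
  fixes g :: "'a::euclidean_space \<Rightarrow> 'b::euclidean_space"
  assumes "\<And>i. s i \<in> borel_measurable lebesgue" and "AE x in lebesgue. (\<lambda>i. s i x) \<longlonglongrightarrow> g x"
  shows "g \<in> borel_measurable lebesgue"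
proof (rule borel_measurable_AE)
  show "(\<lambda>x. lim (\<lambda>i. s i x)) \<in> borel_measurable lebesgue"
    using assms(1) by (rule borel_measurable_lim_metric)
  show "AE x in lebesgue. lim (\<lambda>i. s i x) = g x"
    using assms(2) by eventually_elim (simp add: limI)
qed

lemma integrable_bounded_support:
  fixes f :: "'a::euclidean_space \<Rightarrow> 'b::euclidean_space"
  assumes "f \<in> borel_measurable lebesgue" and "S \<in> lmeasurable"
    and "AE z in lebesgue. norm (f z) \<le> C" and "AE z in lebesgue. z \<notin> S \<longrightarrow> f z = 0"
  shows "integrable lebesgue f"
proof (rule Bochner_Integration.integrable_bound[OF _ assms(1)])
  show "integrable lebesgue (\<lambda>z. C * indicator S z :: real)"
    using assms(2) by (intro integrable_mult_right integrable_real_indicator) (auto simp: fmeasurable_def)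
  show "AE z in lebesgue. norm (f z) \<le> norm (C * indicator S z :: real)"
    using assms(3,4) by eventually_elim (auto simp: indicator_def)
qed

lemma continuous_bounded_on_compact:
  assumes "compact S" and "continuous_on S f"
  obtains K where "K \<ge> 0" and "\<And>x. x \<in> S \<Longrightarrow> norm (f x) \<le> K"
proof -
  obtain K where "\<forall>x\<in>f ` S. norm x \<le> K"
    using compact_imp_bounded[OF compact_continuous_image[OF assms(2,1)]] unfolding bounded_iff by blast
  then show thesis by (intro that[of "max K 0"]) (auto simp: le_max_iff_disj)
qed

lemma filterlim_inverse_Suc_at_0: "filterlim (\<lambda>k. 1 / (real k + 1)) (at 0) sequentially"
  using LIMSEQ_inverse_real_of_nat unfolding filterlim_at
  by (auto simp: inverse_eq_divide add.commute intro!: always_eventually)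

lemma has_derivative_line:
  assumes "(f has_derivative f') (at z)"
  shows "((\<lambda>t. f (z + t *\<^sub>R e)) has_derivative (\<lambda>t. f' (t *\<^sub>R e))) (at 0)"
proof -
  have "((\<lambda>t. z + t *\<^sub>R e) has_derivative (\<lambda>t. t *\<^sub>R e)) (at 0)"
    by (auto intro!: derivative_eq_intros)
  then show ?thesis by (rule has_derivative_compose) (use assms in simp)
qed

text \<open>Integration by parts in its barest form. The difference quotients have integral zero by
  translation invariance and are dominated by a constant on a fixed ball. Only the derivative along
  e is involved, and only almost everywhere, so the lemma covers Lipschitz functions as well as
  smooth functions cut off by a half-space parallel to e.\<close>

lemma integral_directional_derivative_eq_0:
  fixes f g :: "'a::euclidean_space \<Rightarrow> real"
  assumes f: "integrable lebesgue f" and R: "\<And>z. norm z > R \<Longrightarrow> f z = 0"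
    and C: "\<And>z t. 0 < t \<Longrightarrow> t \<le> 1 \<Longrightarrow> \<bar>f (z + t *\<^sub>R e) - f z\<bar> \<le> C * t"
    and g: "AE z in lebesgue. ((\<lambda>t. f (z + t *\<^sub>R e)) has_real_derivative g z) (at 0)"
  shows "integrable lebesgue g" and "(\<integral>z. g z \<partial>lebesgue) = 0"
proof -
  define t where "t k = 1 / (real k + 1)" for k
  have t: "0 < t k" "t k \<le> 1" for k
    by (auto simp: t_def)
  have t_lim: "filterlim t (at 0) sequentially"
    unfolding t_def by (rule filterlim_inverse_Suc_at_0)
  define s where "s k z = (f (z + t k *\<^sub>R e) - f z) / t k" for k z
  note fm = borel_measurable_integrable[OF f]
  have shift: "integrable lebesgue (\<lambda>z. f (z + v))" for v
    using integrable_lebesgue_affine[OF f, of 1 v] by (simp add: add.commute)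
  have s_int: "integrable lebesgue (s k)" for k
    unfolding s_def by (intro integrable_divide Bochner_Integration.integrable_diff shift f)
  have s_lim: "AE z in lebesgue. (\<lambda>k. s k z) \<longlonglongrightarrow> g z"
    using g
  proof eventually_elim
    case (elim z)
    then have "((\<lambda>h. (f (z + h *\<^sub>R e) - f z) / h) \<longlongrightarrow> g z) (at 0)"
      by (simp add: DERIV_def)
    from filterlim_compose[OF this t_lim] show ?case
      by (simp add: s_def)
  qed
  have gm: "g \<in> borel_measurable lebesgue"
    using borel_measurable_AE_limit[OF borel_measurable_integrable[OF s_int] s_lim] .
  \<comment> \<open>Shifts of length at most \<open>norm e\<close> cannot bring the support outside
    this radius.\<close>
  define r where "r = R + norm e"
  have bound: "norm (s k z) \<le> \<bar>C\<bar> * indicator (cball 0 r) z" for k z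
  proof (cases "norm z \<le> r")
    case True
    have "\<bar>f (z + t k *\<^sub>R e) - f z\<bar> \<le> C * t k"
      by (rule C) (use t in auto)
    also have "\<dots> \<le> \<bar>C\<bar> * t k"
      using t(1)[of k] by (intro mult_right_mono) auto
    finally show ?thesis
      using True t(1)[of k] by (simp add: s_def field_simps)
  next
    case False
    have "norm (t k *\<^sub>R e) \<le> norm e"
      using t[of k] by (simp add: mult_left_le_one_le)
    moreover have "norm z \<le> norm (z + t k *\<^sub>R e) + norm (t k *\<^sub>R e)"
      by (metis add_diff_cancel norm_triangle_ineq4)
    ultimately have "norm (z + t k *\<^sub>R e) > R" "norm z > R"
      using False norm_ge_zero[of e] unfolding r_def by linarith+
    then show ?thesis using False R by (simp add: s_def)
  qed
  have "emeasure lborel (cball 0 r :: 'a set) < top"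
    using emeasure_bounded_finite[of "cball 0 r :: 'a set"] by simp
  then have w: "integrable lebesgue (\<lambda>z::'a. \<bar>C\<bar> * indicator (cball 0 r) z :: real)"
    by (intro integrable_mult_right integrable_real_indicator) auto
  show "integrable lebesgue g"
    by (rule integrable_dominated_convergence[OF gm _ w s_lim])
      (use s_int bound in \<open>auto intro: borel_measurable_integrable\<close>)
  have "(\<lambda>k. \<integral>z. s k z \<partial>lebesgue) \<longlonglongrightarrow> (\<integral>z. g z \<partial>lebesgue)"
    by (rule integral_dominated_convergence[OF gm _ w s_lim])
      (use s_int bound in \<open>auto intro: borel_measurable_integrable\<close>)
  moreover have "(\<integral>z. s k z \<partial>lebesgue) = 0" for k
  proof -
    have "(\<integral>z. s k z \<partial>lebesgue) = ((\<integral>z. f (z + t k *\<^sub>R e) \<partial>lebesgue) - (\<integral>z. f z \<partial>lebesgue)) / t k"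
      by (simp add: s_def Bochner_Integration.integral_diff[OF shift f])
    then show ?thesis
      using integral_lebesgue_affine[OF fm, of 1 "t k *\<^sub>R e"] by (simp add: add.commute)
  qed
  ultimately show "(\<integral>z. g z \<partial>lebesgue) = 0"
    by (simp add: LIMSEQ_const_iff)
qed

section \<open>Derivatives of test functions and of Lipschitz maps\<close>

lemma test_functionD:
  assumes "\<phi> \<in> test_functions U"
  shows "Ck_on k UNIV \<phi>" and "compact (closure {z. \<phi> z \<noteq> 0})" and "closure {z. \<phi> z \<noteq> 0} \<subseteq> U"
    and "(\<phi> has_derivative frechet_derivative \<phi> (at z)) (at z)"
    and "continuous_on UNIV (\<lambda>z. frechet_derivative \<phi> (at z) v)"
proof -
  show "Ck_on k UNIV \<phi>" and "compact (closure {z. \<phi> z \<noteq> 0})" and "closure {z. \<phi> z \<noteq> 0} \<subseteq> U" for k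
    using assms unfolding test_functions_def by auto
  from this(1)[of "Suc 0"] show "(\<phi> has_derivative frechet_derivative \<phi> (at z)) (at z)"
    and "continuous_on UNIV (\<lambda>z. frechet_derivative \<phi> (at z) v)"
    by (rule Ck_on_has_derivative, simp)
qed

lemma derivative_zero_off_support:
  assumes "z \<notin> closure {z. \<phi> z \<noteq> 0}"
  shows "frechet_derivative \<phi> (at z) = (\<lambda>h. 0)"
proof -
  have "((\<lambda>_. 0) has_derivative (\<lambda>h. 0)) (at z)" by simp
  then have "(\<phi> has_derivative (\<lambda>h. 0)) (at z)"
    by (rule has_derivative_transform_within_open[where s = "- closure {z. \<phi> z \<noteq> 0}"])
      (use assms closure_subset[of "{z. \<phi> z \<noteq> 0}"] in \<open>auto simp: open_Compl\<close>)
  then show ?thesis by (metis frechet_derivative_at)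
qed

text \<open>Each partial derivative is continuous on the compact support and zero elsewhere, hence
  bounded; the sum of these bounds over the basis serves both as a bound for the derivative and, by
  the mean value inequality, as a Lipschitz constant.\<close>

lemma test_function_lipschitz:
  assumes "\<phi> \<in> test_functions U"
  obtains L where "L \<ge> 0" and "\<And>z h. norm (frechet_derivative \<phi> (at z) h) \<le> L * norm h"
    and "\<And>x y. norm (\<phi> x - \<phi> y) \<le> L * norm (x - y)"
proof -
  let ?K = "closure {z. \<phi> z \<noteq> 0}"
  note D = test_functionD[OF assms]
  have "\<exists>B. \<forall>z. norm (frechet_derivative \<phi> (at z) b) \<le> B" for b
  proof -
    obtain B where "B \<ge> 0" and B: "\<And>z. z \<in> ?K \<Longrightarrow> norm (frechet_derivative \<phi> (at z) b) \<le> B"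
      using continuous_bounded_on_compact[OF D(2) continuous_on_subset[OF D(5)[of b] subset_UNIV]] by metis
    have "norm (frechet_derivative \<phi> (at z) b) \<le> max B 0" for z
      using B[of z] derivative_zero_off_support[of z \<phi>] by (cases "z \<in> ?K") auto
    then show ?thesis by blast
  qed
  then obtain B where B: "\<And>z b. norm (frechet_derivative \<phi> (at z) b) \<le> B b"
    by metis
  define L where "L = (\<Sum>b\<in>Basis. B b)"
  have bd: "norm (frechet_derivative \<phi> (at z) h) \<le> L * norm h" for z h
  proof -
    have lin: "linear (frechet_derivative \<phi> (at z))"
      using D(4) has_derivative_linear by blast
    have "frechet_derivative \<phi> (at z) h = frechet_derivative \<phi> (at z) (\<Sum>b\<in>Basis. (h \<bullet> b) *\<^sub>R b)"
      by (simp add: euclidean_representation)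
    also have "\<dots> = (\<Sum>b\<in>Basis. (h \<bullet> b) *\<^sub>R frechet_derivative \<phi> (at z) b)"
      by (simp add: linear_sum[OF lin] linear_scale[OF lin])
    also have "norm \<dots> \<le> (\<Sum>b\<in>Basis. norm h * B b)"
      by (intro sum_norm_le) (auto intro!: mult_mono B simp: Basis_le_norm)
    finally show ?thesis by (simp add: L_def sum_distrib_left mult.commute)
  qed
  have "L \<ge> 0"
    unfolding L_def by (intro sum_nonneg) (metis B norm_ge_zero order_trans)
  moreover have "norm (\<phi> x - \<phi> y) \<le> L * norm (x - y)" for x y
    by (rule differentiable_bound[of UNIV \<phi> "\<lambda>z. frechet_derivative \<phi> (at z)"])
      (use D(4) bd in \<open>auto intro!: onorm_le\<close>)
  ultimately show thesis using that bd by blast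
qed

lemma test_function_bounded:
  assumes "\<phi> \<in> test_functions U"
  obtains M where "M \<ge> 0" and "\<And>z. norm (\<phi> z) \<le> M"
proof -
  have "continuous_on UNIV \<phi>"
    using test_functionD(1)[OF assms, of 0] by simp
  from continuous_bounded_on_compact[OF test_functionD(2)[OF assms] continuous_on_subset[OF this subset_UNIV]]
  obtain M where "norm (\<phi> z) \<le> M" if "z \<in> closure {z. \<phi> z \<noteq> 0}" for z by metis
  then have "norm (\<phi> z) \<le> max M 0" for z
    using closure_subset[of "{z. \<phi> z \<noteq> 0}"] by (cases "\<phi> z = 0") fastforce+
  then show thesis using that[of "max M 0"] by auto
qed

lemma lebesgue_measurable_continuous:
  "continuous_on UNIV f \<Longrightarrow> f \<in> borel_measurable lebesgue"
  for f :: "'a::euclidean_space \<Rightarrow> 'b::euclidean_space"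
  by (simp add: borel_measurable_continuous_onI measurable_completion)

lemma lipschitz_imp_continuous:
  assumes "\<And>x z. norm (y x - y z) \<le> L * norm (x - z)"
  shows "continuous_on UNIV y"
proof -
  have "dist (y x) (y z) \<le> \<bar>L\<bar> * dist x z" for x z
    using assms[of x z] mult_right_mono[OF abs_ge_self norm_ge_zero, of L "x - z"]
    by (simp add: dist_norm)
  then have "\<bar>L\<bar>-lipschitz_on UNIV y"
    by (auto intro!: lipschitz_onI)
  then show ?thesis by (rule lipschitz_on_continuous_on)
qed

lemma matrix_vector_mult_axis: "(A :: real^'d^'m) *v axis j 1 = column j A"
  by (simp add: matrix_vector_mult_basis)

lemma borel_measurable_matrixI:
  fixes G :: "'a \<Rightarrow> real^'d^'m"
  assumes "\<And>i j. (\<lambda>z. G z $ i $ j) \<in> borel_measurable M"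
  shows "G \<in> borel_measurable M"
  using assms
  by (auto simp: borel_measurable_euclidean_space[of G] Basis_vec_def inner_axis
      borel_measurable_euclidean_space[of "\<lambda>z. G z $ _"])

lemma matrix_derivative_line:
  fixes y :: "real^'d \<Rightarrow> real^'m"
  assumes "(y has_derivative (\<lambda>h. A *v h)) (at z)"
  shows "((\<lambda>t. y (z + t *\<^sub>R axis j 1) $ i) has_real_derivative A $ i $ j) (at 0)"
  using bounded_linear.has_derivative[OF bounded_linear_vec_nth has_derivative_line[OF assms, of "axis j 1"], of i]
  by (simp add: has_field_derivative_def matrix_vector_mult_scaleR matrix_vector_mult_axis column_def mult.commute
      mult_commute_abs)

text \<open>Each entry is almost everywhere the limit of continuous difference quotients along a
  coordinate axis. On the exceptional null set the values of \<open>D\<close> are arbitrary.\<close>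

lemma derivative_matrix_measurable:
  fixes y :: "real^'d \<Rightarrow> real^'m"
  assumes "continuous_on UNIV y" and "AE z in lebesgue. (y has_derivative (\<lambda>h. D z *v h)) (at z)"
  shows "D \<in> borel_measurable lebesgue"
proof (rule borel_measurable_matrixI)
  fix i :: 'm and j :: 'd
  define t where "t k = 1 / (real k + 1)" for k
  have t: "0 < t k" for k
    by (auto simp: t_def)
  have t_lim: "filterlim t (at 0) sequentially"
    unfolding t_def by (rule filterlim_inverse_Suc_at_0)
  define s where "s k z = (y (z + t k *\<^sub>R axis j 1) $ i - y z $ i) / t k" for k z
  show "(\<lambda>z. D z $ i $ j) \<in> borel_measurable lebesgue"
  proof (rule borel_measurable_AE_limit)
    have "continuous_on UNIV (s k)" for k
      unfolding s_def
      by (intro continuous_intros continuous_on_compose2[OF assms(1)] assms(1)) (use t in \<open>auto simp: less_imp_neq[symmetric]\<close>)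
    then show "s k \<in> borel_measurable lebesgue" for k
      by (rule lebesgue_measurable_continuous)
    show "AE z in lebesgue. (\<lambda>k. s k z) \<longlonglongrightarrow> D z $ i $ j"
      using assms(2)
    proof eventually_elim
      case (elim z)
      have "((\<lambda>h. (y (z + h *\<^sub>R axis j 1) $ i - y z $ i) / h) \<longlongrightarrow> D z $ i $ j) (at 0)"
        using matrix_derivative_line[OF elim, of j i] by (simp add: DERIV_def)
      from filterlim_compose[OF this t_lim] show ?case
        by (simp add: s_def)
    qed
  qed
qed

section \<open>Lipschitz maps in the definition of the envelope\<close>

lemma integral_lebesgue_on_eq:
  fixes f :: "'a::euclidean_space \<Rightarrow> 'b::euclidean_space"
  assumes "U \<in> sets lebesgue" and "\<And>z. z \<notin> U \<Longrightarrow> f z = 0"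
  shows "(\<integral>z. f z \<partial>lebesgue_on U) = (\<integral>z. f z \<partial>lebesgue)"
proof -
  have "(\<integral>z. f z \<partial>lebesgue_on U) = (\<integral>z. (if z \<in> U then f z else 0) \<partial>lebesgue)"
    using assms(1) by (rule Lebesgue_Measure.integral_restrict_UNIV[symmetric])
  also have "(\<lambda>z. if z \<in> U then f z else 0) = f"
    using assms(2) by auto
  finally show ?thesis .
qed

text \<open>Every entry is a limit of difference quotients of modulus at most |L|, and the norm is
  at most the sum of the moduli of the entries. The factor is crude; what matters is that it depends
  on nothing but the dimensions.\<close>

lemma derivative_matrix_norm_le:
  fixes y :: "real^'d \<Rightarrow> real^'m"
  assumes L: "\<And>x z. norm (y x - y z) \<le> L * norm (x - z)"
    and D: "(y has_derivative (\<lambda>h. A *v h)) (at z)"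
  shows "norm A \<le> real CARD('m) * real CARD('d) * \<bar>L\<bar>"
proof -
  have *: "\<bar>A $ i $ j\<bar> \<le> \<bar>L\<bar>" for i j
  proof -
    have lim: "((\<lambda>h. \<bar>(y (z + h *\<^sub>R axis j 1) $ i - y z $ i) / h\<bar>) \<longlongrightarrow> \<bar>A $ i $ j\<bar>) (at 0)"
      using matrix_derivative_line[OF D, of j i] by (intro tendsto_rabs) (simp add: DERIV_def)
    show ?thesis
    proof (rule tendsto_upperbound[OF lim])
      have "\<bar>(y (z + h *\<^sub>R axis j 1) $ i - y z $ i) / h\<bar> \<le> \<bar>L\<bar>" if "h \<noteq> 0" for h
      proof -
        have "\<bar>y (z + h *\<^sub>R axis j 1) $ i - y z $ i\<bar> \<le> norm (y (z + h *\<^sub>R axis j 1) - y z)"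
          by (metis component_le_norm_cart vector_minus_component)
        also have "\<dots> \<le> L * norm (h *\<^sub>R axis j 1 :: real^'d)"
          using L[of "z + h *\<^sub>R axis j 1" z] by simp
        also have "\<dots> \<le> \<bar>L\<bar> * \<bar>h\<bar>"
          by (simp add: mult_right_mono)
        finally show ?thesis using that by (simp add: field_simps)
      qed
      then show "\<forall>\<^sub>F h in at 0. \<bar>(y (z + h *\<^sub>R axis j 1) $ i - y z $ i) / h\<bar> \<le> \<bar>L\<bar>"
        by (auto simp: eventually_at_filter)
    qed simp
  qed
  have "norm A \<le> (\<Sum>i\<in>UNIV. norm (A $ i))"
    by (simp add: norm_vec_def L2_set_le_sum)
  also have "\<dots> \<le> (\<Sum>i\<in>(UNIV::'m set). \<Sum>j\<in>(UNIV::'d set). \<bar>L\<bar>)"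
  proof (rule sum_mono)
    fix i
    have "norm (A $ i) \<le> (\<Sum>j\<in>UNIV. \<bar>A $ i $ j\<bar>)"
      by (rule norm_le_l1_cart)
    also have "\<dots> \<le> (\<Sum>j\<in>(UNIV::'d set). \<bar>L\<bar>)"
      by (intro sum_mono *)
    finally show "norm (A $ i) \<le> (\<Sum>j\<in>(UNIV::'d set). \<bar>L\<bar>)" .
  qed
  finally show ?thesis by simp
qed

text \<open>The product of a component of y with a test function is Lipschitz with bounded support,
  and the vanishing integral of its directional derivative is the defining identity of the weak
  gradient. Differentiability almost everywhere is a hypothesis; the competitors satisfy it by
  construction, off finitely many hyperplanes.\<close>

lemma lipschitz_weak_gradient:
  fixes y :: "real^'d \<Rightarrow> real^'m"
  assumes L: "\<And>x z. norm (y x - y z) \<le> L * norm (x - z)"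
    and D: "AE z in lebesgue. (y has_derivative (\<lambda>h. D z *v h)) (at z)"
    and U: "U \<in> sets lebesgue"
  shows "weak_gradient_on U y D"
  unfolding weak_gradient_on_def
proof (intro allI impI)
  fix \<psi> :: "real^'d \<Rightarrow> real" and i :: 'm and j :: 'd
  assume \<psi>: "\<psi> \<in> test_functions U"
  let ?e = "axis j 1 :: real^'d" and ?K = "closure {z. \<psi> z \<noteq> 0}"
  define \<psi>' where "\<psi>' z = frechet_derivative \<psi> (at z) (axis j 1)" for z
  note T = test_functionD[OF \<psi>]
  obtain L' where L': "L' \<ge> 0" "\<And>x y. norm (\<psi> x - \<psi> y) \<le> L' * norm (x - y)"
    and L'd: "\<And>z h. norm (frechet_derivative \<psi> (at z) h) \<le> L' * norm h"
    using test_function_lipschitz[OF \<psi>] by metis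
  obtain M where M: "M \<ge> 0" "\<And>z. norm (\<psi> z) \<le> M"
    using test_function_bounded[OF \<psi>] by blast
  obtain R0 where R0: "\<And>z. z \<in> ?K \<Longrightarrow> norm z \<le> R0"
    using compact_imp_bounded[OF T(2)] unfolding bounded_iff by auto
  define R where "R = max R0 0"
  have R: "\<psi> z = 0" "\<psi>' z = 0" if "norm z > R" for z
  proof -
    have "z \<notin> ?K" using R0[of z] that unfolding R_def by auto
    then show "\<psi> z = 0" "\<psi>' z = 0"
      using closure_subset[of "{z. \<psi> z \<noteq> 0}"] derivative_zero_off_support[of z \<psi>]
      by (auto simp: \<psi>'_def)
  qed
  have yc: "continuous_on UNIV y" by (rule lipschitz_imp_continuous[OF L])
  have Dm: "D \<in> borel_measurable lebesgue" by (rule derivative_matrix_measurable[OF yc D])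
  have "\<psi>' \<in> borel_measurable lebesgue"
    unfolding \<psi>'_def by (rule lebesgue_measurable_continuous[OF T(5)])
  have "continuous_on UNIV \<psi>" using T(1)[of 0] by simp
  \<comment> \<open>Bounds |y_i| on a ball larger by 1 than the support of \<psi>, since difference
    quotients of the product look at shifts of length up to 1.\<close>
  define Y where "Y = norm (y 0) + \<bar>L\<bar> * (R + 1)"
  have Y: "\<bar>y z $ i\<bar> \<le> Y" if "norm z \<le> R + 1" for z
  proof -
    have "\<bar>y z $ i\<bar> \<le> norm (y z)" by (rule component_le_norm_cart)
    also have "\<dots> \<le> norm (y 0) + norm (y z - y 0)" by (simp add: norm_triangle_sub)
    also have "norm (y z - y 0) \<le> \<bar>L\<bar> * norm z"
      using L[of z 0] mult_right_mono[OF abs_ge_self norm_ge_zero, of L z] by simp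
    also have "\<bar>L\<bar> * norm z \<le> \<bar>L\<bar> * (R + 1)" using that by (rule mult_left_mono) simp
    finally show ?thesis by (simp add: Y_def)
  qed
  have Y0: "Y \<ge> 0" by (simp add: Y_def R_def)
  have lm: "cball (0::real^'d) R \<in> lmeasurable" by (rule lmeasurable_cball)
  define f where "f z = y z $ i * \<psi> z" for z
  have yi: "continuous_on UNIV (\<lambda>z. y z $ i)" by (intro continuous_intros yc)
  have f_int: "integrable lebesgue f"
  proof (rule integrable_bounded_support[OF _ lm])
    show "f \<in> borel_measurable lebesgue"
      unfolding f_def by (intro lebesgue_measurable_continuous continuous_intros yi \<open>continuous_on UNIV \<psi>\<close>)
    show "AE z in lebesgue. z \<notin> cball 0 R \<longrightarrow> f z = 0"
      using R by (auto simp: f_def)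
    have "\<bar>f z\<bar> \<le> Y * M" for z
    proof (cases "norm z \<le> R")
      case True
      then show ?thesis unfolding f_def abs_mult by (intro mult_mono Y) (use M Y0 in auto)
    next
      case False
      then show ?thesis using R M(1) Y0 by (simp add: f_def)
    qed
    then show "AE z in lebesgue. norm (f z) \<le> Y * M" by simp
  qed
  define g where "g z = D z $ i $ j * \<psi> z + y z $ i * \<psi>' z" for z
  have int1: "integrable lebesgue (\<lambda>z. y z $ i * \<psi>' z)"
  proof (rule integrable_bounded_support[OF _ lm])
    show "(\<lambda>z. y z $ i * \<psi>' z) \<in> borel_measurable lebesgue"
      unfolding \<psi>'_def by (intro lebesgue_measurable_continuous continuous_intros yi T(5))
    show "AE z in lebesgue. z \<notin> cball 0 R \<longrightarrow> y z $ i * \<psi>' z = 0"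
      using R by auto
    have "\<bar>y z $ i * \<psi>' z\<bar> \<le> Y * L'" for z
    proof (cases "norm z \<le> R")
      case True
      then show ?thesis unfolding abs_mult
        by (intro mult_mono Y) (use L'd[of z ?e] Y0 in \<open>auto simp: \<psi>'_def\<close>)
    next
      case False
      then show ?thesis using R L'(1) Y0 by simp
    qed
    then show "AE z in lebesgue. norm (y z $ i * \<psi>' z) \<le> Y * L'" by simp
  qed
  have fs: "\<bar>f (z + t *\<^sub>R ?e) - f z\<bar> \<le> (\<bar>L\<bar> * M + Y * L') * t" if t: "0 < t" "t \<le> 1" for z t
  proof (cases "norm z \<le> R + 1")
    case True
    let ?w = "z + t *\<^sub>R ?e"
    have "\<bar>y ?w $ i - y z $ i\<bar> \<le> norm (y ?w - y z)"
      by (metis component_le_norm_cart vector_minus_component)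
    also have "\<dots> \<le> L * t"
      using L[of ?w z] t by simp
    also have "\<dots> \<le> \<bar>L\<bar> * t"
      by (rule mult_right_mono) (use t in auto)
    finally have a: "\<bar>(y ?w $ i - y z $ i) * \<psi> ?w\<bar> \<le> \<bar>L\<bar> * t * M"
      unfolding abs_mult by (intro mult_mono) (use M t in auto)
    have b: "\<bar>y z $ i * (\<psi> ?w - \<psi> z)\<bar> \<le> Y * (L' * t)"
      unfolding abs_mult by (intro mult_mono Y True) (use L'(2)[of ?w z] t Y0 in auto)
    have "f ?w - f z = (y ?w $ i - y z $ i) * \<psi> ?w + y z $ i * (\<psi> ?w - \<psi> z)"
      by (simp add: f_def algebra_simps)
    then have "\<bar>f ?w - f z\<bar> \<le> \<bar>L\<bar> * t * M + Y * (L' * t)" using a b by linarith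
    then show ?thesis by (simp add: algebra_simps)
  next
    case False
    have "norm z \<le> norm (z + t *\<^sub>R ?e) + norm (t *\<^sub>R ?e)"
      by (metis add_diff_cancel norm_triangle_ineq4)
    then have "norm (z + t *\<^sub>R ?e) > R" "norm z > R"
      using False t by simp_all
    then show ?thesis using R t M(1) L'(1) Y0 by (simp add: f_def)
  qed
  have fd: "AE z in lebesgue. ((\<lambda>t. f (z + t *\<^sub>R ?e)) has_real_derivative g z) (at 0)"
    using D
  proof eventually_elim
    case (elim z)
    have 1: "((\<lambda>t. y (z + t *\<^sub>R ?e) $ i) has_real_derivative D z $ i $ j) (at 0)"
      by (rule matrix_derivative_line[OF elim])
    have "((\<lambda>t. \<psi> (z + t *\<^sub>R ?e)) has_derivative (\<lambda>t. frechet_derivative \<psi> (at z) (t *\<^sub>R ?e))) (at 0)"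
      by (rule has_derivative_line[OF T(4)])
    then have 2: "((\<lambda>t. \<psi> (z + t *\<^sub>R ?e)) has_real_derivative \<psi>' z) (at 0)"
      unfolding has_field_derivative_def \<psi>'_def
      using linear_scale[OF has_derivative_linear[OF T(4)[of z]]] by (simp add: mult.commute mult_commute_abs)
    show ?case
      unfolding f_def g_def using DERIV_mult[OF 1 2] by (simp add: algebra_simps)
  qed
  have gi: "integrable lebesgue g" and g0: "(\<integral>z. g z \<partial>lebesgue) = 0"
    using integral_directional_derivative_eq_0[OF f_int _ fs fd, of R] R by (auto simp: f_def)
  have int2: "integrable lebesgue (\<lambda>z. D z $ i $ j * \<psi> z)"
    using Bochner_Integration.integrable_diff[OF gi int1] by (simp add: g_def)
  have zero: "\<psi> z = 0" "\<psi>' z = 0" if "z \<notin> U" for z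
  proof -
    have "z \<notin> ?K" using that T(3) by auto
    then show "\<psi> z = 0" "\<psi>' z = 0"
      using closure_subset[of "{z. \<psi> z \<noteq> 0}"] derivative_zero_off_support[of z \<psi>]
      by (auto simp: \<psi>'_def)
  qed
  have "(\<integral>z. y z $ i * \<psi>' z \<partial>lebesgue_on U) = (\<integral>z. y z $ i * \<psi>' z \<partial>lebesgue)"
    by (rule integral_lebesgue_on_eq[OF U]) (use zero in simp)
  moreover have "(\<integral>z. D z $ i $ j * \<psi> z \<partial>lebesgue_on U) = (\<integral>z. D z $ i $ j * \<psi> z \<partial>lebesgue)"
    by (rule integral_lebesgue_on_eq[OF U]) (use zero in simp)
  moreover have "(\<integral>z. g z \<partial>lebesgue) = (\<integral>z. D z $ i $ j * \<psi> z \<partial>lebesgue) + (\<integral>z. y z $ i * \<psi>' z \<partial>lebesgue)"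
    unfolding g_def by (rule Bochner_Integration.integral_add[OF int2 int1])
  ultimately show "(\<integral>z. y z $ i * frechet_derivative \<psi> (at z) (axis j 1) \<partial>lebesgue_on U) =
       - (\<integral>z. D z $ i $ j * \<psi> z \<partial>lebesgue_on U)"
    using g0 by (simp add: \<psi>'_def)
qed

lemma indicator_ball_integral:
  "integrable lebesgue (\<lambda>z::'a::euclidean_space. K * indicator (ball c r) z :: real)"
  "(\<integral>z. K * indicator (ball c r) (z::'a) \<partial>lebesgue) = K * measure lebesgue (ball c r)"
  using emeasure_bounded_finite[OF bounded_ball[of c r]]
  by (intro integrable_mult_right integrable_real_indicator) auto

lemma continuous_bounded_on_cball:
  fixes W :: "'b::euclidean_space \<Rightarrow> real"
  assumes "continuous_on UNIV W"
  obtains K where "\<And>X. norm X \<le> C \<Longrightarrow> \<bar>W X\<bar> \<le> K"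
proof -
  obtain K where "\<And>X. X \<in> cball 0 C \<Longrightarrow> norm (W X) \<le> K"
    using continuous_bounded_on_compact[OF compact_cball continuous_on_subset[OF assms subset_UNIV]] by metis
  then show thesis by (intro that[of K]) simp
qed

lemma compose_continuous_bounded:
  fixes W :: "'b::euclidean_space \<Rightarrow> real" and G :: "'a \<Rightarrow> 'b"
  assumes W: "continuous_on UNIV W" and C: "AE z in M. norm (G z) \<le> C"
  obtains K where "K \<ge> 0" and "AE z in M. \<bar>W (G z)\<bar> \<le> K"
proof -
  obtain K where K: "\<And>X. norm X \<le> C \<Longrightarrow> \<bar>W X\<bar> \<le> K"
    using continuous_bounded_on_cball[OF W] by blast
  have "AE z in M. \<bar>W (G z)\<bar> \<le> max K 0"
    using C by eventually_elim (use K in \<open>auto simp: le_max_iff_disj\<close>)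
  then show thesis by (intro that[of "max K 0"]) auto
qed

lemma L_infinity_compose_integrable:
  fixes W :: "real^'d^'m \<Rightarrow> real" and G :: "real^'d \<Rightarrow> real^'d^'m"
  assumes W: "continuous_on UNIV W" and G: "G \<in> L_infinity U" and U: "U \<in> lmeasurable"
  shows "integrable (lebesgue_on U) (\<lambda>z. W (G z))"
proof -
  have Gm: "G \<in> borel_measurable (lebesgue_on U)"
    using G by (simp add: L_infinity_def)
  obtain C where C: "AE z in lebesgue_on U. norm (G z) \<le> C"
    using G by (auto simp: L_infinity_def)
  obtain K where K: "AE z in lebesgue_on U. \<bar>W (G z)\<bar> \<le> K"
    using compose_continuous_bounded[OF W C] by blast
  have "W \<in> borel_measurable borel" using W by (rule borel_measurable_continuous_onI)
  then have m: "(\<lambda>z. W (G z)) \<in> borel_measurable (lebesgue_on U)"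
    using Gm by measurable
  interpret finite_measure "lebesgue_on U"
    using U by (rule finite_measure_lebesgue_on)
  show ?thesis
    by (rule integrable_const_bound[OF _ m, of K]) (use K in simp)
qed

lemma measure_unit_ball_pos: "measure lebesgue (ball (0::real^'d) 1) > 0"
  by (simp add: content_ball_pos)

lemma lipschitz_W1_infinity:
  fixes y :: "real^'d \<Rightarrow> real^'m"
  assumes L: "\<And>x z. norm (y x - y z) \<le> L * norm (x - z)"
    and D: "AE z in lebesgue. (y has_derivative (\<lambda>h. D z *v h)) (at z)"
    and U: "U \<in> sets lebesgue" "bounded U"
  shows "W1_infinity U y D"
proof -
  obtain R where R: "\<And>z. z \<in> U \<Longrightarrow> norm z \<le> R" using U(2) unfolding bounded_iff by auto
  have yc: "continuous_on UNIV y" by (rule lipschitz_imp_continuous[OF L])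
  have "norm (y z) \<le> norm (y 0) + \<bar>L\<bar> * R" if "z \<in> U" for z
  proof -
    have "norm (y z) \<le> norm (y 0) + norm (y z - y 0)" by (simp add: norm_triangle_sub)
    also have "norm (y z - y 0) \<le> L * norm z" using L[of z 0] by simp
    also have "L * norm z \<le> \<bar>L\<bar> * norm z" by (rule mult_right_mono) auto
    also have "\<bar>L\<bar> * norm z \<le> \<bar>L\<bar> * R" using R[OF that] by (rule mult_left_mono) simp
    finally show ?thesis by simp
  qed
  then have "y \<in> L_infinity U"
    unfolding L_infinity_def using lebesgue_measurable_continuous[OF yc] U(1)
    by (auto intro!: exI[of _ "norm (y 0) + \<bar>L\<bar> * R"] AE_I2 measurable_restrict_space1 simp: space_restrict_space)
  moreover have "D \<in> L_infinity U"
  proof -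
    have "AE z in lebesgue. norm (D z) \<le> real CARD('m) * real CARD('d) * \<bar>L\<bar>"
      using D by eventually_elim (rule derivative_matrix_norm_le[OF L])
    then have "AE z in lebesgue_on U. norm (D z) \<le> real CARD('m) * real CARD('d) * \<bar>L\<bar>"
      using U(1) by (simp add: AE_restrict_space_iff) (erule AE_mp, simp)
    then show ?thesis
      unfolding L_infinity_def using derivative_matrix_measurable[OF yc D]
      by (auto intro: measurable_restrict_space1)
  qed
  moreover have "weak_gradient_on U y D"
    by (rule lipschitz_weak_gradient[OF L D U(1)])
  ultimately show ?thesis by (simp add: W1_infinity_def)
qed

lemma matrix_vector_lipschitz:
  "norm (F *v x - F *v z) \<le> onorm ((*v) F) * norm (x - z)" for F :: "real^'d^'m"
  using onorm[of "(*v) F" "x - z"]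
  by (simp add: matrix_vector_mult_diff_distrib matrix_vector_mul_bounded_linear)

lemma W1_infinity_linear:
  fixes F :: "real^'d^'m"
  assumes "U \<in> sets lebesgue" and "bounded U"
  shows "W1_infinity U (\<lambda>z. F *v z) (\<lambda>_. F)"
  by (rule lipschitz_W1_infinity[OF matrix_vector_lipschitz _ assms])
    (simp add: bounded_linear_imp_has_derivative matrix_vector_mul_bounded_linear)

lemma average_ge:
  assumes "integrable (lebesgue_on U) f" and "U \<in> lmeasurable" and "measure lebesgue U > 0"
    and "\<And>z. f z \<ge> b"
  shows "average U f \<ge> b"
proof -
  interpret finite_measure "lebesgue_on U"
    using assms(2) by (rule finite_measure_lebesgue_on)
  have "(\<integral>z. b \<partial>lebesgue_on U) \<le> (\<integral>z. f z \<partial>lebesgue_on U)"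
    using assms by (intro integral_mono) auto
  moreover have "(\<integral>z. b \<partial>lebesgue_on U) = b * measure lebesgue U"
    using assms(2) measure_restrict_space[of U lebesgue U] by (simp add: fmeasurableD)
  ultimately show ?thesis
    using assms(3) by (auto simp: average_def field_simps)
qed

text \<open>The affine map is admissible with average W F, so the infimum never exceeds W F, and
  equality means that W F is a lower bound. That W is bounded from below makes the set of averages
  bounded from below, as \<open>Inf\<close> on the reals requires.\<close>

lemma quasiconvex_envelope_eq_iff:
  fixes W :: "real^'d^'m \<Rightarrow> real"
  assumes W: "continuous_on UNIV W" and b: "bdd_below (range W)"
  shows "quasiconvex_envelope W F = W F \<longleftrightarrow>
    (\<forall>y G. W1_infinity (ball 0 1) y G \<and> continuous_on (cball 0 1) y \<and> (\<forall>z\<in>sphere 0 1. y z = F *v z)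
      \<longrightarrow> average (ball 0 1) (\<lambda>z. W (G z)) \<ge> W F)"
proof -
  let ?A = "\<lambda>y G. W1_infinity (ball 0 1) y G \<and> continuous_on (cball 0 1) y \<and> (\<forall>z\<in>sphere 0 1. y z = F *v z)"
  let ?S = "{average (ball 0 1) (\<lambda>z. W (G z)) | y G. ?A y G}"
  obtain c where c: "\<And>X. W X \<ge> c" using b unfolding bdd_below_def by auto
  have below: "bdd_below ?S"
    unfolding bdd_below_def
  proof (intro exI[of _ c] ballI)
    fix x assume "x \<in> ?S"
    then obtain y G where x: "x = average (ball 0 1) (\<lambda>z. W (G z))" and "?A y G" by blast
    then have "G \<in> L_infinity (ball 0 1)" by (simp add: W1_infinity_def)
    then show "c \<le> x" unfolding x
      by (intro average_ge L_infinity_compose_integrable W) (auto simp: c content_ball_pos)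
  qed
  have "?A (\<lambda>z. F *v z) (\<lambda>_. F)"
    using W1_infinity_linear[of "ball 0 1" F]
    by (auto intro!: linear_continuous_on matrix_vector_mul_bounded_linear)
  moreover have "average (ball 0 1 :: (real^'d) set) (\<lambda>z. W F) = W F"
    using measure_unit_ball_pos[where 'd = 'd] by (simp add: average_def measure_restrict_space)
  ultimately have mem: "W F \<in> ?S" by force
  have "Inf ?S = W F \<longleftrightarrow> (\<forall>x\<in>?S. W F \<le> x)"
  proof
    assume eq: "Inf ?S = W F"
    show "\<forall>x\<in>?S. W F \<le> x"
    proof
      fix x assume "x \<in> ?S"
      from cInf_lower[OF this below] show "W F \<le> x" unfolding eq .
    qed
  next
    assume "\<forall>x\<in>?S. W F \<le> x"
    then show "Inf ?S = W F" by (intro cInf_eq_minimum mem) auto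
  qed
  moreover have "(\<forall>x\<in>{f G | y G. A y G}. c \<le> x) \<longleftrightarrow> (\<forall>y G. A y G \<longrightarrow> f G \<ge> c)"
    for f :: "(real^'d \<Rightarrow> real^'d^'m) \<Rightarrow> real" and A :: "(real^'d \<Rightarrow> real^'m) \<Rightarrow> _ \<Rightarrow> bool" and c
    by auto
  ultimately show ?thesis unfolding quasiconvex_envelope_def by (simp only:)
qed

lemma derivative_eq_0_off_support:
  fixes v :: "real^'d \<Rightarrow> real^'m"
  assumes "\<And>z. norm z > R \<Longrightarrow> v z = 0" and "(v has_derivative (\<lambda>h. A *v h)) (at z)" and "norm z > R"
  shows "A = 0"
proof -
  have "((\<lambda>_. 0) has_derivative (\<lambda>h. 0)) (at z)" by simp
  then have "(v has_derivative (\<lambda>h. 0)) (at z)"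
    by (rule has_derivative_transform_within_open[where s = "- cball 0 R"]) (use assms in auto)
  from has_derivative_unique[OF assms(2) this] show ?thesis
    by (metis matrix_eq matrix_vector_mult_0)
qed

text \<open>The dilation z -> r z, compensated by the factor 1/r, shrinks the support into the unit
  ball and leaves the set of gradients unchanged. Quasiconvexity thereby becomes available for
  perturbations with supports of any size, such as layers over ever more cells.\<close>

lemma quasiconvexity_lipschitz:
  fixes W :: "real^'d^'m \<Rightarrow> real" and v :: "real^'d \<Rightarrow> real^'m"
  assumes W: "continuous_on UNIV W" "bdd_below (range W)" and Q: "quasiconvex_envelope W F = W F"
    and L: "\<And>x z. norm (v x - v z) \<le> L * norm (x - z)"
    and R: "\<And>z. norm z > R \<Longrightarrow> v z = 0"
    and D: "AE z in lebesgue. (v has_derivative (\<lambda>h. D z *v h)) (at z)"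
  shows "integrable lebesgue (\<lambda>z. W (F + D z) - W F)"
    and "0 \<le> (\<integral>z. W (F + D z) - W F \<partial>lebesgue)"
proof -
  define f where "f z = W (F + D z) - W F" for z
  have Dm: "D \<in> borel_measurable lebesgue"
    by (rule derivative_matrix_measurable[OF lipschitz_imp_continuous[OF L] D])
  have Wm: "W \<in> borel_measurable borel" using W(1) by (rule borel_measurable_continuous_onI)
  have fm: "f \<in> borel_measurable lebesgue"
    unfolding f_def using Dm Wm by measurable
  have D0: "AE z in lebesgue. norm z > R \<longrightarrow> D z = 0"
    using D by eventually_elim (auto intro: derivative_eq_0_off_support[OF R])
  have f0: "AE z in lebesgue. norm z > R \<longrightarrow> f z = 0"
    using D0 by eventually_elim (simp add: f_def)
  have "AE z in lebesgue. norm (F + D z) \<le> norm F + real CARD('m) * real CARD('d) * \<bar>L\<bar>"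
    using D
  proof eventually_elim
    case (elim z)
    then show ?case using derivative_matrix_norm_le[OF L elim] norm_triangle_ineq[of F "D z"] by linarith
  qed
  from compose_continuous_bounded[OF W(1) this] obtain K where
    K: "AE z in lebesgue. \<bar>W (F + D z)\<bar> \<le> K" by blast
  show fi: "integrable lebesgue (\<lambda>z. W (F + D z) - W F)"
    unfolding f_def[symmetric]
  proof (rule integrable_bounded_support[OF fm lmeasurable_cball])
    show "AE z in lebesgue. norm (f z) \<le> K + \<bar>W F\<bar>"
      using K by eventually_elim (simp add: f_def)
    show "AE z in lebesgue. z \<notin> cball 0 R \<longrightarrow> f z = 0"
      using f0 by (simp add: not_le)
  qed
  \<comment> \<open>Positive and larger than R even when R is negative.\<close>
  define r where "r = \<bar>R\<bar> + 1"
  have r: "r > 0" "r > R" "r \<noteq> 0" by (auto simp: r_def)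
  define y where "y z = F *v z + (1 / r) *\<^sub>R v (r *\<^sub>R z)" for z
  define G where "G z = F + D (r *\<^sub>R z)" for z
  have "W1_infinity (ball 0 1) y G"
  proof (rule lipschitz_W1_infinity)
    fix x z
    have "y x - y z = (F *v x - F *v z) + (1 / r) *\<^sub>R (v (r *\<^sub>R x) - v (r *\<^sub>R z))"
      by (simp add: y_def algebra_simps)
    then have "norm (y x - y z) \<le> norm (F *v x - F *v z) + (1 / r) * norm (v (r *\<^sub>R x) - v (r *\<^sub>R z))"
      using norm_triangle_ineq[of "F *v x - F *v z" "(1 / r) *\<^sub>R (v (r *\<^sub>R x) - v (r *\<^sub>R z))"] r by simp
    also have "norm (v (r *\<^sub>R x) - v (r *\<^sub>R z)) \<le> L * (r * norm (x - z))"
      using L[of "r *\<^sub>R x" "r *\<^sub>R z"] r by (simp add: scaleR_diff_right[symmetric])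
    finally show "norm (y x - y z) \<le> (onorm ((*v) F) + L) * norm (x - z)"
      using matrix_vector_lipschitz[of F x z] r by (simp add: field_simps)
  next
    have "AE z in lebesgue. (v has_derivative (\<lambda>h. D (0 + r *\<^sub>R z) *v h)) (at (0 + r *\<^sub>R z))"
      by (rule AE_lebesgue_affine[OF D r(3)])
    then show "AE z in lebesgue. (y has_derivative (\<lambda>h. G z *v h)) (at z)"
    proof eventually_elim
      case (elim z)
      have "((\<lambda>z. r *\<^sub>R z) has_derivative (\<lambda>h. r *\<^sub>R h)) (at z)"
        by (auto intro!: derivative_eq_intros)
      from has_derivative_compose[OF this] elim
      have "((\<lambda>z. v (r *\<^sub>R z)) has_derivative (\<lambda>h. D (r *\<^sub>R z) *v (r *\<^sub>R h))) (at z)"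
        by simp
      from has_derivative_add[OF bounded_linear_imp_has_derivative[OF matrix_vector_mul_bounded_linear[of F]]
          has_derivative_scaleR_right[OF this, of "1 / r"]]
      show ?case
        using r by (simp add: y_def[abs_def] G_def matrix_vector_mult_scaleR matrix_vector_mult_add_rdistrib)
    qed
  qed auto
  moreover have "continuous_on (cball 0 1) y"
  proof -
    have "continuous_on UNIV y"
      unfolding y_def by (intro continuous_intros continuous_on_compose2[OF lipschitz_imp_continuous[OF L]]
          linear_continuous_on matrix_vector_mul_bounded_linear) auto
    then show ?thesis by (rule continuous_on_subset) simp
  qed
  moreover have "\<forall>z\<in>sphere 0 1. y z = F *v z"
    using R r by (auto simp: y_def)
  ultimately have avg: "average (ball 0 1) (\<lambda>z. W (G z)) \<ge> W F" and GL: "G \<in> L_infinity (ball 0 1)"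
    using Q quasiconvex_envelope_eq_iff[OF W, of F] by (auto simp: W1_infinity_def)
  interpret finite_measure "lebesgue_on (ball (0::real^'d) 1)"
    by (rule finite_measure_lebesgue_on) simp
  have "integrable (lebesgue_on (ball 0 1)) (\<lambda>z. W (G z))"
    by (rule L_infinity_compose_integrable[OF W(1) GL]) simp
  then have "(\<integral>z. W (G z) - W F \<partial>lebesgue_on (ball 0 1))
      = (\<integral>z. W (G z) \<partial>lebesgue_on (ball 0 1)) - (\<integral>z. W F \<partial>lebesgue_on (ball (0::real^'d) 1))"
    by (intro Bochner_Integration.integral_diff) auto
  also have "(\<integral>z. W F \<partial>lebesgue_on (ball (0::real^'d) 1)) = W F * measure lebesgue (ball (0::real^'d) 1)"
    using measure_restrict_space[of "ball (0::real^'d) 1" lebesgue "ball 0 1"] by simp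
  also have "(\<integral>z. W (G z) \<partial>lebesgue_on (ball 0 1)) - W F * measure lebesgue (ball (0::real^'d) 1) \<ge> 0"
    using avg measure_unit_ball_pos[where 'd = 'd] by (simp add: average_def field_simps)
  finally have "0 \<le> (\<integral>z. f (r *\<^sub>R z) \<partial>lebesgue_on (ball 0 1))"
    by (simp add: f_def G_def)
  also have "\<dots> = (\<integral>z. (if z \<in> ball 0 1 then f (r *\<^sub>R z) else 0) \<partial>lebesgue)"
    by (rule Lebesgue_Measure.integral_restrict_UNIV[symmetric]) simp
  also have "\<dots> = (\<integral>z. f (0 + r *\<^sub>R z) \<partial>lebesgue)"
  proof (rule integral_cong_AE)
    note [measurable] = measurable_compose[OF lebesgue_affine(1)[of r 0] fm]
    show m: "(\<lambda>z. f (0 + r *\<^sub>R z)) \<in> borel_measurable lebesgue"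
      using r by measurable
    then show "(\<lambda>z. if z \<in> ball 0 1 then f (r *\<^sub>R z) else 0) \<in> borel_measurable lebesgue"
      by (intro borel_measurable_if_I measurable_restrict_space1) simp_all
    have "AE z in lebesgue. norm (0 + r *\<^sub>R z) > R \<longrightarrow> f (0 + r *\<^sub>R z) = 0"
      by (rule AE_lebesgue_affine[OF f0 r(3)])
    then show "AE z in lebesgue. (if z \<in> ball 0 1 then f (r *\<^sub>R z) else 0) = f (0 + r *\<^sub>R z)"
    proof eventually_elim
      case (elim z)
      have "norm (r *\<^sub>R z) > R" if "norm z \<ge> 1"
      proof -
        have "r * 1 \<le> r * norm z" using that r by (intro mult_left_mono) auto
        then have "R < r * norm z" using r(2) by linarith
        then show ?thesis using r(1) by simp
      qed
      then show ?case using elim by (auto simp: not_less)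
    qed
  qed
  finally have "0 \<le> \<bar>r\<bar> ^ DIM(real^'d) *\<^sub>R (\<integral>z. f (0 + r *\<^sub>R z) \<partial>lebesgue)"
    by (simp add: r_def)
  then show "0 \<le> (\<integral>z. W (F + D z) - W F \<partial>lebesgue)"
    using integral_lebesgue_affine[OF fm, of r 0] r by (simp add: f_def)
qed

section \<open>The layer competitor\<close>

text \<open>An orthonormal basis that has n among its vectors takes the place of coordinate axes, so
  that the layer can be orthogonal to an arbitrary n; the vectors of \<open>S - {n}\<close> are the
  lateral directions.\<close>

locale orthonormal_frame =
  fixes n :: "real^'d" and S :: "(real^'d) set"
  assumes n: "n \<in> S" and orth: "pairwise orthogonal S" and unit: "\<And>b. b \<in> S \<Longrightarrow> norm b = 1"
    and fin: "finite S" and span: "span S = UNIV"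
begin

lemma inner_frame: "b \<in> S \<Longrightarrow> c \<in> S \<Longrightarrow> b \<bullet> c = (if b = c then 1 else 0)"
  using orth unit by (auto simp: pairwise_def orthogonal_def norm_eq_1)

lemma norm_le_frame: "norm z \<le> (\<Sum>b\<in>S. \<bar>z \<bullet> b\<bar>)"
proof -
  have "z = (\<Sum>b\<in>S. (z \<bullet> b) *\<^sub>R b)"
    using orthonormal_basis_expand[OF orth unit _ fin, of z] span by simp
  also have "norm \<dots> \<le> (\<Sum>b\<in>S. \<bar>z \<bullet> b\<bar>)"
    by (intro sum_norm_le) (simp add: unit)
  finally show ?thesis .
qed

lemma abs_inner_le: "b \<in> S \<Longrightarrow> \<bar>z \<bullet> b\<bar> \<le> norm z"
  using Cauchy_Schwarz_ineq2[of z b] unit[of b] by simp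

text \<open>A lattice in the hyperplane orthogonal to n. The spacing 2 leaves room for disjoint open
  unit balls around its points.\<close>

definition center :: "(real^'d \<Rightarrow> nat) \<Rightarrow> real^'d"
  where "center k = (\<Sum>b\<in>S - {n}. (2 * real (k b)) *\<^sub>R b)"

lemma center_inner: "c \<in> S \<Longrightarrow> center k \<bullet> c = (if c = n then 0 else 2 * real (k c))"
proof -
  assume c: "c \<in> S"
  have "center k \<bullet> c = (\<Sum>b\<in>S - {n}. if b = c then 2 * real (k b) else 0)"
    unfolding center_def inner_sum_left by (intro sum.cong) (use c inner_frame in auto)
  then show ?thesis
    using fin c by (simp add: sum.delta)
qed

text \<open>The lateral sides have length 2, matching the lattice spacing, and are half-open so that
  translates tile without overlap.\<close>

definition slab :: "real \<Rightarrow> real \<Rightarrow> (real^'d) set"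
  where "slab \<alpha> \<beta> = {x. (\<forall>b\<in>S - {n}. -1 \<le> x \<bullet> b \<and> x \<bullet> b < 1) \<and> \<alpha> \<le> x \<bullet> n \<and> x \<bullet> n < \<beta>}"

lemma slab_borel: "slab \<alpha> \<beta> \<in> sets borel"
proof -
  have "slab \<alpha> \<beta> = (\<Inter>b\<in>S. {x. (if b = n then \<alpha> else -1) \<le> x \<bullet> b} \<inter> {x. x \<bullet> b < (if b = n then \<beta> else 1)})"
    using n by (auto simp: slab_def split: if_splits)
  also have "\<dots> \<in> sets borel"
    using fin n by (intro sets.finite_INT) (auto intro!: sets.Int borel_closed borel_open
        closed_Collect_le open_Collect_less continuous_intros)
  finally show ?thesis .
qed

lemma slab_bounded: "bounded (slab \<alpha> \<beta>)"
proof -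
  have "norm x \<le> (\<Sum>b\<in>S. \<bar>\<alpha>\<bar> + \<bar>\<beta>\<bar> + 1)" if "x \<in> slab \<alpha> \<beta>" for x
  proof -
    have "\<bar>x \<bullet> b\<bar> \<le> \<bar>\<alpha>\<bar> + \<bar>\<beta>\<bar> + 1" if "b \<in> S" for b
    proof (cases "b = n")
      case True
      then show ?thesis using \<open>x \<in> slab \<alpha> \<beta>\<close> unfolding slab_def by auto
    next
      case False
      then have "-1 \<le> x \<bullet> b" "x \<bullet> b < 1" using \<open>x \<in> slab \<alpha> \<beta>\<close> that unfolding slab_def by auto
      then show ?thesis by linarith
    qed
    then show ?thesis using norm_le_frame[of x] by (meson order_trans sum_mono)
  qed
  then show ?thesis unfolding bounded_iff by blast
qed

lemma slab_lmeasurable: "slab \<alpha> \<beta> \<in> lmeasurable"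
  by (rule bounded_set_imp_lmeasurable[OF slab_bounded]) (simp add: slab_borel)

text \<open>Unit layers are stacked along n by translation. Only the ratio to the unit layer below
  the hyperplane is needed, which is therefore left unevaluated and becomes \<kappa>.\<close>

lemma measure_slab: "measure lebesgue (slab 0 (real i)) = real i * measure lebesgue (slab (-1) 0)"
proof (induction i)
  case 0
  have "slab 0 0 = {}" by (auto simp: slab_def)
  then show ?case by simp
next
  case (Suc i)
  \<comment> \<open>The unit layer occupies heights from -1 to 0, so a shift by i + 1 puts it at
    heights from i to i + 1.\<close>
  let ?t = "(real i + 1) *\<^sub>R n"
  have nn: "n \<bullet> n = 1" using inner_frame[OF n n] by simp
  have nb: "n \<bullet> b = 0" if "b \<in> S - {n}" for b using inner_frame[OF n, of b] that by auto
  have eq: "slab 0 (real (Suc i)) = slab 0 (real i) \<union> (+) ?t ` slab (-1) 0"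
  proof (intro equalityI subsetI)
    fix x assume x: "x \<in> slab 0 (real (Suc i))"
    show "x \<in> slab 0 (real i) \<union> (+) ?t ` slab (-1) 0"
    proof (cases "x \<bullet> n < real i")
      case True
      then show ?thesis using x by (auto simp: slab_def)
    next
      case False
      then have "x - ?t \<in> slab (-1) 0"
        using x nn nb by (auto simp: slab_def inner_diff_left)
      then show ?thesis by (auto intro!: image_eqI[of _ _ "x - ?t"])
    qed
  qed (auto simp: slab_def inner_add_left nn nb)
  have disj: "slab 0 (real i) \<inter> (+) ?t ` slab (-1) 0 = {}"
    using nn by (auto simp: slab_def inner_add_left)
  have "measure lebesgue (slab 0 (real (Suc i)))
      = measure lebesgue (slab 0 (real i)) + measure lebesgue ((+) ?t ` slab (-1) 0)"
    unfolding eq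
    by (rule measure_Un3[where M = lebesgue, THEN trans])
      (use slab_lmeasurable measurable_translation disj in auto)
  also have "measure lebesgue ((+) ?t ` slab (-1) 0) = measure lebesgue (slab (-1) 0)"
    by (rule measure_translation)
  finally show ?case
    using Suc by (simp add: algebra_simps)
qed

lemma measure_slab_pos: "measure lebesgue (slab (-1) 0) > 0"
proof -
  let ?c = "- (1/2) *\<^sub>R n"
  have nn: "n \<bullet> n = 1" using inner_frame[OF n n] by simp
  have "ball ?c (1/2) \<subseteq> slab (-1) 0"
  proof
    fix x assume "x \<in> ball ?c (1/2)"
    then have *: "norm (x - ?c) < 1/2" by (simp add: dist_norm norm_minus_commute)
    have "-1 \<le> x \<bullet> b \<and> x \<bullet> b < 1" if "b \<in> S - {n}" for b
      using abs_inner_le[of b "x - ?c"] * that inner_frame[OF n, of b] by (auto simp: inner_add_left)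
    moreover have "-1 \<le> x \<bullet> n \<and> x \<bullet> n < 0"
      using abs_inner_le[OF n, of "x - ?c"] * nn by (simp add: inner_add_left abs_le_iff)
    ultimately show "x \<in> slab (-1) 0" by (auto simp: slab_def)
  qed
  then have "measure lebesgue (ball ?c (1/2)) \<le> measure lebesgue (slab (-1) 0)"
    by (intro measure_mono_fmeasurable slab_lmeasurable) auto
  moreover have "measure lebesgue (ball ?c (1/2)) > 0"
    by (simp add: content_ball_pos)
  ultimately show ?thesis by linarith
qed

text \<open>
  The cells \<open>center k + slab (-1) H\<close> are half-open and tile a layer around the hyperplane
  orthogonal to \<open>n\<close>.
\<close>

lemma cell_unique:
  assumes "z - center k \<in> slab (-1) H" and "b \<in> S - {n}" and "k b \<noteq> k' b"
  shows "\<bar>(z - center k') \<bullet> b\<bar> \<ge> 1"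
proof -
  have "-1 \<le> (z - center k) \<bullet> b" "(z - center k) \<bullet> b < 1"
    using assms by (auto simp: slab_def)
  moreover have "center k \<bullet> b = 2 * real (k b)" "center k' \<bullet> b = 2 * real (k' b)"
    using assms(2) center_inner by auto
  moreover have "real (k b) \<ge> real (k' b) + 1 \<or> real (k' b) \<ge> real (k b) + 1"
    using assms(3) by linarith
  ultimately show ?thesis by (auto simp: inner_diff_left)
qed

text \<open>Extensional functions agree off \<open>I\<close>, so a difference shows at some index.
  The two families may differ because indices of inner cells are compared with indices of the larger
  family that includes the boundary cells.\<close>

lemma PiE_neqE:
  assumes "k \<in> PiE I A" "k' \<in> PiE I B" "k \<noteq> k'"
  obtains b where "b \<in> I" "k b \<noteq> k' b"
proof -
  obtain b where b: "k b \<noteq> k' b" using assms(3) by blast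
  then have "b \<in> I" using PiE_arb[OF assms(1)] PiE_arb[OF assms(2)] by metis
  then show thesis using b that by blast
qed

lemma AE_off_hyperplanes:
  assumes "\<And>b. b \<in> S \<Longrightarrow> finite (X b)"
  shows "AE z in lebesgue. \<forall>b\<in>S. z \<bullet> b \<notin> X b"
proof -
  have "negligible (\<Union>b\<in>S. \<Union>c\<in>X b. {z. b \<bullet> z = c})"
  proof (rule negligible_Union)
    fix T assume "T \<in> (\<lambda>b. \<Union>c\<in>X b. {z. b \<bullet> z = c}) ` S"
    then obtain b where b: "b \<in> S" "T = (\<Union>c\<in>X b. {z. b \<bullet> z = c})" by blast
    moreover have "b \<noteq> 0" using unit[OF b(1)] by auto
    ultimately show "negligible T"
      using assms[OF b(1)] by (auto intro!: negligible_Union negligible_hyperplane)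
  qed (use fin in simp)
  then have "(\<Union>b\<in>S. \<Union>c\<in>X b. {z. b \<bullet> z = c}) \<in> null_sets lebesgue"
    by (simp add: negligible_iff_null_sets)
  from AE_not_in[OF this] show ?thesis
    by eventually_elim (auto simp: inner_commute)
qed

end

section \<open>Piecewise linear profiles in one variable\<close>

lemma differentiable_max_min:
  fixes f g :: "real \<Rightarrow> real"
  assumes "f differentiable (at x)" and "g differentiable (at x)" and "f x \<noteq> g x"
  shows "(\<lambda>x. max (f x) (g x)) differentiable (at x)" and "(\<lambda>x. min (f x) (g x)) differentiable (at x)"
proof -
  have *: "\<forall>\<^sub>F y in nhds x. f y < g y"
    if "f differentiable (at x)" "g differentiable (at x)" "f x < g x" for f g :: "real \<Rightarrow> real"
  proof -
    have "isCont f x" "isCont g x"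
      by (rule differentiable_imp_continuous_within, rule that)+
    then have "(f \<longlongrightarrow> f x) (nhds x)" "(g \<longlongrightarrow> g x) (nhds x)"
      by (simp_all add: continuous_at tendsto_nhds_iff)
    from order_tendstoD(1)[OF tendsto_diff[OF this(2,1)], of 0] that(3)
    show ?thesis by simp
  qed
  have cong: "h differentiable (at x)"
    if ev: "\<forall>\<^sub>F y in nhds x. h y = f y" and diff: "f differentiable (at x)" for h f :: "real \<Rightarrow> real"
  proof -
    obtain U where U: "open U" "x \<in> U" "\<forall>y\<in>U. h y = f y"
      using ev unfolding eventually_nhds by metis
    obtain D where "(f has_derivative D) (at x)" using diff unfolding differentiable_def by blast
    then have "(h has_derivative D) (at x)"
      by (rule has_derivative_transform_within_open[OF _ U(1,2)]) (simp add: U(3))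
    then show ?thesis unfolding differentiable_def by blast
  qed
  from assms(3) consider "f x < g x" | "g x < f x" by linarith
  then have "(\<lambda>x. max (f x) (g x)) differentiable (at x) \<and> (\<lambda>x. min (f x) (g x)) differentiable (at x)"
  proof cases
    case 1
    note ev = *[OF assms(1,2) 1]
    have "(\<lambda>x. max (f x) (g x)) differentiable (at x)"
      by (rule cong[OF eventually_mono[OF ev] assms(2)]) auto
    moreover have "(\<lambda>x. min (f x) (g x)) differentiable (at x)"
      by (rule cong[OF eventually_mono[OF ev] assms(1)]) auto
    ultimately show ?thesis ..
  next
    case 2
    note ev = *[OF assms(2,1) 2]
    have "(\<lambda>x. max (f x) (g x)) differentiable (at x)"
      by (rule cong[OF eventually_mono[OF ev] assms(1)]) auto
    moreover have "(\<lambda>x. min (f x) (g x)) differentiable (at x)"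
      by (rule cong[OF eventually_mono[OF ev] assms(2)]) auto
    ultimately show ?thesis ..
  qed
  then show "(\<lambda>x. max (f x) (g x)) differentiable (at x)" "(\<lambda>x. min (f x) (g x)) differentiable (at x)" by auto
qed

text \<open>The profile across the layer: it rises with slope 1 from -1 to 0 and falls with slope -s
  from 0 to 1/s. Multiplied by -a and added to F_+ z, it produces F_- on the unit layer and F_+ + s
  (a \<otimes> n) on the compensating layer of thickness H = 1/s.\<close>

definition hat :: "real \<Rightarrow> real \<Rightarrow> real"
  where "hat s t = max 0 (min (t + 1) (1 - s * t))"

text \<open>The lateral cutoff. It equals 1 between 0 and 2N + 2 and vanishes outside -1 and 2N + 3.
  Cell number k covers the interval from 2k - 1 to 2k + 1, so the cells 1 to N lie inside the
  plateau and the cells 0 to N + 1 exhaust the support.\<close>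

definition trapezoid :: "nat \<Rightarrow> real \<Rightarrow> real"
  where "trapezoid N r = max 0 (min 1 (min (r + 1) (2 * real N + 3 - r)))"

lemma hat_differentiable:
  assumes "0 < s" and "t \<notin> {-1, 0, 1/s}"
  shows "hat s differentiable (at t)"
  unfolding hat_def[abs_def]
proof (intro differentiable_max_min)
  have "t * (1 + s) \<noteq> 0" using assms by simp
  then show "t + 1 \<noteq> 1 - s * t" by (simp add: algebra_simps)
  then show "0 \<noteq> min (t + 1) (1 - s * t)" using assms by (auto simp: min_def field_simps)
qed (auto intro!: derivative_intros)

text \<open>The trapezoid is flat at N + 1, but its inner \<open>min\<close> has a tie there.
  Excluding the point as well is harmless, since a hyperplane is a null set.\<close>

lemma trapezoid_differentiable:
  assumes "r \<notin> {-1, 0, real N + 1, 2 * real N + 2, 2 * real N + 3}"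
  shows "trapezoid N differentiable (at r)"
  unfolding trapezoid_def[abs_def]
  by (intro differentiable_max_min) (use assms in \<open>auto intro!: derivative_intros simp: min_def\<close>)

lemma hat_bounds: "s > 0 \<Longrightarrow> 0 \<le> hat s t \<and> hat s t \<le> 1"
proof -
  assume s: "s > 0"
  have "0 \<le> s * t \<or> t \<le> 0" using s by (auto simp: zero_le_mult_iff)
  then show ?thesis by (auto simp: hat_def min_def max_def)
qed

lemma trapezoid_bounds: "0 \<le> trapezoid N r \<and> trapezoid N r \<le> 1"
  by (auto simp: trapezoid_def)

lemma hat_lipschitz:
  assumes "0 < s" "s \<le> 1"
  shows "\<bar>hat s t - hat s u\<bar> \<le> \<bar>t - u\<bar>"
proof -
  have "\<bar>s * t - s * u\<bar> = s * \<bar>t - u\<bar>"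
    using assms by (simp add: abs_mult right_diff_distrib[symmetric])
  also have "\<dots> \<le> 1 * \<bar>t - u\<bar>" using assms by (intro mult_right_mono) auto
  finally show ?thesis unfolding hat_def min_def max_def by (auto split: if_splits)
qed

lemma trapezoid_lipschitz: "\<bar>trapezoid N t - trapezoid N u\<bar> \<le> \<bar>t - u\<bar>"
  unfolding trapezoid_def min_def max_def by (auto split: if_splits)

section \<open>Jacobian matrices\<close>

lemma jacobian_eqI:
  fixes f :: "real^'d \<Rightarrow> real^'m"
  assumes "(f has_derivative (\<lambda>h. A *v h)) (at z)"
  shows "jacobian f (at z) = A"
  unfolding jacobian_def frechet_derivative_at[OF assms, symmetric] by (rule matrix_of_matrix_vector_mul)

lemma has_derivative_jacobian:
  fixes f :: "real^'d \<Rightarrow> real^'m"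
  shows "f differentiable (at z) \<Longrightarrow> (f has_derivative (\<lambda>h. jacobian f (at z) *v h)) (at z)"
  using jacobian_works[of f "at z"] by blast

lemma jacobian_add:
  fixes f g :: "real^'d \<Rightarrow> real^'m"
  assumes "f differentiable (at z)" and "g differentiable (at z)"
  shows "jacobian (\<lambda>z. f z + g z) (at z) = jacobian f (at z) + jacobian g (at z)"
  using has_derivative_add[OF assms[THEN has_derivative_jacobian]]
  by (intro jacobian_eqI) (simp add: matrix_vector_mult_add_rdistrib)

lemma outer_mult_vec: "(a \<otimes> n) *v h = (h \<bullet> n) *\<^sub>R a"
  by (simp add: vec_eq_iff outer_def matrix_vector_mult_def inner_vec_def sum_distrib_left
      sum_distrib_right mult_ac)

lemma test_function_jacobian:
  fixes \<phi> :: "real^'d \<Rightarrow> real^'m"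
  assumes "\<phi> \<in> test_functions U"
  shows "(\<phi> has_derivative (\<lambda>h. jacobian \<phi> (at z) *v h)) (at z)"
    and "jacobian \<phi> (at z) *v h = frechet_derivative \<phi> (at z) h"
    and "z \<notin> U \<Longrightarrow> \<phi> z = 0" and "z \<notin> U \<Longrightarrow> jacobian \<phi> (at z) = 0"
    and "(\<lambda>z. jacobian \<phi> (at z)) \<in> borel_measurable borel"
    and "continuous_on UNIV (\<lambda>z. jacobian \<phi> (at z))"
proof -
  note T = test_functionD[OF assms]
  show J: "(\<phi> has_derivative (\<lambda>h. jacobian \<phi> (at z) *v h)) (at z)" for z
    using T(4)[of z] by (intro has_derivative_jacobian) (auto simp: differentiable_def)
  show Jf: "jacobian \<phi> (at z) *v h = frechet_derivative \<phi> (at z) h" for z h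
    using frechet_derivative_at[OF J[of z]] by metis
  have off: "z \<notin> closure {z. \<phi> z \<noteq> 0}" if "z \<notin> U" for z
    using that T(3) by blast
  show "\<phi> z = 0" if "z \<notin> U"
    using off[OF that] closure_subset[of "{z. \<phi> z \<noteq> 0}"] by blast
  show "jacobian \<phi> (at z) = 0" if "z \<notin> U"
    by (rule jacobian_eqI) (use derivative_zero_off_support[OF off[OF that]] T(4)[of z] in simp)
  have eq: "(\<lambda>z. jacobian \<phi> (at z) $ i $ j) = (\<lambda>z. frechet_derivative \<phi> (at z) (axis j 1) $ i)" for i j
    using Jf[of _ "axis j 1"] by (auto simp: matrix_vector_mult_axis column_def vec_eq_iff)
  have "continuous_on UNIV (\<lambda>z. jacobian \<phi> (at z) $ i $ j)" for i j
    unfolding eq by (intro continuous_intros T(5))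
  then have "continuous_on UNIV (\<lambda>z. \<chi> i j. jacobian \<phi> (at z) $ i $ j)"
    by (intro continuous_on_vec_lambda)
  then show "continuous_on UNIV (\<lambda>z. jacobian \<phi> (at z))" by simp
  then show "(\<lambda>z. jacobian \<phi> (at z)) \<in> borel_measurable borel"
    by (rule borel_measurable_continuous_onI)
qed

section \<open>The competitor and its gradient, cell by cell\<close>

context orthonormal_frame
begin

definition profile :: "real \<Rightarrow> nat \<Rightarrow> real^'d \<Rightarrow> real \<Rightarrow> real"
  where "profile s N b = (if b = n then hat s else trapezoid N)"

definition cutoff :: "real \<Rightarrow> nat \<Rightarrow> real^'d \<Rightarrow> real"
  where "cutoff s N z = (\<Prod>b\<in>S. profile s N b (z \<bullet> b))"

text \<open>All factors take values between 0 and 1 and are 1-Lipschitz, for the hat because s \<le>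
  1. The constant involves neither s nor N, so gradients in the boundary cells stay bounded as N
  grows.\<close>

lemma cutoff_lipschitz:
  assumes "0 < s" "s \<le> 1"
  shows "\<bar>cutoff s N z - cutoff s N w\<bar> \<le> real (card S) * norm (z - w)"
proof -
  have "\<bar>cutoff s N z - cutoff s N w\<bar> \<le> (\<Sum>b\<in>S. \<bar>profile s N b (z \<bullet> b) - profile s N b (w \<bullet> b)\<bar>)"
    unfolding cutoff_def real_norm_def[symmetric]
    by (rule norm_prod_diff) (use hat_bounds trapezoid_bounds assms in \<open>auto simp: profile_def\<close>)
  also have "\<dots> \<le> (\<Sum>b\<in>S. norm (z - w))"
  proof (rule sum_mono)
    fix b assume b: "b \<in> S"
    have "\<bar>profile s N b (z \<bullet> b) - profile s N b (w \<bullet> b)\<bar> \<le> \<bar>z \<bullet> b - w \<bullet> b\<bar>"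
      using hat_lipschitz[OF assms] trapezoid_lipschitz by (simp add: profile_def)
    also have "\<dots> \<le> norm (z - w)"
      using abs_inner_le[OF b, of "z - w"] by (simp add: inner_diff_left)
    finally show "\<bar>profile s N b (z \<bullet> b) - profile s N b (w \<bullet> b)\<bar> \<le> norm (z - w)" .
  qed
  finally show ?thesis by simp
qed

text \<open>The breakpoints of \<open>hat\<close> and \<open>trapezoid\<close> taken together, so
  that one condition and one null set serve all directions of the frame.\<close>

definition kinks :: "real \<Rightarrow> nat \<Rightarrow> real set"
  where "kinks s N = {-1, 0, 1/s, real N + 1, 2 * real N + 2, 2 * real N + 3}"

lemma cutoff_differentiable:
  assumes "0 < s" and "\<forall>b\<in>S. z \<bullet> b \<notin> kinks s N"
  shows "cutoff s N differentiable (at z)"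
proof -
  have "(\<lambda>z. profile s N b (z \<bullet> b)) differentiable (at z)" if b: "b \<in> S" for b
  proof -
    have "profile s N b differentiable (at (z \<bullet> b))"
      using assms b hat_differentiable[of s "z \<bullet> b"] trapezoid_differentiable[of "z \<bullet> b" N]
      by (auto simp: profile_def kinks_def)
    then obtain D where "(profile s N b has_derivative D) (at (z \<bullet> b))"
      unfolding differentiable_def by blast
    from has_derivative_compose[OF has_derivative_inner_left[OF has_derivative_ident] this]
    show ?thesis unfolding differentiable_def by blast
  qed
  note D = this[unfolded frechet_derivative_works]
  show ?thesis
    unfolding cutoff_def[abs_def] differentiable_def by (rule exI, rule has_derivative_prod, rule D)
qed

lemma cutoff_eq_0:
  assumes "0 < s" and "b \<in> S" and "z \<bullet> b \<le> -1 \<or> z \<bullet> b \<ge> (if b = n then 1/s else 2 * real N + 3)"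
  shows "cutoff s N z = 0"
proof -
  have "profile s N b (z \<bullet> b) = 0"
    using assms by (auto simp: profile_def hat_def trapezoid_def max_def min_def field_simps split: if_splits)
  then show ?thesis
    unfolding cutoff_def using assms(2) fin by (intro prod_zero) auto
qed

lemma cell_bounds:
  assumes "z - center k \<in> slab (-1) H" and "b \<in> S - {n}"
  shows "-1 \<le> z \<bullet> b - 2 * real (k b)" and "z \<bullet> b - 2 * real (k b) < 1"
proof -
  have "(z - center k) \<bullet> b = z \<bullet> b - 2 * real (k b)"
    using assms(2) center_inner[of b k] by (simp add: inner_diff_left)
  moreover have "-1 \<le> (z - center k) \<bullet> b" "(z - center k) \<bullet> b < 1"
    using assms unfolding slab_def by blast+
  ultimately show "-1 \<le> z \<bullet> b - 2 * real (k b)" and "z \<bullet> b - 2 * real (k b) < 1" by simp_all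
qed

text \<open>An inner cell lies in the open region where every lateral coordinate is strictly between
  0 and 2N + 2 and every lateral factor is 1. Equality in a neighbourhood is stated because it is
  going to be differentiated.\<close>

lemma cutoff_eq_hat:
  assumes k: "k \<in> PiE (S - {n}) (\<lambda>_. {1..N})" and z: "z - center k \<in> slab (-1) H"
  shows "\<forall>\<^sub>F w in nhds z. cutoff s N w = hat s (w \<bullet> n)"
  unfolding eventually_nhds
proof (intro exI conjI ballI)
  let ?V = "\<Inter>b\<in>S - {n}. {w. 0 < w \<bullet> b} \<inter> {w. w \<bullet> b < 2 * real N + 2}"
  show "open ?V"
    using fin by (intro open_INT open_Int ballI open_Collect_less continuous_intros) auto
  show "z \<in> ?V"
  proof
    fix b assume b: "b \<in> S - {n}"
    have kb: "1 \<le> real (k b)" "real (k b) \<le> real N" using k b by (auto simp: PiE_iff)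
    from cell_bounds[OF z b] show "z \<in> {w. 0 < w \<bullet> b} \<inter> {w. w \<bullet> b < 2 * real N + 2}" using kb by auto
  qed
  fix w assume w: "w \<in> ?V"
  have "cutoff s N w = profile s N n (w \<bullet> n) * (\<Prod>b\<in>S - {n}. profile s N b (w \<bullet> b))"
    unfolding cutoff_def using fin n by (rule prod.remove)
  also have "(\<Prod>b\<in>S - {n}. profile s N b (w \<bullet> b)) = (\<Prod>b\<in>S - {n}. 1)"
  proof (rule prod.cong)
    fix b assume b: "b \<in> S - {n}"
    then have "0 < w \<bullet> b" "w \<bullet> b < 2 * real N + 2" using w by blast+
    then show "profile s N b (w \<bullet> b) = 1" using b by (simp add: profile_def trapezoid_def)
  qed simp
  finally show "cutoff s N w = hat s (w \<bullet> n)" by (simp add: profile_def)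
qed

lemma hat_derivative:
  assumes "0 < s" and "-1 < t" and "t < 1/s" and "t \<noteq> 0"
  shows "(hat s has_derivative (\<lambda>h. (if t < 0 then 1 else - s) * h)) (at t)"
proof (cases "t < 0")
  case True
  have "((\<lambda>t. t + 1) has_derivative (\<lambda>h. (if t < 0 then 1 else - s) * h)) (at t)"
    using True by (auto intro!: derivative_eq_intros)
  then show ?thesis
  proof (rule has_derivative_transform_within_open[where s = "{-1<..<0}"])
    fix r assume "r \<in> {-1<..<0::real}"
    moreover have "s * r < 0" using calculation assms(1) by (simp add: mult_pos_neg)
    ultimately show "r + 1 = hat s r" by (auto simp: hat_def)
  qed (use True assms in auto)
next
  case False
  have "((\<lambda>t. 1 - s * t) has_derivative (\<lambda>h. (if t < 0 then 1 else - s) * h)) (at t)"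
    using False by (auto intro!: derivative_eq_intros)
  then show ?thesis
  proof (rule has_derivative_transform_within_open[where s = "{0<..<1/s}"])
    fix r assume r: "r \<in> {0<..<1/s}"
    then have "s * r > 0" "s * r < 1" using assms(1) by (auto simp: field_simps)
    then show "1 - s * r = hat s r" using r by (auto simp: hat_def)
  qed (use False assms in auto)
qed

lemma cell_disjoint:
  assumes "z - center k \<in> slab (-1) H" and "z - center k' \<in> slab (-1) H" and "b \<in> S - {n}"
  shows "k b = k' b"
proof -
  from cell_bounds[OF assms(1,3)] cell_bounds[OF assms(2,3)]
  have "\<not> real (k b) \<ge> real (k' b) + 1" "\<not> real (k' b) \<ge> real (k b) + 1" by linarith+
  then show ?thesis by linarith
qed

lemma cell_cover:
  assumes "\<forall>b\<in>S - {n}. -1 \<le> z \<bullet> b \<and> z \<bullet> b < 2 * real N + 3" and "-1 \<le> z \<bullet> n" "z \<bullet> n < H"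
  obtains k where "k \<in> PiE (S - {n}) (\<lambda>_. {0..N+1})" and "z - center k \<in> slab (-1) H"
proof -
  \<comment> \<open>Inverts the rule that cell number k covers the interval from 2k - 1 to 2k +
    1.\<close>
  define k where "k = restrict (\<lambda>b. nat \<lfloor>(z \<bullet> b + 1) / 2\<rfloor>) (S - {n})"
  have k: "k b \<le> N + 1 \<and> 2 * real (k b) \<le> z \<bullet> b + 1 \<and> z \<bullet> b + 1 < 2 * real (k b) + 2" if b: "b \<in> S - {n}" for b
  proof -
    have "-1 \<le> z \<bullet> b" using assms b by blast
    then have "0 \<le> \<lfloor>(z \<bullet> b + 1) / 2\<rfloor>" by simp
    then have r: "real (k b) = of_int \<lfloor>(z \<bullet> b + 1) / 2\<rfloor>" using b by (simp add: k_def)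
    have "real (k b) \<le> (z \<bullet> b + 1) / 2" "(z \<bullet> b + 1) / 2 < real (k b) + 1"
      unfolding r by linarith+
    moreover have "z \<bullet> b < 2 * real N + 3" using assms b by blast
    ultimately have "real (k b) < real N + 2" "2 * real (k b) \<le> z \<bullet> b + 1" "z \<bullet> b + 1 < 2 * real (k b) + 2"
      by (simp_all add: field_simps)
    then show ?thesis by simp
  qed
  show thesis
  proof (rule that[of k])
    show "k \<in> PiE (S - {n}) (\<lambda>_. {0..N+1})" using k by (auto simp: k_def)
    have "-1 \<le> (z - center k) \<bullet> b \<and> (z - center k) \<bullet> b < 1" if b: "b \<in> S - {n}" for b
      using k[OF b] center_inner[of b k] b by (auto simp: inner_diff_left)
    then show "z - center k \<in> slab (-1) H"
      using assms center_inner[OF n, of k] by (auto simp: slab_def inner_diff_left)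
  qed
qed

text \<open>The perturbation of the affine map F_+ z. Copies of \<phi> are placed in the inner cells
  only, where the cutoff is the pure layer profile; the boundary cells see nothing but the lateral
  truncation.\<close>

definition competitor :: "real \<Rightarrow> nat \<Rightarrow> real^'m \<Rightarrow> (real^'d \<Rightarrow> real^'m) \<Rightarrow> real^'d \<Rightarrow> real^'m"
  where "competitor s N a \<phi> z =
    (- cutoff s N z) *\<^sub>R a + (\<Sum>k\<in>PiE (S - {n}) (\<lambda>_. {1..N}). \<phi> (z - center k))"

text \<open>The gradient of the competitor in the coordinates of an inner cell, the same for all
  inner cells.\<close>

definition cell_gradient :: "real \<Rightarrow> real^'m \<Rightarrow> (real^'d \<Rightarrow> real^'m) \<Rightarrow> real^'d \<Rightarrow> real^'d^'m"
  where "cell_gradient s a \<phi> x = jacobian \<phi> (at x) + (if x \<bullet> n < 0 then -1 else s) *\<^sub>R (a \<otimes> n)"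

text \<open>The constant ignores that the copies of \<phi> have disjoint supports and grows with N.
  Only its existence matters for admissibility; estimates uniform in N come from the cutoff
  alone.\<close>

lemma competitor_lipschitz:
  fixes \<phi> :: "real^'d \<Rightarrow> real^'m"
  assumes \<phi>: "\<phi> \<in> test_functions U" and s: "0 < s" "s \<le> 1"
  obtains L where "\<And>x z. norm (competitor s N a \<phi> x - competitor s N a \<phi> z) \<le> L * norm (x - z)"
proof -
  obtain L' where L': "\<And>x y. norm (\<phi> x - \<phi> y) \<le> L' * norm (x - y)"
    using test_function_lipschitz[OF \<phi>] by metis
  let ?K = "PiE (S - {n}) (\<lambda>_. {1..N})"
  have "norm (competitor s N a \<phi> x - competitor s N a \<phi> z)
      \<le> (real (card S) * norm a + real (card ?K) * L') * norm (x - z)" for x z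
  proof -
    have "competitor s N a \<phi> x - competitor s N a \<phi> z =
        (cutoff s N z - cutoff s N x) *\<^sub>R a + (\<Sum>k\<in>?K. \<phi> (x - center k) - \<phi> (z - center k))"
      by (simp add: competitor_def sum_subtractf algebra_simps)
    also have "norm \<dots> \<le> \<bar>cutoff s N z - cutoff s N x\<bar> * norm a
        + norm (\<Sum>k\<in>?K. \<phi> (x - center k) - \<phi> (z - center k))"
      by (rule norm_triangle_ineq[THEN order_trans]) simp
    also have "\<bar>cutoff s N z - cutoff s N x\<bar> * norm a \<le> (real (card S) * norm (x - z)) * norm a"
      using cutoff_lipschitz[OF s, of N z x] by (intro mult_right_mono) (auto simp: norm_minus_commute)
    also have "norm (\<Sum>k\<in>?K. \<phi> (x - center k) - \<phi> (z - center k)) \<le> (\<Sum>k\<in>?K. L' * norm (x - z))"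
    proof (rule sum_norm_le)
      fix k show "norm (\<phi> (x - center k) - \<phi> (z - center k)) \<le> L' * norm (x - z)"
        using L'[of "x - center k" "z - center k"] by simp
    qed
    finally show ?thesis by (simp add: algebra_simps)
  qed
  then show thesis by (rule that)
qed

lemma competitor_support:
  fixes \<phi> :: "real^'d \<Rightarrow> real^'m"
  assumes \<phi>: "\<phi> \<in> test_functions (ball 0 1)" and s: "0 < s"
  obtains R where "\<And>z. norm z > R \<Longrightarrow> competitor s N a \<phi> z = 0"
proof -
  let ?K = "PiE (S - {n}) (\<lambda>_. {1..N})"
  have finK: "finite ?K" using fin by (intro finite_PiE) auto
  define r where "r = 1/s + 2 * real N + 3"
  define R where "R = real (card S) * r + 1 + (\<Sum>k\<in>?K. norm (center k))"
  have r: "r \<ge> 1/s" "r \<ge> 2 * real N + 3" "r \<ge> 1" using s by (auto simp: r_def)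
  have S0: "(\<Sum>k\<in>?K. norm (center k)) \<ge> 0" by (intro sum_nonneg) auto
  have "competitor s N a \<phi> z = 0" if z: "norm z > R" for z
  proof -
    have "\<exists>b\<in>S. \<bar>z \<bullet> b\<bar> > r"
    proof (rule ccontr)
      assume "\<not> ?thesis"
      then have "(\<Sum>b\<in>S. \<bar>z \<bullet> b\<bar>) \<le> (\<Sum>b\<in>S. r)" by (intro sum_mono) (auto simp: not_less)
      then have "norm z \<le> real (card S) * r" using norm_le_frame[of z] by simp
      then show False using z S0 by (simp add: R_def)
    qed
    then obtain b where b: "b \<in> S" "\<bar>z \<bullet> b\<bar> > r" by blast
    have "cutoff s N z = 0"
      by (rule cutoff_eq_0[OF s b(1)]) (use b(2) r in auto)
    moreover have "\<phi> (z - center k) = 0" if k: "k \<in> ?K" for k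
    proof (rule test_function_jacobian(3)[OF \<phi>])
      have "norm (center k) \<le> (\<Sum>k\<in>?K. norm (center k))"
        by (rule member_le_sum[OF k _ finK]) simp
      moreover have "real (card S) * r \<ge> 0" using r by simp
      ultimately have "norm z > 1 + norm (center k)" using z unfolding R_def by linarith
      then show "z - center k \<notin> ball 0 1"
        using norm_triangle_ineq2[of z "center k"] by simp
    qed
    ultimately show ?thesis by (simp add: competitor_def)
  qed
  then show thesis by (rule that)
qed

text \<open>Off the kinks there are three regions: inner cells, where the gradient is known exactly;
  boundary cells, where a bound free of N suffices; and the outside, where the gradient
  vanishes.\<close>

lemma competitor_gradient:
  fixes \<phi> :: "real^'d \<Rightarrow> real^'m" and a :: "real^'m"
  assumes \<phi>: "\<phi> \<in> test_functions (ball 0 1)" and s: "0 < s" "s \<le> 1"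
    and z: "\<forall>b\<in>S. z \<bullet> b \<notin> kinks s N"
  defines "v \<equiv> competitor s N a \<phi>"
    and "K \<equiv> PiE (S - {n}) (\<lambda>_. {1..N})" and "J \<equiv> PiE (S - {n}) (\<lambda>_. {0..N+1})"
  shows "v differentiable (at z)"
    and "k \<in> K \<Longrightarrow> z - center k \<in> slab (-1) (1/s) \<Longrightarrow> jacobian v (at z) = cell_gradient s a \<phi> (z - center k)"
    and "k \<in> J - K \<Longrightarrow> z - center k \<in> slab (-1) (1/s) \<Longrightarrow>
      norm (jacobian v (at z)) \<le> real CARD('m) * real CARD('d) * (real (card S) * norm a)"
    and "(\<forall>k\<in>J. z - center k \<notin> slab (-1) (1/s)) \<Longrightarrow> jacobian v (at z) = 0"
proof -
  define u where "u z = (- cutoff s N z) *\<^sub>R a" for z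
  define P where "P z = (\<Sum>k\<in>K. \<phi> (z - center k))" for z
  have v: "v = (\<lambda>z. u z + P z)" by (simp add: v_def competitor_def u_def P_def K_def fun_eq_iff)
  obtain D where D: "(cutoff s N has_derivative D) (at z)"
    using cutoff_differentiable[OF s(1) z] unfolding differentiable_def by blast
  have u_der: "(u has_derivative (\<lambda>h. (- D h) *\<^sub>R a)) (at z)"
    unfolding u_def by (auto intro!: derivative_eq_intros D)
  then have u_diff: "u differentiable (at z)" unfolding differentiable_def by blast
  have P_der: "(P has_derivative (\<lambda>h. (\<Sum>k\<in>K. jacobian \<phi> (at (z - center k))) *v h)) (at z)"
  proof -
    have "((\<lambda>z. z - center k) has_derivative (\<lambda>h. h)) (at z)" for k
      by (auto intro!: derivative_eq_intros)
    from has_derivative_compose[OF this test_function_jacobian(1)[OF \<phi>]]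
    have "((\<lambda>z. \<phi> (z - center k)) has_derivative (\<lambda>h. jacobian \<phi> (at (z - center k)) *v h)) (at z)" for k .
    then have "(P has_derivative (\<lambda>h. \<Sum>k\<in>K. jacobian \<phi> (at (z - center k)) *v h)) (at z)"
      unfolding P_def by (intro has_derivative_sum)
    moreover have "(\<Sum>k\<in>K. jacobian \<phi> (at (z - center k)) *v h) = (\<Sum>k\<in>K. jacobian \<phi> (at (z - center k))) *v h" for h
      by (induction K rule: infinite_finite_induct) (auto simp: matrix_vector_mult_add_rdistrib)
    ultimately show ?thesis by simp
  qed
  then have P_diff: "P differentiable (at z)" unfolding differentiable_def by blast
  show "v differentiable (at z)" unfolding v by (intro differentiable_add u_diff P_diff)
  have J: "jacobian v (at z) = jacobian u (at z) + (\<Sum>k\<in>K. jacobian \<phi> (at (z - center k)))"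
    unfolding v using jacobian_add[OF u_diff P_diff] jacobian_eqI[OF P_der] by simp
  have finK: "finite K" unfolding K_def using fin by (intro finite_PiE) auto
  \<comment> \<open>A point of one cell differs from the centre of any other inner cell by at least
    1 in some lateral direction, so at most one copy of \<phi> is alive there.\<close>
  have other: "jacobian \<phi> (at (z - center k')) = 0"
    if k: "k \<in> J" "z - center k \<in> slab (-1) (1/s)" and k': "k' \<in> K" "k' \<noteq> k" for k k'
  proof (rule test_function_jacobian(4)[OF \<phi>])
    obtain b where b: "b \<in> S - {n}" "k b \<noteq> k' b"
      using PiE_neqE[of k "S - {n}" _ k'] k(1) k' unfolding J_def K_def by metis
    have "1 \<le> \<bar>(z - center k') \<bullet> b\<bar>" by (rule cell_unique[where k = k and k' = k' and b = b, OF k(2) b])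
    also have "\<dots> \<le> norm (z - center k')" using b by (intro abs_inner_le) auto
    finally show "z - center k' \<notin> ball 0 1" by simp
  qed
  have KJ: "K \<subseteq> J" unfolding K_def J_def by (intro PiE_mono) auto
  have u_bound: "norm (jacobian u (at z)) \<le> real CARD('m) * real CARD('d) * (real (card S) * norm a)"
  proof -
    have "norm (u x - u y) \<le> (real (card S) * norm a) * norm (x - y)" for x y
    proof -
      have "u x - u y = (cutoff s N y - cutoff s N x) *\<^sub>R a" by (simp add: u_def algebra_simps)
      then have "norm (u x - u y) = \<bar>cutoff s N x - cutoff s N y\<bar> * norm a" by (simp add: abs_minus_commute)
      also have "\<dots> \<le> (real (card S) * norm (x - y)) * norm a"
        by (intro mult_right_mono cutoff_lipschitz s) auto
      finally show ?thesis by (simp add: mult_ac)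
    qed
    from derivative_matrix_norm_le[OF this has_derivative_jacobian[OF u_diff]] show ?thesis by simp
  qed
  show "jacobian v (at z) = cell_gradient s a \<phi> (z - center k)"
    if k: "k \<in> K" and zk: "z - center k \<in> slab (-1) (1/s)"
  proof -
    have "(\<Sum>k\<in>K. jacobian \<phi> (at (z - center k))) =
        (\<Sum>k'\<in>K. if k = k' then jacobian \<phi> (at (z - center k)) else 0)"
      using other[of k] k zk KJ by (intro sum.cong) auto
    then have sum: "(\<Sum>k\<in>K. jacobian \<phi> (at (z - center k))) = jacobian \<phi> (at (z - center k))"
      using finK k by simp
    have zn: "(z - center k) \<bullet> n = z \<bullet> n" using center_inner[OF n, of k] by (simp add: inner_diff_left)
    have "z \<bullet> n \<notin> kinks s N" using z n by blast
    then have t: "-1 < z \<bullet> n" "z \<bullet> n < 1/s" "z \<bullet> n \<noteq> 0"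
      using zk zn unfolding slab_def kinks_def by auto
    let ?c = "if z \<bullet> n < 0 then 1 else - s"
    have "((\<lambda>w. hat s (w \<bullet> n)) has_derivative (\<lambda>h. ?c * (h \<bullet> n))) (at z)"
      by (rule has_derivative_compose[OF has_derivative_inner_left[OF has_derivative_ident] hat_derivative])
        (use s t in auto)
    then have "(cutoff s N has_derivative (\<lambda>h. ?c * (h \<bullet> n))) (at z)"
    proof -
      obtain V where V: "open V" "z \<in> V" "\<forall>w\<in>V. cutoff s N w = hat s (w \<bullet> n)"
        using cutoff_eq_hat[OF k[unfolded K_def] zk] unfolding eventually_nhds by metis
      assume "((\<lambda>w. hat s (w \<bullet> n)) has_derivative (\<lambda>h. ?c * (h \<bullet> n))) (at z)"
      then show ?thesis
        by (rule has_derivative_transform_within_open[OF _ V(1,2)]) (use V(3) in simp)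
    qed
    then have "(u has_derivative (\<lambda>h. (- (?c * (h \<bullet> n))) *\<^sub>R a)) (at z)"
      unfolding u_def by (auto intro!: derivative_eq_intros)
    moreover have "(\<lambda>h. (- (?c * (h \<bullet> n))) *\<^sub>R a) = (\<lambda>h. ((- ?c) *\<^sub>R (a \<otimes> n)) *v h)"
      by (simp only: scaleR_matrix_vector_assoc[symmetric] outer_mult_vec scaleR_scaleR mult_minus_left)
    ultimately have "jacobian u (at z) = (- ?c) *\<^sub>R (a \<otimes> n)"
      by (intro jacobian_eqI) (simp only:)
    then show ?thesis
      unfolding J sum by (auto simp: cell_gradient_def zn)
  qed
  show "norm (jacobian v (at z)) \<le> real CARD('m) * real CARD('d) * (real (card S) * norm a)"
    if "k \<in> J - K" "z - center k \<in> slab (-1) (1/s)"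
  proof -
    have "(\<Sum>k\<in>K. jacobian \<phi> (at (z - center k))) = 0"
      using other[of k] that by (intro sum.neutral) auto
    then show ?thesis using u_bound J by simp
  qed
  show "jacobian v (at z) = 0" if out: "\<forall>k\<in>J. z - center k \<notin> slab (-1) (1/s)"
  proof -
    have "jacobian \<phi> (at (z - center k)) = 0" if k: "k \<in> K" for k
    proof (rule test_function_jacobian(4)[OF \<phi>], rule notI)
      assume "z - center k \<in> ball 0 1"
      then have "norm (z - center k) < 1" by simp
      then have *: "\<bar>(z - center k) \<bullet> b\<bar> < 1" if "b \<in> S" for b
        using abs_inner_le[OF that] by (meson le_less_trans)
      have "-1 \<le> (z - center k) \<bullet> b \<and> (z - center k) \<bullet> b < 1" if "b \<in> S" for b
        using *[OF that] by (auto simp: abs_less_iff)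
      \<comment> \<open>Thanks to s \<le> 1 the cell is high enough to contain the whole unit ball
        around its centre.\<close>
      moreover have "1 \<le> 1/s" using s by simp
      ultimately have "z - center k \<in> slab (-1) (1/s)"
        using n unfolding slab_def by force
      then show False using out k KJ by blast
    qed
    then have sum: "(\<Sum>k\<in>K. jacobian \<phi> (at (z - center k))) = 0" by (intro sum.neutral) auto
    have "\<exists>b\<in>S. z \<bullet> b < -1 \<or> z \<bullet> b > (if b = n then 1/s else 2 * real N + 3)"
    proof (rule ccontr)
      assume a: "\<not> ?thesis"
      \<comment> \<open>Avoiding the kinks turns the non-strict bounds at the upper faces into the
        strict ones of a half-open cell.\<close>
      have "z \<bullet> b \<noteq> 1/s" "z \<bullet> b \<noteq> 2 * real N + 3" if "b \<in> S" for b
        using z that by (auto simp: kinks_def)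
      then have "\<forall>b\<in>S - {n}. -1 \<le> z \<bullet> b \<and> z \<bullet> b < 2 * real N + 3" "-1 \<le> z \<bullet> n" "z \<bullet> n < 1/s"
        using a n by (auto simp: not_less less_le)
      from cell_cover[OF this] out show False unfolding J_def by metis
    qed
    then obtain b where b: "b \<in> S" "z \<bullet> b < -1 \<or> z \<bullet> b > (if b = n then 1/s else 2 * real N + 3)" by blast
    let ?V = "{w. w \<bullet> b < -1} \<union> {w. w \<bullet> b > (if b = n then 1/s else 2 * real N + 3)}"
    have "((\<lambda>_. 0) has_derivative (\<lambda>h. 0)) (at z)" by simp
    then have "(u has_derivative (\<lambda>h. 0)) (at z)"
    proof (rule has_derivative_transform_within_open[where s = ?V])
      show "open ?V" by (intro open_Un open_Collect_less continuous_intros)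
      show "z \<in> ?V" using b by auto
      show "0 = u w" if "w \<in> ?V" for w
        using cutoff_eq_0[OF s(1) b(1), of w N] that by (auto simp: u_def)
    qed
    then have "jacobian u (at z) = 0" by (intro jacobian_eqI) simp
    then show ?thesis unfolding J sum by simp
  qed
qed

end

text \<open>After division by N^p the second term carries (1 + 2/N)^p - 1, which tends to 0:
  boundary cells are a vanishing fraction. In dimension one p is 0 and there are no boundary cells
  at all.\<close>

lemma polynomial_growth_limit:
  fixes e C :: real
  assumes "\<And>N::nat. N \<ge> 1 \<Longrightarrow> 0 \<le> real N ^ p * e + (real (N + 2) ^ p - real N ^ p) * C"
  shows "0 \<le> e"
proof -
  have "(\<lambda>N. e + ((1 + 2 * inverse (real (Suc N))) ^ p - 1) * C) \<longlonglongrightarrow> e + ((1 + 2 * 0) ^ p - 1) * C"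
    by (intro tendsto_intros LIMSEQ_inverse_real_of_nat)
  moreover have "0 \<le> e + ((1 + 2 * inverse (real (Suc N))) ^ p - 1) * C" for N
  proof -
    let ?x = "real (Suc N)"
    have "real (Suc N + 2) = ?x * (1 + 2 * inverse ?x)" by (simp add: field_simps)
    then have "real (Suc N + 2) ^ p = ?x ^ p * (1 + 2 * inverse ?x) ^ p" by (simp add: power_mult_distrib)
    then have "0 \<le> ?x ^ p * (e + ((1 + 2 * inverse ?x) ^ p - 1) * C)"
      using assms[of "Suc N"] by (simp add: algebra_simps)
    moreover have "?x ^ p > 0" by (intro zero_less_power) simp
    ultimately show ?thesis by (metis zero_le_mult_iff not_less)
  qed
  ultimately have "0 \<le> e + ((1 + 2 * 0) ^ p - 1) * C"
    by (intro LIMSEQ_le_const) auto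
  then show ?thesis by simp
qed

section \<open>Energy per cell\<close>

context orthonormal_frame
begin

lemma cell_gradient_measurable:
  fixes \<phi> :: "real^'d \<Rightarrow> real^'m"
  assumes "\<phi> \<in> test_functions U"
  shows "cell_gradient s a \<phi> \<in> borel_measurable borel"
  unfolding cell_gradient_def[abs_def]
  using test_function_jacobian(5)[OF assms] by measurable

text \<open>The energy excess of the competitor splits over the cells. The N^p inner cells all
  contribute the same integral, the boundary cells contribute at most a constant each, and the
  outside contributes nothing. Since the total is nonnegative for every N, so is the contribution of
  one inner cell.\<close>

lemma cell_energy_nonneg:
  fixes \<phi> :: "real^'d \<Rightarrow> real^'m" and W :: "real^'d^'m \<Rightarrow> real"
  assumes W: "continuous_on UNIV W" "bdd_below (range W)" and Q: "quasiconvex_envelope W F = W F"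
    and \<phi>: "\<phi> \<in> test_functions (ball 0 1)" and s: "0 < s" "s \<le> 1"
  shows "0 \<le> (\<integral>x. indicator (slab (-1) (1/s)) x * (W (F + cell_gradient s a \<phi> x) - W F) \<partial>lebesgue)"
proof -
  define C where "C = slab (-1) (1/s)"
  define p where "p = card (S - {n})"
  define B where "B = real CARD('m) * real CARD('d) * (real (card S) * norm a)"
  define \<psi> where "\<psi> x = indicator C x * (W (F + cell_gradient s a \<phi> x) - W F)" for x
  have C: "C \<in> lmeasurable" "C \<in> sets borel" unfolding C_def by (rule slab_lmeasurable, rule slab_borel)
  have Wm: "W \<in> borel_measurable borel" using W(1) by (rule borel_measurable_continuous_onI)
  have \<psi>_borel: "\<psi> \<in> borel_measurable borel"
    unfolding \<psi>_def using C(2) Wm cell_gradient_measurable[OF \<phi>] by measurable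
  then have \<psi>m: "\<psi> \<in> borel_measurable lebesgue" by (simp add: measurable_completion)
  \<comment> \<open>A one-sided bound is enough, because the boundary cells have to be estimated
    only from above. It depends on \<open>B\<close> and therefore not on N.\<close>
  obtain M where M: "\<And>X. norm X \<le> B \<Longrightarrow> W (F + X) - W F \<le> M"
  proof -
    obtain K where K: "\<And>X. norm X \<le> norm F + B \<Longrightarrow> \<bar>W X\<bar> \<le> K"
      using continuous_bounded_on_cball[OF W(1)] by blast
    have "W (F + X) - W F \<le> K - W F" if "norm X \<le> B" for X
      using K[of "F + X"] norm_triangle_ineq[of F X] that by simp
    then show thesis by (rule that)
  qed
  have "0 \<le> real N ^ p * (\<integral>x. \<psi> x \<partial>lebesgue) + (real (N + 2) ^ p - real N ^ p) * (M * measure lebesgue C)"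
    for N :: nat
  proof -
    define v where "v = competitor s N a \<phi>"
    define K where "K = PiE (S - {n}) (\<lambda>_. {1..N})"
    define J where "J = PiE (S - {n}) (\<lambda>_. {0..N+1})"
    define f where "f z = W (F + jacobian v (at z)) - W F" for z
    have fin': "finite J" "finite K" unfolding J_def K_def using fin by (auto intro: finite_PiE)
    have KJ: "K \<subseteq> J" unfolding K_def J_def by (intro PiE_mono) auto
    have card: "card K = N ^ p" "card J = (N + 2) ^ p"
      using fin by (simp_all add: K_def J_def card_PiE p_def)
    have off: "AE z in lebesgue. \<forall>b\<in>S. z \<bullet> b \<notin> kinks s N"
      by (rule AE_off_hyperplanes) (simp add: kinks_def)
    have "AE z in lebesgue. v differentiable (at z)"
      using off by eventually_elim (simp add: v_def competitor_gradient(1)[OF \<phi> s])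
    then have D: "AE z in lebesgue. (v has_derivative (\<lambda>h. jacobian v (at z) *v h)) (at z)"
      by eventually_elim (rule has_derivative_jacobian)
    obtain L where L: "\<And>x z. norm (v x - v z) \<le> L * norm (x - z)"
      using competitor_lipschitz[OF \<phi> s] unfolding v_def by metis
    obtain R where R: "\<And>z. norm z > R \<Longrightarrow> v z = 0"
      using competitor_support[OF \<phi> s(1)] unfolding v_def by metis
    have fi: "integrable lebesgue f" and f0: "0 \<le> (\<integral>z. f z \<partial>lebesgue)"
      unfolding f_def by (rule quasiconvexity_lipschitz[OF W Q L R D]; simp)+
    define T where "T k = (\<lambda>z. z - center k) -` C" for k
    have T: "T k \<in> lmeasurable" "measure lebesgue (T k) = measure lebesgue C" for k
    proof -
      have "T k = (+) (center k) ` C"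
        unfolding T_def by (auto intro!: image_eqI[of _ _ "_ - center k"])
      then show "T k \<in> lmeasurable" "measure lebesgue (T k) = measure lebesgue C"
        using C(1) by (simp_all add: measurable_translation measure_translation)
    qed
    have Ti: "integrable lebesgue (\<lambda>z. indicator (T k) z * f z)" for k
      using integrable_mult_indicator[OF _ fi, of "T k"] T(1)[of k] by (simp add: fmeasurableD)
    have sum: "AE z in lebesgue. f z = (\<Sum>k\<in>J. indicator (T k) z * f z)"
      using off
    proof eventually_elim
      case (elim z)
      show ?case
      proof (cases "\<exists>k\<in>J. z \<in> T k")
        case True
        then obtain k where k: "k \<in> J" "z - center k \<in> slab (-1) (1/s)" by (auto simp: T_def C_def)
        have "z \<notin> T k'" if k'J: "k' \<in> J" "k' \<noteq> k" for k'
        proof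
          assume "z \<in> T k'"
          then have k': "z - center k' \<in> slab (-1) (1/s)" by (simp add: T_def C_def)
          obtain b where "b \<in> S - {n}" "k b \<noteq> k' b"
            using PiE_neqE[of k "S - {n}" _ k'] k(1) k'J unfolding J_def by metis
          with cell_disjoint[OF k(2) k'] show False by metis
        qed
        then have "(\<Sum>k'\<in>J. indicator (T k') z * f z) = (\<Sum>k'\<in>J. if k = k' then f z else 0)"
          using k by (intro sum.cong) (auto simp: T_def C_def)
        then show ?thesis using k(1) fin' by simp
      next
        case False
        then have "\<forall>k\<in>J. z - center k \<notin> slab (-1) (1/s)" by (auto simp: T_def C_def)
        then have "jacobian v (at z) = 0"
          using competitor_gradient(4)[OF \<phi> s elim] unfolding v_def J_def by blast
        moreover have "(\<Sum>k\<in>J. indicator (T k) z * f z) = 0" using False by (intro sum.neutral) auto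
        ultimately show ?thesis by (simp add: f_def)
      qed
    qed
    have "(\<integral>z. f z \<partial>lebesgue) = (\<integral>z. (\<Sum>k\<in>J. indicator (T k) z * f z) \<partial>lebesgue)"
      using Ti sum borel_measurable_integrable[OF fi]
      by (intro integral_cong_AE) (auto intro!: borel_measurable_sum borel_measurable_integrable)
    also have "\<dots> = (\<Sum>k\<in>J. \<integral>z. indicator (T k) z * f z \<partial>lebesgue)"
      by (rule Bochner_Integration.integral_sum) (rule Ti)
    also have "\<dots> = (\<Sum>k\<in>K. \<integral>z. indicator (T k) z * f z \<partial>lebesgue)
        + (\<Sum>k\<in>J - K. \<integral>z. indicator (T k) z * f z \<partial>lebesgue)"
      using sum.subset_diff[OF KJ fin'(1)] by (simp add: add.commute)
    also have "(\<Sum>k\<in>K. \<integral>z. indicator (T k) z * f z \<partial>lebesgue) = (\<Sum>k\<in>K. \<integral>x. \<psi> x \<partial>lebesgue)"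
    proof (rule sum.cong)
      fix k assume k: "k \<in> K"
      have shift: "(\<lambda>z. \<psi> (z - center k)) \<in> borel_measurable lebesgue"
        using measurable_compose[OF lebesgue_affine(1)[of 1 "- center k"] \<psi>m] by simp
      have "(\<integral>z. indicator (T k) z * f z \<partial>lebesgue) = (\<integral>z. \<psi> (z - center k) \<partial>lebesgue)"
      proof (rule integral_cong_AE[OF borel_measurable_integrable[OF Ti] shift])
        show "AE z in lebesgue. indicator (T k) z * f z = \<psi> (z - center k)"
          using off
        proof eventually_elim
          case (elim z)
          show ?case
            using competitor_gradient(2)[OF \<phi> s elim k[unfolded K_def]]
            by (auto simp: indicator_def T_def C_def \<psi>_def f_def v_def)
        qed
      qed
      also have "\<dots> = (\<integral>x. \<psi> x \<partial>lebesgue)"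
        using integral_lebesgue_affine[OF \<psi>m, of 1 "- center k"] by simp
      finally show "(\<integral>z. indicator (T k) z * f z \<partial>lebesgue) = (\<integral>x. \<psi> x \<partial>lebesgue)" .
    qed simp
    also have "(\<Sum>k\<in>J - K. \<integral>z. indicator (T k) z * f z \<partial>lebesgue) \<le> (\<Sum>k\<in>J - K. M * measure lebesgue C)"
    proof (rule sum_mono)
      fix k assume k: "k \<in> J - K"
      have "(\<integral>z. indicator (T k) z * f z \<partial>lebesgue) \<le> (\<integral>z. M * indicator (T k) z \<partial>lebesgue)"
      proof (rule integral_mono_AE[OF Ti])
        show "integrable lebesgue (\<lambda>z. M * indicator (T k) z)"
          using T(1)[of k] by (intro integrable_mult_right integrable_real_indicator) (auto simp: fmeasurable_def)
        show "AE z in lebesgue. indicator (T k) z * f z \<le> M * indicator (T k) z"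
          using off
        proof eventually_elim
          case (elim z)
          show ?case
            using competitor_gradient(3)[OF \<phi> s elim k[unfolded K_def J_def]] M
            by (auto simp: indicator_def T_def C_def f_def v_def B_def)
        qed
      qed
      also have "\<dots> = M * measure lebesgue C"
        using T[of k] by (simp add: fmeasurableD)
      finally show "(\<integral>z. indicator (T k) z * f z \<partial>lebesgue) \<le> M * measure lebesgue C" .
    qed
    finally have "(\<integral>z. f z \<partial>lebesgue) \<le> real (card K) * (\<integral>x. \<psi> x \<partial>lebesgue)
        + real (card (J - K)) * (M * measure lebesgue C)" by simp
    moreover have "real (card (J - K)) = real (card J) - real (card K)"
      using card_Diff_subset[OF fin'(2) KJ] card_mono[OF fin'(1) KJ] by (simp add: of_nat_diff)
    ultimately have "0 \<le> real (card K) * (\<integral>x. \<psi> x \<partial>lebesgue)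
        + (real (card J) - real (card K)) * (M * measure lebesgue C)"
      using f0 by simp
    then show ?thesis unfolding card by simp
  qed
  then have "0 \<le> (\<integral>x. \<psi> x \<partial>lebesgue)" by (rule polynomial_growth_limit)
  then show ?thesis unfolding \<psi>_def C_def .
qed

end

section \<open>Sufficiency\<close>

text \<open>Subtracting the energies of the phases makes the integrand vanish where the test
  function does not act, so the integral can run over the whole space. The hyperplane, a null set,
  is counted with the phase \<open>Fp\<close>.\<close>

definition interface_excess ::
    "(real^'d^'m \<Rightarrow> real) \<Rightarrow> real^'d^'m \<Rightarrow> real^'d^'m \<Rightarrow> real^'d \<Rightarrow> (real^'d \<Rightarrow> real^'m) \<Rightarrow> real^'d \<Rightarrow> real"
  where "interface_excess W Fp Fm n \<phi> z =
    (if z \<bullet> n < 0 then W (Fm + jacobian \<phi> (at z)) - W Fm else W (Fp + jacobian \<phi> (at z)) - W Fp)"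

lemma test_function_jacobian_bounded:
  fixes \<phi> :: "real^'d \<Rightarrow> real^'m"
  assumes "\<phi> \<in> test_functions U"
  obtains B where "B \<ge> 0" and "\<And>z. norm (jacobian \<phi> (at z)) \<le> B"
proof -
  obtain L where L: "\<And>x y. norm (\<phi> x - \<phi> y) \<le> L * norm (x - y)"
    using test_function_lipschitz[OF assms] by metis
  have "norm (jacobian \<phi> (at z)) \<le> real CARD('m) * real CARD('d) * \<bar>L\<bar>" for z
    by (rule derivative_matrix_norm_le[OF L test_function_jacobian(1)[OF assms]])
  then show thesis by (rule that[rotated]) simp
qed

text \<open>The bound is uniform in both phases on a ball of matrices because in the limit of thick
  layers the upper phase moves with H.\<close>

lemma interface_excess_bound:
  fixes \<phi> :: "real^'d \<Rightarrow> real^'m"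
  assumes W: "continuous_on UNIV W" and \<phi>: "\<phi> \<in> test_functions (ball 0 1)"
  obtains K where "\<And>Fp Fm z. norm Fp \<le> C \<Longrightarrow> norm Fm \<le> C \<Longrightarrow>
    \<bar>interface_excess W Fp Fm n \<phi> z\<bar> \<le> K * indicator (ball 0 1) z"
proof -
  obtain B where B: "B \<ge> 0" "\<And>z. norm (jacobian \<phi> (at z)) \<le> B"
    using test_function_jacobian_bounded[OF \<phi>] by blast
  obtain K where K: "\<And>X. norm X \<le> C + B \<Longrightarrow> \<bar>W X\<bar> \<le> K"
    using continuous_bounded_on_cball[OF W, of "C + B"] by blast
  have "\<bar>W (F + jacobian \<phi> (at z)) - W F\<bar> \<le> 2 * K * indicator (ball 0 1) z" if F: "norm F \<le> C" for F z
  proof (cases "z \<in> ball 0 1")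
    case True
    have "norm (F + jacobian \<phi> (at z)) \<le> C + B"
      using norm_triangle_ineq[of F "jacobian \<phi> (at z)"] F B(2)[of z] by linarith
    then have "\<bar>W (F + jacobian \<phi> (at z))\<bar> \<le> K" by (rule K)
    moreover have "\<bar>W F\<bar> \<le> K" using F B(1) by (intro K) simp
    ultimately show ?thesis using True by (simp add: indicator_def)
  next
    case False
    then show ?thesis using test_function_jacobian(4)[OF \<phi>, of z] by simp
  qed
  then show thesis by (intro that[of "2 * K"]) (simp add: interface_excess_def)
qed

lemma interface_excess_measurable:
  fixes \<phi> :: "real^'d \<Rightarrow> real^'m"
  assumes W: "continuous_on UNIV W" and \<phi>: "\<phi> \<in> test_functions U"
  shows "interface_excess W Fp Fm n \<phi> \<in> borel_measurable borel"
proof -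
  have "W \<in> borel_measurable borel" using W by (rule borel_measurable_continuous_onI)
  then show ?thesis
    unfolding interface_excess_def[abs_def] using test_function_jacobian(5)[OF \<phi>] by measurable
qed

lemma interface_excess_integrable:
  fixes \<phi> :: "real^'d \<Rightarrow> real^'m"
  assumes W: "continuous_on UNIV W" and \<phi>: "\<phi> \<in> test_functions (ball 0 1)"
  shows "integrable lebesgue (interface_excess W Fp Fm n \<phi>)"
proof -
  obtain K where K: "\<And>z. \<bar>interface_excess W Fp Fm n \<phi> z\<bar> \<le> K * indicator (ball 0 1) z"
    using interface_excess_bound[OF W \<phi>, of "max (norm Fp) (norm Fm)" n] by (metis max.cobounded1 max.cobounded2)
  have "norm (interface_excess W Fp Fm n \<phi> z) \<le> norm (K * indicator (ball 0 1) z :: real)" for z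
    using K[of z] abs_ge_self[of "K * indicator (ball 0 1) z :: real"] unfolding real_norm_def by linarith
  then show ?thesis
    by (intro Bochner_Integration.integrable_bound[OF indicator_ball_integral(1)[of K 0 1]])
      (use interface_excess_measurable[OF W \<phi>] in \<open>auto simp: measurable_completion\<close>)
qed

section \<open>Stability as the sign of one integral\<close>

lemma half_balls:
  fixes n :: "real^'d"
  assumes n: "norm n = 1"
  shows "{z \<in> ball 0 1. z \<bullet> n > 0} \<in> lmeasurable" and "{z \<in> ball 0 1. - z \<bullet> n > 0} \<in> lmeasurable"
    and "measure lebesgue {z \<in> ball 0 1. z \<bullet> n > 0} > 0"
    and "measure lebesgue {z \<in> ball 0 1. - z \<bullet> n > 0} = measure lebesgue {z \<in> ball 0 1. z \<bullet> n > 0}"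
proof -
  let ?P = "{z \<in> ball 0 1. z \<bullet> n > 0}" and ?M = "{z \<in> ball 0 1. - z \<bullet> n > 0}"
  have "?P = ball 0 1 \<inter> {z. 0 < z \<bullet> n}" "?M = ball 0 1 \<inter> {z. z \<bullet> n < 0}" by auto
  moreover have "open (ball 0 1 \<inter> {z. 0 < z \<bullet> n})" "open (ball 0 1 \<inter> {z. z \<bullet> n < 0})"
    by (intro open_Int open_ball open_Collect_less continuous_intros)+
  ultimately have "open ?P" "open ?M" by simp_all
  moreover have "bounded ?P" "bounded ?M" by (rule bounded_subset[OF bounded_ball[of 0 1]]; auto)+
  ultimately show P: "?P \<in> lmeasurable" and "?M \<in> lmeasurable" by (simp_all add: lmeasurable_open)
  let ?c = "(1/2) *\<^sub>R n"
  have nn: "n \<bullet> n = 1" using n by (simp add: norm_eq_1)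
  have "ball ?c (1/2) \<subseteq> ?P"
  proof
    fix x assume "x \<in> ball ?c (1/2)"
    then have *: "norm (x - ?c) < 1/2" by (simp add: dist_norm norm_minus_commute)
    have "norm x \<le> norm (x - ?c) + norm ?c" by (metis diff_add_cancel norm_triangle_ineq)
    then have "norm x < 1" using * n by simp
    moreover have "\<bar>(x - ?c) \<bullet> n\<bar> \<le> norm (x - ?c)" using Cauchy_Schwarz_ineq2[of "x - ?c" n] n by simp
    then have "x \<bullet> n > 0" using * nn by (simp add: inner_diff_left)
    ultimately show "x \<in> ?P" by simp
  qed
  then have "measure lebesgue (ball ?c (1/2)) \<le> measure lebesgue ?P"
    by (intro measure_mono_fmeasurable P) auto
  moreover have "measure lebesgue (ball ?c (1/2)) > 0" by (simp add: content_ball_pos)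
  ultimately show "measure lebesgue ?P > 0" by linarith
  have "?M = (\<lambda>x. (-1) *\<^sub>R x + 0) ` ?P"
    by (auto intro!: image_eqI[of _ _ "- _"])
  then show "measure lebesgue ?M = measure lebesgue ?P"
    using measure_lebesgue_affine[of "-1" "0::real^'d" ?P] by simp
qed

lemma average_eq_excess:
  assumes "D \<in> lmeasurable" and "measure lebesgue D > 0" and "integrable (lebesgue_on D) f"
  shows "average D f = c + (\<integral>z. f z - c \<partial>lebesgue_on D) / measure lebesgue D"
proof -
  interpret finite_measure "lebesgue_on D"
    using assms(1) by (rule finite_measure_lebesgue_on)
  have "(\<integral>z. f z - c \<partial>lebesgue_on D) = (\<integral>z. f z \<partial>lebesgue_on D) - (\<integral>z. c \<partial>lebesgue_on D)"
    using assms(3) by (intro Bochner_Integration.integral_diff) auto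
  also have "(\<integral>z. c \<partial>lebesgue_on D) = c * measure lebesgue D"
    using assms(1) measure_restrict_space[of D lebesgue D] by (simp add: fmeasurableD)
  finally show ?thesis using assms(2) by (simp add: average_def field_simps)
qed

text \<open>The half balls are mirror images and have the same measure m. Hence the two averages,
  minus the phase energies, add up to 1/m times a single integral of the excess.\<close>

lemma strongly_locally_stable_iff:
  fixes W :: "real^'d^'m \<Rightarrow> real" and n :: "real^'d"
  assumes W: "continuous_on UNIV W" and n: "norm n = 1"
  shows "strongly_locally_stable W Fp Fm n \<longleftrightarrow>
    (\<forall>\<phi>\<in>test_functions (ball 0 1). 0 \<le> (\<integral>z. interface_excess W Fp Fm n \<phi> z \<partial>lebesgue))"
proof -
  let ?P = "{z \<in> ball 0 1. z \<bullet> n > 0}" and ?M = "{z \<in> ball 0 1. - z \<bullet> n > 0}"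
  define m where "m = measure lebesgue ?P"
  note hb = half_balls[OF n]
  have key: "average ?P (\<lambda>z. W (Fp + jacobian \<phi> (at z))) + average ?M (\<lambda>z. W (Fm + jacobian \<phi> (at z)))
      = W Fp + W Fm + (\<integral>z. interface_excess W Fp Fm n \<phi> z \<partial>lebesgue) / m"
    if \<phi>: "\<phi> \<in> test_functions (ball 0 1)" for \<phi> :: "real^'d \<Rightarrow> real^'m"
  proof -
    obtain B where B: "\<And>z. norm (jacobian \<phi> (at z)) \<le> B"
      using test_function_jacobian_bounded[OF \<phi>] by blast
    have int: "integrable (lebesgue_on D) (\<lambda>z. W (F + jacobian \<phi> (at z)))" if "D \<in> lmeasurable" for D F
    proof (rule L_infinity_compose_integrable[OF W _ that])
      have "(\<lambda>z. F + jacobian \<phi> (at z)) \<in> borel_measurable lebesgue"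
        using test_function_jacobian(5)[OF \<phi>] by (intro borel_measurable_add) (auto simp: measurable_completion)
      moreover have "norm (F + jacobian \<phi> (at z)) \<le> norm F + B" for z
        using norm_triangle_ineq[of F "jacobian \<phi> (at z)"] B[of z] by linarith
      ultimately show "(\<lambda>z. F + jacobian \<phi> (at z)) \<in> L_infinity D"
        unfolding L_infinity_def by (auto intro!: exI[of _ "norm F + B"] measurable_restrict_space1)
    qed
    let ?e = "interface_excess W Fp Fm n \<phi>"
    have em: "?e \<in> borel_measurable lebesgue"
      using interface_excess_measurable[OF W \<phi>] by (simp add: measurable_completion)
    have ei: "integrable lebesgue (\<lambda>z. if z \<in> D then ?e z else 0)" if "D \<in> lmeasurable" for D
    proof -
      have "(\<lambda>z. if z \<in> D then ?e z else 0) = (\<lambda>z. indicator D z *\<^sub>R ?e z)"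
        by (auto simp: indicator_def)
      then show ?thesis
        using that integrable_mult_indicator[OF _ interface_excess_integrable[OF W \<phi>]] by (simp add: fmeasurableD)
    qed
    have 1: "average ?P (\<lambda>z. W (Fp + jacobian \<phi> (at z))) = W Fp + (\<integral>z. (if z \<in> ?P then ?e z else 0) \<partial>lebesgue) / m"
    proof -
      have "(\<integral>z. W (Fp + jacobian \<phi> (at z)) - W Fp \<partial>lebesgue_on ?P)
          = (\<integral>z. (if z \<in> ?P then W (Fp + jacobian \<phi> (at z)) - W Fp else 0) \<partial>lebesgue)"
        by (rule Lebesgue_Measure.integral_restrict_UNIV[symmetric]) (use hb(1) in \<open>simp add: fmeasurableD\<close>)
      also have "\<dots> = (\<integral>z. (if z \<in> ?P then ?e z else 0) \<partial>lebesgue)"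
        by (intro Bochner_Integration.integral_cong) (auto simp: interface_excess_def)
      finally show ?thesis
        using average_eq_excess[OF hb(1,3) int[OF hb(1)], of Fp "W Fp"] by (simp add: m_def)
    qed
    have 2: "average ?M (\<lambda>z. W (Fm + jacobian \<phi> (at z))) = W Fm + (\<integral>z. (if z \<in> ?M then ?e z else 0) \<partial>lebesgue) / m"
    proof -
      have "(\<integral>z. W (Fm + jacobian \<phi> (at z)) - W Fm \<partial>lebesgue_on ?M)
          = (\<integral>z. (if z \<in> ?M then W (Fm + jacobian \<phi> (at z)) - W Fm else 0) \<partial>lebesgue)"
        by (rule Lebesgue_Measure.integral_restrict_UNIV[symmetric]) (use hb(2) in \<open>simp add: fmeasurableD\<close>)
      also have "\<dots> = (\<integral>z. (if z \<in> ?M then ?e z else 0) \<partial>lebesgue)"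
        by (intro Bochner_Integration.integral_cong) (auto simp: interface_excess_def)
      finally show ?thesis
        using average_eq_excess[OF hb(2) _ int[OF hb(2)], of Fm "W Fm"] hb(3,4) by (simp add: m_def)
    qed
    have "(\<integral>z. ?e z \<partial>lebesgue) = (\<integral>z. (if z \<in> ?P then ?e z else 0) + (if z \<in> ?M then ?e z else 0) \<partial>lebesgue)"
    proof (rule integral_cong_AE[OF em])
      show "(\<lambda>z. (if z \<in> ?P then ?e z else 0) + (if z \<in> ?M then ?e z else 0)) \<in> borel_measurable lebesgue"
        by (intro borel_measurable_add borel_measurable_integrable ei hb)
      have "negligible {z. n \<bullet> z = 0}"
        using n by (intro negligible_hyperplane) auto
      then have "{z. n \<bullet> z = 0} \<in> null_sets lebesgue" by (simp add: negligible_iff_null_sets)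
      from AE_not_in[OF this]
      show "AE z in lebesgue. ?e z = (if z \<in> ?P then ?e z else 0) + (if z \<in> ?M then ?e z else 0)"
      proof eventually_elim
        case (elim z)
        then have "z \<bullet> n \<noteq> 0" by (simp add: inner_commute)
        moreover have "?e z = 0" if "z \<notin> ball 0 1"
          using test_function_jacobian(4)[OF \<phi> that] by (simp add: interface_excess_def)
        ultimately show ?case by (cases "z \<in> ball 0 1") (auto simp: not_less)
      qed
    qed
    also have "\<dots> = (\<integral>z. (if z \<in> ?P then ?e z else 0) \<partial>lebesgue) + (\<integral>z. (if z \<in> ?M then ?e z else 0) \<partial>lebesgue)"
      by (intro Bochner_Integration.integral_add ei hb)
    finally show ?thesis unfolding 1 2 by (simp add: add_divide_distrib)
  qed
  have "m > 0" using hb(3) by (simp add: m_def)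
  then have "W Fp + W Fm \<le> average ?P (\<lambda>z. W (Fp + jacobian \<phi> (at z))) + average ?M (\<lambda>z. W (Fm + jacobian \<phi> (at z)))
      \<longleftrightarrow> 0 \<le> (\<integral>z. interface_excess W Fp Fm n \<phi> z \<partial>lebesgue)"
    if "\<phi> \<in> test_functions (ball 0 1)" for \<phi> :: "real^'d \<Rightarrow> real^'m"
    unfolding key[OF that] by (simp add: zero_le_divide_iff)
  then show ?thesis
    unfolding strongly_locally_stable_def Ball_def by (intro all_cong1 imp_cong refl)
qed

text \<open>In the inner cell with s = 1/H the compensating layer has volume \<kappa> H and constant
  excess W(F + A/H) - W(F). Their product tends to \<kappa> times the directional derivative of W
  along A, while the copy of \<phi> sees an upper phase that converges to F.\<close>

lemma (in orthonormal_frame) layer_inequality_frame: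
  fixes \<phi> :: "real^'d \<Rightarrow> real^'m" and W :: "real^'d^'m \<Rightarrow> real"
  assumes W: "continuous_on UNIV W" "bdd_below (range W)" and Q: "quasiconvex_envelope W F = W F"
    and P: "GDERIV W F :> P" and \<phi>: "\<phi> \<in> test_functions (ball 0 1)"
  shows "0 \<le> measure lebesgue (slab (-1) 0) * (W (F - a \<otimes> n) - W F + P \<bullet> (a \<otimes> n))
      + (\<integral>z. interface_excess W F (F - a \<otimes> n) n \<phi> z \<partial>lebesgue)"
proof -
  define A where "A = a \<otimes> n"
  define \<kappa> where "\<kappa> = measure lebesgue (slab (-1) 0)"
  \<comment> \<open>Integer thickness, so that the layer is a stack of unit layers, and at least 1,
    so that the slope 1/H is at most 1.\<close>
  define H where "H i = real (Suc i)" for i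
  define e where "e s = interface_excess W (F + s *\<^sub>R A) (F - A) n \<phi>" for s
  \<comment> \<open>The first two terms are the excess of the bare layers over F; \<open>e\<close>
    measures what \<phi> adds relative to the layered state rather than relative to F.\<close>
  have eq: "indicator (slab (-1) (H i)) x * (W (F + cell_gradient (inverse (H i)) a \<phi> x) - W F)
      = indicator (slab (-1) 0) x * (W (F - A) - W F)
      + indicator (slab 0 (H i)) x * (W (F + inverse (H i) *\<^sub>R A) - W F) + e (inverse (H i)) x" for i x
  proof (cases "x \<in> slab (-1) (H i)")
    case True
    show ?thesis
    proof (cases "x \<bullet> n < 0")
      case neg: True
      then have "x \<in> slab (-1) 0" "x \<notin> slab 0 (H i)" using True by (auto simp: slab_def)
      then show ?thesis using True neg
        by (simp add: e_def interface_excess_def cell_gradient_def A_def algebra_simps)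
    next
      case pos: False
      then have "x \<notin> slab (-1) 0" "x \<in> slab 0 (H i)" using True by (auto simp: slab_def)
      then show ?thesis using True pos
        by (simp add: e_def interface_excess_def cell_gradient_def A_def algebra_simps)
    qed
  next
    case False
    have "x \<notin> ball 0 1"
    proof
      assume "x \<in> ball 0 1"
      then have *: "\<bar>x \<bullet> b\<bar> < 1" if "b \<in> S" for b
        using abs_inner_le[OF that, of x] by simp
      have "-1 \<le> x \<bullet> b \<and> x \<bullet> b < 1" if "b \<in> S" for b
        using *[OF that] by (auto simp: abs_less_iff)
      moreover have "1 \<le> H i" by (simp add: H_def)
      ultimately have "x \<in> slab (-1) (H i)" using n unfolding slab_def by force
      with False show False by blast
    qed
    then have "jacobian \<phi> (at x) = 0" by (rule test_function_jacobian(4)[OF \<phi>])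
    moreover have "x \<notin> slab (-1) 0" "x \<notin> slab 0 (H i)" using False by (auto simp: slab_def H_def)
    ultimately show ?thesis using False by (simp add: e_def interface_excess_def)
  qed
  have slab_int: "integrable lebesgue (\<lambda>x. indicator (slab \<alpha> \<beta>) x * c :: real)" for \<alpha> \<beta> c
    using slab_lmeasurable[of \<alpha> \<beta>] by (intro integrable_mult_left integrable_real_indicator) (auto simp: fmeasurable_def)
  have slab_val: "(\<integral>x. indicator (slab \<alpha> \<beta>) x * c \<partial>lebesgue) = measure lebesgue (slab \<alpha> \<beta>) * c" for \<alpha> \<beta> and c :: real
    using slab_lmeasurable[of \<alpha> \<beta>] by (simp add: fmeasurableD)
  have e_int: "integrable lebesgue (e s)" for s
    unfolding e_def by (rule interface_excess_integrable[OF W(1) \<phi>])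
  have nonneg: "0 \<le> \<kappa> * (W (F - A) - W F) + \<kappa> * (H i * (W (F + inverse (H i) *\<^sub>R A) - W F))
      + (\<integral>x. e (inverse (H i)) x \<partial>lebesgue)" for i
  proof -
    have H_inv: "1 / inverse (H i) = H i" by (simp only: inverse_eq_divide[symmetric] inverse_inverse_eq)
    have "0 < inverse (H i)" "inverse (H i) \<le> 1" by (auto simp: H_def field_simps)
    from cell_energy_nonneg[OF W Q \<phi> this, of a]
    have "0 \<le> (\<integral>x. indicator (slab (-1) (H i)) x * (W (F + cell_gradient (inverse (H i)) a \<phi> x) - W F) \<partial>lebesgue)"
      by (simp only: H_inv)
    also have "\<dots> = (\<integral>x. indicator (slab (-1) 0) x * (W (F - A) - W F)
        + indicator (slab 0 (H i)) x * (W (F + inverse (H i) *\<^sub>R A) - W F) + e (inverse (H i)) x \<partial>lebesgue)"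
      unfolding eq ..
    also have "\<dots> = (\<integral>x. indicator (slab (-1) 0) x * (W (F - A) - W F) \<partial>lebesgue)
        + (\<integral>x. indicator (slab 0 (H i)) x * (W (F + inverse (H i) *\<^sub>R A) - W F) \<partial>lebesgue)
        + (\<integral>x. e (inverse (H i)) x \<partial>lebesgue)"
      by (simp only: Bochner_Integration.integral_add Bochner_Integration.integrable_add slab_int e_int)
    also have "(\<integral>x. indicator (slab 0 (H i)) x * (W (F + inverse (H i) *\<^sub>R A) - W F) \<partial>lebesgue)
        = \<kappa> * (H i * (W (F + inverse (H i) *\<^sub>R A) - W F))"
      unfolding slab_val unfolding H_def measure_slab \<kappa>_def by (simp add: mult_ac)
    finally show ?thesis unfolding slab_val \<kappa>_def .
  qed
  have H_lim: "(\<lambda>i. inverse (H i)) \<longlonglongrightarrow> 0" unfolding H_def by (rule LIMSEQ_inverse_real_of_nat)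
  have lim1: "(\<lambda>i. H i * (W (F + inverse (H i) *\<^sub>R A) - W F)) \<longlonglongrightarrow> P \<bullet> A"
  proof -
    have "((\<lambda>t. W (F + t *\<^sub>R A)) has_derivative (\<lambda>t. (t *\<^sub>R A) \<bullet> P)) (at 0)"
      by (rule has_derivative_line[OF P[unfolded gderiv_def]])
    then have "((\<lambda>t. W (F + t *\<^sub>R A)) has_real_derivative P \<bullet> A) (at 0)"
      by (simp add: has_field_derivative_def inner_commute mult.commute mult_commute_abs)
    then have "((\<lambda>t. (W (F + t *\<^sub>R A) - W F) / t) \<longlongrightarrow> P \<bullet> A) (at 0)"
      by (simp add: DERIV_def)
    moreover have "filterlim (\<lambda>i. inverse (H i)) (at 0) sequentially"
      unfolding filterlim_at using H_lim by (auto simp: H_def)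
    ultimately have "(\<lambda>i. (W (F + inverse (H i) *\<^sub>R A) - W F) / inverse (H i)) \<longlonglongrightarrow> P \<bullet> A"
      by (rule filterlim_compose)
    then show ?thesis by (simp add: field_simps)
  qed
  have lim2: "(\<lambda>i. \<integral>x. e (inverse (H i)) x \<partial>lebesgue) \<longlonglongrightarrow> (\<integral>x. e 0 x \<partial>lebesgue)"
  proof -
    \<comment> \<open>The radius \<open>norm F + norm A\<close> covers F + A/H for every H \<ge> 1
      as well as F - A, so one integrable bound dominates the whole sequence.\<close>
    obtain K where K: "\<And>Fp Fm z. norm Fp \<le> norm F + norm A \<Longrightarrow> norm Fm \<le> norm F + norm A \<Longrightarrow>
        \<bar>interface_excess W Fp Fm n \<phi> z\<bar> \<le> K * indicator (ball 0 1) z"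
      using interface_excess_bound[OF W(1) \<phi>, of "norm F + norm A" n] by blast
    show ?thesis
    proof (rule integral_dominated_convergence[OF _ _ indicator_ball_integral(1)[of K 0 1]])
      show "AE x in lebesgue. (\<lambda>i. e (inverse (H i)) x) \<longlonglongrightarrow> e 0 x"
      proof (rule AE_I2)
        fix x
        have c: "(\<lambda>i. W (F + inverse (H i) *\<^sub>R A + X)) \<longlonglongrightarrow> W (F + 0 *\<^sub>R A + X)" for X
        proof -
          have "isCont W (F + 0 *\<^sub>R A + X)"
            using W(1) by (simp add: continuous_on_eq_continuous_at)
          moreover have "(\<lambda>i. F + inverse (H i) *\<^sub>R A + X) \<longlonglongrightarrow> F + 0 *\<^sub>R A + X"
            by (intro tendsto_intros H_lim)
          ultimately show ?thesis by (rule isCont_tendsto_compose)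
        qed
        show "(\<lambda>i. e (inverse (H i)) x) \<longlonglongrightarrow> e 0 x"
          unfolding e_def interface_excess_def using tendsto_diff[OF c c[of 0]] by simp
      qed
      show "AE x in lebesgue. norm (e (inverse (H i)) x) \<le> K * indicator (ball 0 1) x" for i
      proof (rule AE_I2)
        fix x
        have "inverse (H i) * norm A \<le> 1 * norm A" by (intro mult_right_mono) (auto simp: H_def field_simps)
        then have "norm (F + inverse (H i) *\<^sub>R A) \<le> norm F + norm A"
          using norm_triangle_ineq[of F "inverse (H i) *\<^sub>R A"] by (simp add: H_def)
        then show "norm (e (inverse (H i)) x) \<le> K * indicator (ball 0 1) x"
          unfolding e_def real_norm_def by (rule K) (rule norm_triangle_ineq4)
      qed
    qed (use e_int in \<open>auto intro: borel_measurable_integrable\<close>)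
  qed
  have "(\<lambda>i. \<kappa> * (W (F - A) - W F) + \<kappa> * (H i * (W (F + inverse (H i) *\<^sub>R A) - W F))
      + (\<integral>x. e (inverse (H i)) x \<partial>lebesgue)) \<longlonglongrightarrow> \<kappa> * (W (F - A) - W F) + \<kappa> * (P \<bullet> A) + (\<integral>x. e 0 x \<partial>lebesgue)"
    by (intro tendsto_intros lim1 lim2)
  then have "0 \<le> \<kappa> * (W (F - A) - W F) + \<kappa> * (P \<bullet> A) + (\<integral>x. e 0 x \<partial>lebesgue)"
    by (rule LIMSEQ_le_const) (use nonneg in blast)
  then show ?thesis
    by (simp add: \<kappa>_def A_def e_def algebra_simps)
qed

text \<open>Completing n to an orthonormal basis removes the frame from the statement; what remains
  of it is \<kappa>, chosen before F, a and \<phi>.\<close>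

lemma layer_inequality:
  fixes W :: "real^'d^'m \<Rightarrow> real" and n :: "real^'d"
  assumes W: "continuous_on UNIV W" "bdd_below (range W)" and n: "norm n = 1"
  obtains \<kappa> where "\<kappa> > 0" and "\<And>F P a \<phi>. quasiconvex_envelope W F = W F \<Longrightarrow> GDERIV W F :> P \<Longrightarrow>
    \<phi> \<in> test_functions (ball 0 1) \<Longrightarrow> 0 \<le> \<kappa> * (W (F - a \<otimes> n) - W F + P \<bullet> (a \<otimes> n))
      + (\<integral>z. interface_excess W F (F - a \<otimes> n) n \<phi> z \<partial>lebesgue)"
proof -
  obtain S where S: "n \<in> S" "pairwise orthogonal S" "\<And>x. x \<in> S \<Longrightarrow> norm x = 1"
    "independent S" "span S = UNIV"
    using vector_in_orthonormal_basis[OF n] by metis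
  interpret orthonormal_frame n S
    using S independent_imp_finite by unfold_locales auto
  show thesis
    by (rule that[OF measure_slab_pos layer_inequality_frame[OF W]])
qed

lemma zero_test_function: "(\<lambda>_. 0) \<in> test_functions U"
  by (rule test_functionsI[of _ "{}"]) (auto simp: Ck_on_const)

lemma Weierstrass_condition:
  fixes W :: "real^'d^'m \<Rightarrow> real" and n :: "real^'d"
  assumes W: "continuous_on UNIV W" "bdd_below (range W)" and n: "norm n = 1"
    and Q: "quasiconvex_envelope W F = W F" and P: "GDERIV W F :> P"
  shows "0 \<le> W (F - a \<otimes> n) - W F + P \<bullet> (a \<otimes> n)"
proof -
  obtain \<kappa> where \<kappa>: "\<kappa> > 0" "0 \<le> \<kappa> * (W (F - a \<otimes> n) - W F + P \<bullet> (a \<otimes> n))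
      + (\<integral>z. interface_excess W F (F - a \<otimes> n) n (\<lambda>_. 0) z \<partial>lebesgue)"
    using layer_inequality[OF W n] Q P zero_test_function[of "ball 0 1"] by metis
  have "jacobian (\<lambda>_. 0 :: real^'m) (at (z::real^'d)) = 0" for z
    by (rule jacobian_eqI) simp
  then have "interface_excess W F (F - a \<otimes> n) n (\<lambda>_. 0) = (\<lambda>_. 0)"
    by (auto simp: interface_excess_def)
  with \<kappa> show ?thesis by (simp add: zero_le_mult_iff)
qed

lemma interface_stability_sufficient:
  fixes W :: "real^'d^'m \<Rightarrow> real" and n :: "real^'d"
  assumes W: "continuous_on UNIV W" "bdd_below (range W)" and n: "norm n = 1"
    and a: "Fp - Fm = a \<otimes> n" and P: "GDERIV W Fp :> Pp" "GDERIV W Fm :> Pm"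
    and Q: "quasiconvex_envelope W Fp = W Fp" "quasiconvex_envelope W Fm = W Fm"
    and N: "(Pp - Pm) \<bullet> (Fp - Fm) \<le> 0"
  shows "strongly_locally_stable W Fp Fm n"
proof -
  \<comment> \<open>Seen from the phase F_- the jump is -a with the same normal, so the Weierstrass
    inequality applies to both phases without turning n around.\<close>
  have neg: "(- a) \<otimes> n = - (a \<otimes> n)" by (simp add: outer_def vec_eq_iff)
  have Fm: "Fm = Fp - a \<otimes> n" "Fm - (- a) \<otimes> n = Fp" using a neg by (auto simp: algebra_simps)
  have Fp: "Fm + a \<otimes> n = Fp" using a by (simp add: algebra_simps)
  have "0 \<le> W Fm - W Fp + Pp \<bullet> (a \<otimes> n)"
    using Weierstrass_condition[OF W n Q(1) P(1), of a] Fm(1) by simp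
  moreover have "0 \<le> W Fp - W Fm - Pm \<bullet> (a \<otimes> n)"
    using Weierstrass_condition[OF W n Q(2) P(2), of "- a"] unfolding neg by (simp add: Fp)
  moreover have "Pp \<bullet> (a \<otimes> n) - Pm \<bullet> (a \<otimes> n) \<le> 0" using N a by (simp add: inner_diff_left)
  ultimately have "W Fm - W Fp + Pp \<bullet> (a \<otimes> n) = 0" by linarith
  then have zero: "W (Fp - a \<otimes> n) - W Fp + Pp \<bullet> (a \<otimes> n) = 0" using Fm(1) by simp
  show ?thesis
    unfolding strongly_locally_stable_iff[OF W(1) n]
  proof
    fix \<phi> :: "real^'d \<Rightarrow> real^'m" assume \<phi>: "\<phi> \<in> test_functions (ball 0 1)"
    obtain \<kappa> where "0 \<le> \<kappa> * (W (Fp - a \<otimes> n) - W Fp + Pp \<bullet> (a \<otimes> n))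
      + (\<integral>z. interface_excess W Fp (Fp - a \<otimes> n) n \<phi> z \<partial>lebesgue)"
      using layer_inequality[OF W n] Q(1) P(1) \<phi> by metis
    then show "0 \<le> (\<integral>z. interface_excess W Fp Fm n \<phi> z \<partial>lebesgue)"
      using zero Fm(1) by simp
  qed
qed

section \<open>Interchange stability from the first variation\<close>

text \<open>For fixed P and a the pairing is linear in g and represented by the vector P^T a. Test
  functions with values along a thus reduce the first variation to gradients of scalar
  functions.\<close>

lemma inner_outer: "P \<bullet> (a \<otimes> g) = (transpose P *v a) \<bullet> g" for P :: "real^'d^'m"
proof -
  have "P \<bullet> (a \<otimes> g) = (\<Sum>i\<in>UNIV. \<Sum>j\<in>UNIV. P $ i $ j * (a $ i * g $ j))"
    by (simp add: inner_vec_def outer_def)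
  also have "\<dots> = (\<Sum>j\<in>UNIV. \<Sum>i\<in>UNIV. P $ i $ j * (a $ i * g $ j))" by (rule sum.swap)
  also have "\<dots> = (transpose P *v a) \<bullet> g"
    by (simp add: inner_vec_def matrix_vector_mult_def transpose_def sum_distrib_left mult_ac)
  finally show ?thesis .
qed

text \<open>The gradient -h z points to the origin because the profile decreases with |z|. The
  function serves twice: for the sign in the interchange inequality and, rescaled, as a
  mollifier.\<close>

lemma radial_test_function:
  obtains \<psi> :: "'a::euclidean_space \<Rightarrow> real" and h
  where "\<psi> \<in> test_functions (ball 0 1)" and "\<And>z. (\<psi> has_derivative (\<lambda>v. - h z * (z \<bullet> v))) (at z)"
    and "continuous_on UNIV h" and "\<And>z. 0 \<le> h z" and "\<And>z. 0 < norm z \<Longrightarrow> norm z \<le> 1/2 \<Longrightarrow> 0 < h z"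
    and "\<And>z. z \<notin> ball 0 1 \<Longrightarrow> h z = 0" and "\<And>z. 0 \<le> \<psi> z" and "\<psi> 0 > 0"
proof -
  obtain s s' where s: "\<And>k. Ck_on k UNIV s" "\<And>t. (s has_real_derivative s' t) (at t)" "continuous_on UNIV s'"
    "\<And>t. t \<le> 0 \<Longrightarrow> s t = 0" "\<And>t. t \<ge> 1 \<Longrightarrow> s t = 1" "mono s" "\<And>t. 0 < t \<Longrightarrow> t < 1 \<Longrightarrow> s' t > 0" "\<And>t. s' t \<ge> 0"
    "\<And>t. t \<le> 0 \<or> t \<ge> 1 \<Longrightarrow> s' t = 0"
    using smooth_step by metis
  \<comment> \<open>The argument 1 - 2|z|^2 is nonpositive for |z|^2 \<ge> 1/2, which gives compact
    support in the open ball, and lies strictly between 0 and 1 for 0 < |z| \<le> 1/2, where the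
    step has positive slope.\<close>
  define \<psi> :: "'a \<Rightarrow> real" where "\<psi> z = s (1 + (- 2) * (z \<bullet> z))" for z
  define h :: "'a \<Rightarrow> real" where "h z = 4 * s' (1 + (- 2) * (z \<bullet> z))" for z
  have sq: "z \<bullet> z = (norm z)\<^sup>2" for z :: 'a by (simp add: power2_norm_eq_inner)
  have off: "1 + (- 2) * (z \<bullet> z) \<le> 0" if "z \<notin> {z. z \<bullet> z \<le> 1/2}" for z :: 'a using that by simp
  have sub: "{z. z \<bullet> z \<le> 1/2} \<subseteq> ball (0::'a) 1"
  proof
    fix z :: 'a assume "z \<in> {z. z \<bullet> z \<le> 1/2}"
    then have "(norm z)\<^sup>2 < 1\<^sup>2" by (simp add: sq)
    then show "z \<in> ball 0 1" using power2_less_imp_less[of "norm z" 1] by simp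
  qed
  have "\<psi> \<in> test_functions (ball 0 1)"
  proof (rule test_functionsI)
    show "Ck_on k UNIV \<psi>" for k
      unfolding \<psi>_def 
      by (rule Ck_on_real_compose[OF s(1)
            Ck_on_add[OF Ck_on_const Ck_on_mult[OF Ck_on_const Ck_on_norm_square]]])
    show "compact {z::'a. z \<bullet> z \<le> 1/2}"
      unfolding compact_eq_bounded_closed using bounded_subset[OF bounded_ball sub]
      by (auto intro!: closed_Collect_le continuous_intros)
    show "{z. z \<bullet> z \<le> 1/2} \<subseteq> ball (0::'a) 1" by (rule sub)
    show "\<psi> z = 0" if "z \<notin> {z. z \<bullet> z \<le> 1/2}" for z
      unfolding \<psi>_def by (intro s(4) off that)
  qed
  moreover have "(\<psi> has_derivative (\<lambda>v. - h z * (z \<bullet> v))) (at z)" for z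
  proof -
    have "((\<lambda>z. 1 + (- 2) * (z \<bullet> z)) has_derivative (\<lambda>v. (- 4) * (z \<bullet> v))) (at z)" for z :: 'a
      by (auto intro!: derivative_eq_intros simp: inner_commute)
    from has_derivative_compose[OF this s(2)[unfolded has_field_derivative_def]]
    show ?thesis unfolding \<psi>_def h_def by (simp add: mult_ac)
  qed
  moreover have "continuous_on UNIV h"
    unfolding h_def by (intro continuous_intros continuous_on_compose2[OF s(3)]) auto
  moreover have "0 < h z" if "0 < norm z" "norm z \<le> 1/2" for z
  proof -
    have "(norm z)\<^sup>2 \<le> (1/2)\<^sup>2" using that by (intro power_mono) auto
    then have "(norm z)\<^sup>2 \<le> 1/4" by (simp add: power2_eq_square)
    moreover have "0 < (norm z)\<^sup>2" using that by simp
    ultimately show ?thesis unfolding h_def sq using s(7)[of "1 + - 2 * (norm z)\<^sup>2"] by simp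
  qed
  moreover have "h z = 0" if "z \<notin> ball 0 1" for z
  proof -
    have "1 + (- 2) * (z \<bullet> z) \<le> 0" using sub that by (intro off) blast
    then show ?thesis unfolding h_def using s(9) by simp
  qed
  moreover have "0 \<le> \<psi> z" for z
  proof -
    have "s (min 0 (1 + (- 2) * (z \<bullet> z))) \<le> \<psi> z" unfolding \<psi>_def by (rule monoD[OF s(6)]) simp
    then show ?thesis by (simp add: s(4))
  qed
  moreover have "\<psi> 0 > 0" by (simp add: \<psi>_def s(5))
  ultimately show thesis using that[of \<psi> h] s(8) by (simp add: h_def)
qed

text \<open>The integral of the gradient over the half-space is -c n: tangential components
  integrate to zero because the half-space is invariant under tangential shifts, and the normal
  component has a sign because the function decreases radially. By the divergence theorem c is the
  integral of \<psi> over the hyperplane, but only c > 0 is used.\<close>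

lemma half_space_gradient:
  fixes n :: "real^'d"
  assumes n: "norm n = 1"
  obtains \<psi> :: "real^'d \<Rightarrow> real" and g c where "\<psi> \<in> test_functions (ball 0 1)"
    and "\<And>z. (\<psi> has_derivative (\<lambda>v. v \<bullet> g z)) (at z)" and "c > 0"
    and "\<And>q. integrable lebesgue (\<lambda>z. q \<bullet> g z)"
    and "\<And>q. (\<integral>z. q \<bullet> g z \<partial>lebesgue) = 0"
    and "\<And>q. (\<integral>z. (if z \<bullet> n < 0 then 0 else q \<bullet> g z) \<partial>lebesgue) = - c * (q \<bullet> n)"
proof -
  obtain \<psi> :: "real^'d \<Rightarrow> real" and h where \<psi>: "\<psi> \<in> test_functions (ball 0 1)"
    and d: "\<And>z. (\<psi> has_derivative (\<lambda>v. - h z * (z \<bullet> v))) (at z)"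
    and hc: "continuous_on UNIV h" and h0: "\<And>z. 0 \<le> h z"
    and hpos: "\<And>z. 0 < norm z \<Longrightarrow> norm z \<le> 1/2 \<Longrightarrow> 0 < h z"
    and hoff: "\<And>z. z \<notin> ball 0 1 \<Longrightarrow> h z = 0"
    using radial_test_function[where 'a = "real^'d"] by metis
  define g where "g z = - h z *\<^sub>R z" for z
  have dg: "(\<psi> has_derivative (\<lambda>v. v \<bullet> g z)) (at z)" for z
    using d[of z] by (simp add: g_def inner_commute)
  have nn: "n \<bullet> n = 1" using n by (simp add: norm_eq_1)
  obtain L where L: "L \<ge> 0" "\<And>x y. norm (\<psi> x - \<psi> y) \<le> L * norm (x - y)"
    using test_function_lipschitz[OF \<psi>] by metis
  have \<psi>c: "continuous_on UNIV \<psi>" using test_functionD(1)[OF \<psi>, of 0] by simp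
  obtain M where M: "\<And>z. norm (\<psi> z) \<le> M" using test_function_bounded[OF \<psi>] by metis
  have \<psi>off: "\<psi> z = 0" if "norm z > 1" for z
  proof -
    have "z \<notin> closure {z. \<psi> z \<noteq> 0}" using test_functionD(3)[OF \<psi>] that by auto
    then show ?thesis using closure_subset[of "{z. \<psi> z \<noteq> 0}"] by blast
  qed
  have line: "((\<lambda>t. \<psi> (z + t *\<^sub>R e)) has_real_derivative e \<bullet> g z) (at 0)" for z e
  proof -
    have "((\<lambda>t. \<psi> (z + t *\<^sub>R e)) has_derivative (\<lambda>t. (t *\<^sub>R e) \<bullet> g z)) (at 0)"
      by (rule has_derivative_line[OF dg])
    then show ?thesis by (simp add: has_field_derivative_def mult.commute mult_commute_abs)
  qed
  \<comment> \<open>Cutting \<psi> off by a set invariant along e does not disturb differentiation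
    along e. The sets in question are the whole space and the half-space.\<close>
  have part: "integrable lebesgue (\<lambda>z. if P z then e \<bullet> g z else 0)
      \<and> (\<integral>z. (if P z then e \<bullet> g z else 0) \<partial>lebesgue) = 0"
    if P: "{z. P z} \<in> sets borel" "\<And>z t. P (z + t *\<^sub>R e) = P z" for P e
  proof -
    let ?f = "\<lambda>z. if P z then \<psi> z else 0"
    have fm: "?f \<in> borel_measurable lebesgue"
    proof -
      have "?f = (\<lambda>z. indicator {z. P z} z * \<psi> z)" by (auto simp: indicator_def)
      moreover have "(\<lambda>z. indicator {z. P z} z * \<psi> z) \<in> borel_measurable borel"
        using P(1) borel_measurable_continuous_onI[OF \<psi>c]
        by (intro borel_measurable_times borel_measurable_indicator) auto
      ultimately show ?thesis by (simp add: measurable_completion)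
    qed
    have fi: "integrable lebesgue ?f"
    proof (rule integrable_bounded_support[OF fm lmeasurable_cball[of 0 1]])
      have "norm (?f z) \<le> \<bar>M\<bar>" for z
        using M[of z] by (cases "P z") (auto simp: abs_le_iff)
      then show "AE z in lebesgue. norm (?f z) \<le> \<bar>M\<bar>" by simp
      show "AE z in lebesgue. z \<notin> cball 0 1 \<longrightarrow> ?f z = 0"
        by (rule AE_I2) (simp add: \<psi>off)
    qed
    have fL: "\<bar>?f (z + t *\<^sub>R e) - ?f z\<bar> \<le> (L * norm e) * t" if "0 < t" "t \<le> 1" for z t
      using L(2)[of "z + t *\<^sub>R e" z] L(1) that by (auto simp: P(2) mult_ac)
    have fd: "AE z in lebesgue. ((\<lambda>t. ?f (z + t *\<^sub>R e)) has_real_derivative (if P z then e \<bullet> g z else 0)) (at 0)"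
      using line by (auto simp: P(2))
    show ?thesis
      using integral_directional_derivative_eq_0[OF fi _ fL fd, of 1] \<psi>off by auto
  qed
  have all: "integrable lebesgue (\<lambda>z. q \<bullet> g z)" "(\<integral>z. q \<bullet> g z \<partial>lebesgue) = 0" for q
    using part[of "\<lambda>_. True" q] by simp_all
  have half: "{z::real^'d. \<not> z \<bullet> n < 0} \<in> sets borel"
  proof -
    have "{z::real^'d. \<not> z \<bullet> n < 0} = {z. 0 \<le> z \<bullet> n}" by auto
    then show ?thesis by (auto intro!: borel_closed closed_Collect_le continuous_intros)
  qed
  have half_int: "integrable lebesgue (\<lambda>z. if z \<bullet> n < 0 then 0 else q \<bullet> g z)" for q
  proof -
    have "{z::real^'d. \<not> z \<bullet> n < 0} \<in> sets lebesgue" using half by simp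
    from integrable_mult_indicator[OF this all(1)[of q]]
    have "integrable lebesgue (\<lambda>z. indicator {z. \<not> z \<bullet> n < 0} z *\<^sub>R (q \<bullet> g z))" .
    also have "(\<lambda>z. indicator {z. \<not> z \<bullet> n < 0} z *\<^sub>R (q \<bullet> g z)) = (\<lambda>z. if z \<bullet> n < 0 then 0 else q \<bullet> g z)"
      by (auto simp: indicator_def)
    finally show ?thesis .
  qed
  define c where "c = - (\<integral>z. (if z \<bullet> n < 0 then 0 else n \<bullet> g z) \<partial>lebesgue)"
  have "(\<integral>z. (if z \<bullet> n < 0 then 0 else q \<bullet> g z) \<partial>lebesgue) = - c * (q \<bullet> n)" for q
  proof -
    \<comment> \<open>The tangential part of q, along which the half-space is invariant.\<close>
    define e where "e = q - (q \<bullet> n) *\<^sub>R n"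
    have en: "e \<bullet> n = 0" by (simp add: e_def inner_diff_left nn)
    have "(\<integral>z. (if z \<bullet> n < 0 then 0 else e \<bullet> g z) \<partial>lebesgue) = 0"
    proof -
      have "(if \<not> b then x else y) = (if b then y else x)" for b and x y :: real by simp
      then show ?thesis
        using part[of "\<lambda>z. \<not> z \<bullet> n < 0" e] half en by (simp add: inner_add_left)
    qed
    moreover have "(if z \<bullet> n < 0 then 0 else q \<bullet> g z)
        = (q \<bullet> n) * (if z \<bullet> n < 0 then 0 else n \<bullet> g z) + (if z \<bullet> n < 0 then 0 else e \<bullet> g z)" for z
      by (simp add: e_def inner_diff_left)
    then have "(\<integral>z. (if z \<bullet> n < 0 then 0 else q \<bullet> g z) \<partial>lebesgue)
        = (q \<bullet> n) * (\<integral>z. (if z \<bullet> n < 0 then 0 else n \<bullet> g z) \<partial>lebesgue)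
          + (\<integral>z. (if z \<bullet> n < 0 then 0 else e \<bullet> g z) \<partial>lebesgue)"
      by (simp only: Bochner_Integration.integral_add integrable_mult_right half_int integral_mult_right_zero)
    ultimately show ?thesis by (simp add: c_def)
  qed
  moreover have "c > 0"
  proof (rule ccontr)
    let ?k = "\<lambda>z. - (if z \<bullet> n < 0 then 0 else n \<bullet> g z)"
    assume "\<not> c > 0"
    have k0: "0 \<le> ?k z" for z
      using h0[of z] by (auto simp: g_def inner_commute not_less)
    have c_eq: "c = (\<integral>z. ?k z \<partial>lebesgue)" unfolding c_def by simp
    have "0 \<le> (\<integral>z. ?k z \<partial>lebesgue)" by (rule Bochner_Integration.integral_nonneg) (rule k0)
    with \<open>\<not> c > 0\<close> have "(\<integral>z. ?k z \<partial>lebesgue) = 0" unfolding c_eq by linarith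
    moreover have "integrable lebesgue ?k" using half_int by (rule Bochner_Integration.integrable_minus)
    ultimately have AE: "AE z in lebesgue. ?k z = 0"
      using integral_nonneg_eq_0_iff_AE[of lebesgue ?k] k0 by auto
    \<comment> \<open>This ball lies where z \<bullet> n > 0 and 0 < |z| \<le> 1/2, so there the
      integrand is strictly positive and the integral cannot vanish.\<close>
    have "ball ((1/4) *\<^sub>R n) (1/4) \<subseteq> {z. ?k z \<noteq> 0}"
    proof
      fix z assume "z \<in> ball ((1/4) *\<^sub>R n) (1/4)"
      then have *: "norm (z - (1/4) *\<^sub>R n) < 1/4" by (simp add: dist_norm norm_minus_commute)
      have "norm z \<le> norm (z - (1/4) *\<^sub>R n) + norm ((1/4) *\<^sub>R n)" by (metis diff_add_cancel norm_triangle_ineq)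
      then have "norm z \<le> 1/2" using * n by simp
      moreover have "\<bar>(z - (1/4) *\<^sub>R n) \<bullet> n\<bar> \<le> norm (z - (1/4) *\<^sub>R n)"
        using Cauchy_Schwarz_ineq2[of "z - (1/4) *\<^sub>R n" n] n by simp
      then have "z \<bullet> n > 0" using * nn by (simp add: inner_diff_left)
      moreover have "z \<noteq> 0" using calculation by auto
      ultimately show "z \<in> {z. ?k z \<noteq> 0}" using hpos[of z] by (simp add: g_def inner_commute)
    qed
    then have "AE z in lebesgue. z \<notin> ball ((1/4) *\<^sub>R n) (1/4)"
      using AE by (auto elim!: eventually_mono)
    then have "negligible (ball ((1/4) *\<^sub>R n) (1/4))"
      by (simp add: negligible_iff_null_sets AE_iff_null_sets)
    then show False using open_not_negligible[of "ball ((1/4) *\<^sub>R n) (1/4)"] by simp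
  qed
  ultimately show thesis using that[OF \<psi> dg] all by blast
qed

section \<open>The first variation\<close>

lemma gderiv_uniform:
  assumes "GDERIV W F :> P" and "\<epsilon> > 0"
  obtains \<delta> where "\<delta> > 0" and "\<And>X. norm X \<le> \<delta> \<Longrightarrow> \<bar>W (F + X) - W F - P \<bullet> X\<bar> \<le> \<epsilon> * norm X"
proof -
  have "(W has_derivative (\<lambda>h. h \<bullet> P)) (at F)" using assms(1) by (simp add: gderiv_def)
  then obtain \<delta> where \<delta>: "\<delta> > 0" "\<And>y. norm (y - F) < \<delta> \<Longrightarrow> norm (W y - W F - (y - F) \<bullet> P) \<le> \<epsilon> * norm (y - F)"
    using assms(2) unfolding has_derivative_at_alt by metis
  show thesis
  proof (rule that[of "\<delta> / 2"])
    show "\<bar>W (F + X) - W F - P \<bullet> X\<bar> \<le> \<epsilon> * norm X" if "norm X \<le> \<delta> / 2" for X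
      using \<delta>(2)[of "F + X"] that \<delta>(1) by (simp add: inner_commute)
  qed (use \<delta>(1) in simp)
qed

lemma test_function_linear_compose:
  assumes \<phi>: "\<phi> \<in> test_functions U" and "bounded_linear L"
  shows "(\<lambda>z. L (\<phi> z)) \<in> test_functions U"
proof (rule test_functionsI[OF _ test_functionD(2,3)[OF \<phi>]])
  show "Ck_on k UNIV (\<lambda>z. L (\<phi> z))" for k
    by (rule Ck_on_linear_compose[OF assms(2) test_functionD(1)[OF \<phi>]])
  show "L (\<phi> z) = 0" if "z \<notin> closure {z. \<phi> z \<noteq> 0}" for z
  proof -
    have "\<phi> z = 0" using that closure_subset[of "{z. \<phi> z \<noteq> 0}"] by blast
    then show ?thesis using linear_0[OF bounded_linear.linear[OF assms(2)]] by simp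
  qed
qed

text \<open>Inserting t \<phi> for small t > 0, the excess is t times the integrand plus o(t),
  uniformly because the gradient of \<phi> is bounded. Test functions may change sign, so this
  contains the vanishing of the first variation; the inequality is all that is used later.\<close>

lemma first_variation_nonneg:
  fixes W :: "real^'d^'m \<Rightarrow> real" and n :: "real^'d" and \<phi> :: "real^'d \<Rightarrow> real^'m"
  assumes W: "continuous_on UNIV W" and n: "norm n = 1"
    and P: "GDERIV W Fp :> Pp" "GDERIV W Fm :> Pm"
    and stable: "strongly_locally_stable W Fp Fm n" and \<phi>: "\<phi> \<in> test_functions (ball 0 1)"
  shows "0 \<le> (\<integral>z. (if z \<bullet> n < 0 then Pm else Pp) \<bullet> jacobian \<phi> (at z) \<partial>lebesgue)"
proof -
  let ?l = "\<lambda>z. (if z \<bullet> n < 0 then Pm else Pp) \<bullet> jacobian \<phi> (at z)"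
  obtain B where B: "B \<ge> 0" "\<And>z. norm (jacobian \<phi> (at z)) \<le> B"
    using test_function_jacobian_bounded[OF \<phi>] by blast
  have lb: "\<bar>?l z\<bar> \<le> (norm Pm + norm Pp) * B * indicator (ball 0 1) z" for z
  proof (cases "z \<in> ball 0 1")
    case True
    have "\<bar>?l z\<bar> \<le> norm (if z \<bullet> n < 0 then Pm else Pp) * norm (jacobian \<phi> (at z))"
      by (rule Cauchy_Schwarz_ineq2)
    also have "\<dots> \<le> (norm Pm + norm Pp) * B" by (intro mult_mono B) auto
    finally show ?thesis using True by simp
  qed (use test_function_jacobian(4)[OF \<phi>, of z] in simp)
  have lm: "?l \<in> borel_measurable lebesgue"
  proof -
    have "?l \<in> borel_measurable borel"
      using test_function_jacobian(5)[OF \<phi>] by measurable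
    then show ?thesis by (simp add: measurable_completion)
  qed
  have li: "integrable lebesgue ?l"
  proof (rule Bochner_Integration.integrable_bound[OF indicator_ball_integral(1) lm])
    show "AE z in lebesgue. norm (?l z) \<le> norm ((norm Pm + norm Pp) * B * indicator (ball 0 1) z :: real)"
      unfolding real_norm_def by (rule AE_I2, rule order_trans[OF lb abs_ge_self])
  qed
  have "- (\<integral>z. ?l z \<partial>lebesgue) \<le> \<epsilon> * (B * measure lebesgue (ball (0::real^'d) 1))" if \<epsilon>: "\<epsilon> > 0" for \<epsilon>
  proof -
    obtain \<delta>1 where \<delta>1: "\<delta>1 > 0" "\<And>X. norm X \<le> \<delta>1 \<Longrightarrow> \<bar>W (Fp + X) - W Fp - Pp \<bullet> X\<bar> \<le> \<epsilon> * norm X"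
      using gderiv_uniform[OF P(1) \<epsilon>] by metis
    obtain \<delta>2 where \<delta>2: "\<delta>2 > 0" "\<And>X. norm X \<le> \<delta>2 \<Longrightarrow> \<bar>W (Fm + X) - W Fm - Pm \<bullet> X\<bar> \<le> \<epsilon> * norm X"
      using gderiv_uniform[OF P(2) \<epsilon>] by metis
    \<comment> \<open>Small enough for t times the gradient of \<phi> to stay within both radii of
      linearisation; the summand 1 allows B = 0. One such t for each \<epsilon> suffices, since the
      inequality can be divided by t.\<close>
    define t where "t = min \<delta>1 \<delta>2 / (B + 1)"
    have t: "t > 0" using \<delta>1(1) \<delta>2(1) B(1) by (simp add: t_def)
    have "t * (B + 1) = min \<delta>1 \<delta>2" using B(1) by (simp add: t_def)
    then have tB: "t * B \<le> \<delta>1" "t * B \<le> \<delta>2" using t by (simp_all add: algebra_simps)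
    let ?\<phi> = "\<lambda>z. t *\<^sub>R \<phi> z"
    have \<phi>t: "?\<phi> \<in> test_functions (ball 0 1)" by (rule test_function_linear_compose[OF \<phi> bounded_linear_scaleR_right])
    have jac: "jacobian ?\<phi> (at z) = t *\<^sub>R jacobian \<phi> (at z)" for z
      by (rule jacobian_eqI)
        (use has_derivative_scaleR_right[OF test_function_jacobian(1)[OF \<phi>], of t z] in
          \<open>simp add: scaleR_matrix_vector_assoc\<close>)
    have bound: "interface_excess W Fp Fm n ?\<phi> z \<le> t * ?l z + \<epsilon> * (t * B) * indicator (ball 0 1) z" for z
    proof (cases "z \<in> ball 0 1")
      case True
      let ?X = "t *\<^sub>R jacobian \<phi> (at z)"
      have X: "norm ?X \<le> t * B" using B(2)[of z] t by simp
      then have "\<epsilon> * norm ?X \<le> \<epsilon> * (t * B)" using \<epsilon> by simp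
      moreover have "\<bar>W (Fp + ?X) - W Fp - Pp \<bullet> ?X\<bar> \<le> \<epsilon> * norm ?X" "\<bar>W (Fm + ?X) - W Fm - Pm \<bullet> ?X\<bar> \<le> \<epsilon> * norm ?X"
        using \<delta>1(2)[of ?X] \<delta>2(2)[of ?X] X tB by linarith+
      ultimately have "W (Fp + ?X) - W Fp \<le> t * (Pp \<bullet> jacobian \<phi> (at z)) + \<epsilon> * (t * B)"
        "W (Fm + ?X) - W Fm \<le> t * (Pm \<bullet> jacobian \<phi> (at z)) + \<epsilon> * (t * B)"
        by (simp_all only: inner_scaleR_right abs_le_iff) linarith+
      then show ?thesis using True by (simp add: interface_excess_def jac)
    next
      case False
      then show ?thesis
        using test_function_jacobian(4)[OF \<phi>, of z] by (simp add: interface_excess_def jac)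
    qed
    have "0 \<le> (\<integral>z. interface_excess W Fp Fm n ?\<phi> z \<partial>lebesgue)"
      using stable \<phi>t strongly_locally_stable_iff[OF W n] by blast
    also have "\<dots> \<le> (\<integral>z. t * ?l z + \<epsilon> * (t * B) * indicator (ball 0 1) z \<partial>lebesgue)"
      by (intro integral_mono interface_excess_integrable[OF W \<phi>t] bound Bochner_Integration.integrable_add
          integrable_mult_right li indicator_ball_integral(1))
    also have "\<dots> = t * (\<integral>z. ?l z \<partial>lebesgue) + \<epsilon> * (t * B) * measure lebesgue (ball (0::real^'d) 1)"
    proof -
      have b: "(\<integral>z. \<epsilon> * (t * B) * indicator (ball (0::real^'d) 1) z \<partial>lebesgue)
          = \<epsilon> * (t * B) * measure lebesgue (ball (0::real^'d) 1)"
        by simp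
      show ?thesis
        unfolding Bochner_Integration.integral_add[OF integrable_mult_right[OF li] indicator_ball_integral(1)] b
        by simp
    qed
    finally have "0 \<le> t * ((\<integral>z. ?l z \<partial>lebesgue) + \<epsilon> * (B * measure lebesgue (ball (0::real^'d) 1)))"
      by (simp add: algebra_simps)
    then show ?thesis using t by (simp add: zero_le_mult_iff)
  qed
  then have "- (\<integral>z. ?l z \<partial>lebesgue) \<le> 0"
  proof -
    let ?V = "B * measure lebesgue (ball (0::real^'d) 1)"
    assume *: "\<And>\<epsilon>. \<epsilon> > 0 \<Longrightarrow> - (\<integral>z. ?l z \<partial>lebesgue) \<le> \<epsilon> * ?V"
    have V: "?V \<ge> 0" using B(1) by simp
    show ?thesis
    proof (rule field_le_epsilon)
      fix e :: real assume "e > 0"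
      then have "- (\<integral>z. ?l z \<partial>lebesgue) \<le> e / (?V + 1) * ?V" using V by (intro *) simp
      also have "\<dots> \<le> e" using V \<open>e > 0\<close> by (simp add: field_simps)
      finally show "- (\<integral>z. ?l z \<partial>lebesgue) \<le> 0 + e" by simp
    qed
  qed
  then show ?thesis by simp
qed

text \<open>With \<phi> = \<psi> a the first variation is the whole-space integral of r \<bullet> g,
  which is zero, plus the half-space integral of q \<bullet> g, which is -c (q \<bullet> n).
  Moreover q \<bullet> n is the pairing of Pp - Pm with a \<otimes> n.\<close>

lemma interchange_stability_necessary:
  fixes W :: "real^'d^'m \<Rightarrow> real" and n :: "real^'d"
  assumes W: "continuous_on UNIV W" and n: "norm n = 1" and a: "Fp - Fm = a \<otimes> n"
    and P: "GDERIV W Fp :> Pp" "GDERIV W Fm :> Pm"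
    and stable: "strongly_locally_stable W Fp Fm n"
  shows "(Pp - Pm) \<bullet> (Fp - Fm) \<le> 0"
proof -
  obtain \<psi> :: "real^'d \<Rightarrow> real" and g c where \<psi>: "\<psi> \<in> test_functions (ball 0 1)"
    and dg: "\<And>z. (\<psi> has_derivative (\<lambda>v. v \<bullet> g z)) (at z)" and c: "c > 0"
    and int: "\<And>q. integrable lebesgue (\<lambda>z. q \<bullet> g z)" and zero: "\<And>q. (\<integral>z. q \<bullet> g z \<partial>lebesgue) = 0"
    and half: "\<And>q. (\<integral>z. (if z \<bullet> n < 0 then 0 else q \<bullet> g z) \<partial>lebesgue) = - c * (q \<bullet> n)"
    by (rule half_space_gradient[OF n]) (rule that, assumption+)
  define \<phi> where "\<phi> z = \<psi> z *\<^sub>R a" for z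
  have \<phi>: "\<phi> \<in> test_functions (ball 0 1)"
    unfolding \<phi>_def by (rule test_function_linear_compose[OF \<psi> bounded_linear_scaleR_left])
  have jac: "jacobian \<phi> (at z) = a \<otimes> g z" for z
    by (rule jacobian_eqI)
      (use has_derivative_scaleR_left[OF dg[of z], of a] in \<open>simp add: \<phi>_def[abs_def] outer_mult_vec\<close>)
  define q where "q = transpose (Pp - Pm) *v a"
  define r where "r = transpose Pm *v a"
  have "(if z \<bullet> n < 0 then Pm else Pp) \<bullet> jacobian \<phi> (at z) = r \<bullet> g z + (if z \<bullet> n < 0 then 0 else q \<bullet> g z)" for z
    unfolding jac q_def r_def inner_outer[symmetric] by (simp add: inner_diff_left)
  then have "0 \<le> (\<integral>z. r \<bullet> g z + (if z \<bullet> n < 0 then 0 else q \<bullet> g z) \<partial>lebesgue)"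
    using first_variation_nonneg[OF W n P stable \<phi>] by simp
  also have "\<dots> = (\<integral>z. r \<bullet> g z \<partial>lebesgue) + (\<integral>z. (if z \<bullet> n < 0 then 0 else q \<bullet> g z) \<partial>lebesgue)"
  proof (rule Bochner_Integration.integral_add[OF int])
    have "{z::real^'d. 0 \<le> z \<bullet> n} \<in> sets lebesgue"
      by (auto intro!: borel_closed closed_Collect_le continuous_intros)
    from integrable_mult_indicator[OF this int[of q]]
    show "integrable lebesgue (\<lambda>z. if z \<bullet> n < 0 then 0 else q \<bullet> g z)"
      by (rule Bochner_Integration.integrable_cong[THEN iffD1, rotated 2]) (auto simp: indicator_def)
  qed
  finally have "q \<bullet> n \<le> 0" using c by (simp add: zero half mult_le_0_iff zero_le_mult_iff)
  then show ?thesis unfolding a inner_outer q_def .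
qed

section \<open>Mollification\<close>

definition convolve :: "('a::euclidean_space \<Rightarrow> real) \<Rightarrow> ('a \<Rightarrow> 'b::euclidean_space) \<Rightarrow> 'a \<Rightarrow> 'b"
  where "convolve \<psi> v x = (\<integral>z. \<psi> (x - z) *\<^sub>R v z \<partial>lebesgue)"

text \<open>The bound holds at every point, so it can serve as a dominating function directly. For
  the weak gradient, bounded only almost everywhere, a representative with this property is chosen
  later.\<close>

locale bounded_unit_ball_function =
  fixes v :: "'a::euclidean_space \<Rightarrow> 'b::euclidean_space" and C :: real
  assumes measurable_v: "v \<in> borel_measurable lebesgue"
    and bound_v: "\<And>z. norm (v z) \<le> C * indicator (ball 0 1) z"
begin

lemma C_nonneg: "C \<ge> 0"
  using order_trans[OF norm_ge_zero bound_v[of 0]] by simp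

lemma convolve_measurable:
  assumes "continuous_on UNIV \<psi>"
  shows "(\<lambda>z. \<psi> (x - z) *\<^sub>R v z) \<in> borel_measurable lebesgue"
proof -
  have "continuous_on UNIV (\<lambda>z. \<psi> (x - z))"
    by (rule continuous_on_compose2[OF assms]) (auto intro!: continuous_intros)
  then show ?thesis
    by (intro borel_measurable_scaleR measurable_v lebesgue_measurable_continuous)
qed

lemma convolve_bound:
  assumes "continuous_on UNIV \<psi>"
  obtains K where "\<And>x z. x \<in> cball 0 R \<Longrightarrow> norm (\<psi> (x - z) *\<^sub>R v z) \<le> K * indicator (ball 0 1) z"
proof -
  obtain K where K: "\<And>y. y \<in> cball 0 (R + 1) \<Longrightarrow> norm (\<psi> y) \<le> K"
    using continuous_bounded_on_compact[OF compact_cball continuous_on_subset[OF assms subset_UNIV]] by metis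
  have "norm (\<psi> (x - z) *\<^sub>R v z) \<le> (K * C) * indicator (ball 0 1) z" if x: "x \<in> cball 0 R" for x z
  proof (cases "z \<in> ball 0 1")
    case True
    have "norm (x - z) \<le> R + 1" using norm_triangle_ineq4[of x z] x True by simp
    then have "\<bar>\<psi> (x - z)\<bar> \<le> K" using K[of "x - z"] by simp
    moreover have "norm (v z) \<le> C" using bound_v[of z] True by simp
    ultimately show ?thesis using True by (auto intro!: mult_mono)
  next
    case False
    then show ?thesis using bound_v[of z] by simp
  qed
  then show thesis by (rule that)
qed

lemma convolve_integrable:
  assumes "continuous_on UNIV \<psi>"
  shows "integrable lebesgue (\<lambda>z. \<psi> (x - z) *\<^sub>R v z)"
proof -
  obtain K where K: "\<And>y z. y \<in> cball 0 (norm x) \<Longrightarrow> norm (\<psi> (y - z) *\<^sub>R v z) \<le> K * indicator (ball 0 1) z"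
    using convolve_bound[OF assms] by blast
  show ?thesis
    by (rule Bochner_Integration.integrable_bound[OF indicator_ball_integral(1)[of K 0 1] convolve_measurable[OF assms]])
      (rule AE_I2, rule order_trans[OF K], auto)
qed

lemma convolve_continuous:
  assumes "continuous_on UNIV \<psi>"
  shows "continuous_on UNIV (convolve \<psi> v)"
  unfolding continuous_on_eq_continuous_at[OF open_UNIV] continuous_at_sequentially
proof (intro ballI allI impI, unfold comp_def)
  fix x :: 'a and y assume y: "y \<longlonglongrightarrow> x"
  obtain R where R: "\<And>k. norm (y k) \<le> R"
    using convergent_imp_bounded[OF y] unfolding bounded_iff by auto
  obtain K where K: "\<And>x z. x \<in> cball 0 R \<Longrightarrow> norm (\<psi> (x - z) *\<^sub>R v z) \<le> K * indicator (ball 0 1) z"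
    using convolve_bound[OF assms] by blast
  have cont: "isCont \<psi> p" for p using assms by (simp add: continuous_on_eq_continuous_at)
  show "(\<lambda>k. convolve \<psi> v (y k)) \<longlonglongrightarrow> convolve \<psi> v x"
    unfolding convolve_def
  proof (rule integral_dominated_convergence[OF _ _ indicator_ball_integral(1)[of K 0 1]])
    show "AE z in lebesgue. (\<lambda>k. \<psi> (y k - z) *\<^sub>R v z) \<longlonglongrightarrow> \<psi> (x - z) *\<^sub>R v z"
      by (intro AE_I2 tendsto_scaleR tendsto_const isCont_tendsto_compose[OF cont] tendsto_diff y)
    show "AE z in lebesgue. norm (\<psi> (y k - z) *\<^sub>R v z) \<le> K * indicator (ball 0 1) z" for k
      using R[of k] by (intro AE_I2 K) simp
  qed (rule convolve_measurable[OF assms])+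
qed

text \<open>The linearisation error of \<psi> at x - z is estimated uniformly for z in the unit ball
  by uniform continuity of the gradient of \<psi> on a compact set; integrated against the bounded
  function v it remains of smaller order.\<close>

lemma convolve_has_derivative:
  assumes \<psi>: "Ck_on (Suc 0) UNIV \<psi>"
  shows "(convolve \<psi> v has_derivative (\<lambda>h. convolve (\<lambda>p. frechet_derivative \<psi> (at p) h) v x)) (at x)"
  unfolding has_derivative_at_alt
proof (intro conjI allI impI)
  \<comment> \<open>The gradient of \<psi>. Representing the derivative by a vector turns operator
    norms of differences into norms of vectors.\<close>
  define g where "g p = (\<Sum>b\<in>Basis. frechet_derivative \<psi> (at p) b *\<^sub>R b)" for p
  note D = Ck_on_has_derivative[OF \<psi>]
  have lin: "linear (frechet_derivative \<psi> (at p))" for p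
    using D has_derivative_linear by blast
  have Dg: "frechet_derivative \<psi> (at p) h = h \<bullet> g p" for p h
  proof -
    have "frechet_derivative \<psi> (at p) h = frechet_derivative \<psi> (at p) (\<Sum>b\<in>Basis. (h \<bullet> b) *\<^sub>R b)"
      by (simp add: euclidean_representation)
    then show ?thesis
      by (simp add: g_def linear_sum[OF lin] linear_scale[OF lin] inner_sum_right mult.commute)
  qed
  have gc: "continuous_on UNIV g"
    unfolding g_def using \<psi> by (auto intro!: continuous_intros)
  have Dc: "continuous_on UNIV (\<lambda>p. frechet_derivative \<psi> (at p) h)" for h
    using \<psi> by simp
  have \<psi>c: "continuous_on UNIV \<psi>" by (rule Ck_on_continuous[OF \<psi>])
  let ?D = "\<lambda>h. convolve (\<lambda>p. frechet_derivative \<psi> (at p) h) v x"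
  show bl: "bounded_linear ?D"
  proof (rule linear_conv_bounded_linear[THEN iffD1], rule linearI)
    fix h k :: 'a and c :: real
    show "?D (h + k) = ?D h + ?D k"
      unfolding convolve_def linear_add[OF lin] scaleR_add_left
      by (rule Bochner_Integration.integral_add[OF convolve_integrable[OF Dc] convolve_integrable[OF Dc]])
    show "?D (c *\<^sub>R h) = c *\<^sub>R ?D h"
      unfolding convolve_def linear_scale[OF lin]
      by (simp only: real_scaleR_def scaleR_scaleR[symmetric] Bochner_Integration.integral_scaleR_right)
  qed
  fix e :: real assume e: "e > 0"
  define V where "V = measure lebesgue (ball (0::'a) 1)"
  have V: "C * V \<ge> 0" using C_nonneg by (simp add: V_def)
  \<comment> \<open>The pointwise error \<eta> |y - x| is integrated against |v| \<le> C over volume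
    V; the summand 1 guards against C V = 0.\<close>
  define \<eta> where "\<eta> = e / (C * V + 1)"
  have \<eta>: "\<eta> > 0" using e V by (simp add: \<eta>_def)
  \<comment> \<open>The radius covers the segment from x - z to y - z when |z| < 1 and |y - x| <
    1.\<close>
  have "uniformly_continuous_on (cball 0 (norm x + 2)) g"
    by (rule compact_uniformly_continuous) (use gc continuous_on_subset in auto)
  then obtain \<delta> where \<delta>: "\<delta> > 0" "\<And>p q. p \<in> cball 0 (norm x + 2) \<Longrightarrow> q \<in> cball 0 (norm x + 2) \<Longrightarrow>
      dist q p < \<delta> \<Longrightarrow> dist (g q) (g p) < \<eta>"
    using \<eta> unfolding uniformly_continuous_on_def by metis
  show "\<exists>d>0. \<forall>y. norm (y - x) < d \<longrightarrow> norm (convolve \<psi> v y - convolve \<psi> v x - ?D (y - x)) \<le> e * norm (y - x)"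
  proof (intro exI[of _ "min \<delta> 1"] conjI allI impI)
    fix y assume y: "norm (y - x) < min \<delta> 1"
    let ?r = "\<lambda>z. \<psi> (y - z) - \<psi> (x - z) - frechet_derivative \<psi> (at (x - z)) (y - x)"
    have r: "\<bar>?r z\<bar> \<le> norm (y - x) * \<eta>" if z: "z \<in> ball 0 1" for z
    proof -
      let ?S = "closed_segment (x - z) (y - z)"
      have near: "p \<in> cball 0 (norm x + 2)" "dist p (x - z) < \<delta>" if "p \<in> ?S" for p
      proof -
        have "norm (p - (x - z)) \<le> norm ((y - z) - (x - z))"
          using segment_bound1[OF that] by (simp add: norm_minus_commute)
        then have *: "norm (p - (x - z)) \<le> norm (y - x)" by simp
        then show "dist p (x - z) < \<delta>" using y by (simp add: dist_norm)
        have "norm p \<le> norm (p - (x - z)) + norm (x - z)" by (metis diff_add_cancel norm_triangle_ineq)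
        also have "norm (x - z) \<le> norm x + norm z" by (rule norm_triangle_ineq4)
        finally show "p \<in> cball 0 (norm x + 2)" using * y z by simp
      qed
      have "norm (\<psi> (y - z) - \<psi> (x - z) - frechet_derivative \<psi> (at (x - z)) ((y - z) - (x - z)))
          \<le> norm ((y - z) - (x - z)) * \<eta>"
      proof (rule differentiable_bound_linearization[where S = ?S and f' = "\<lambda>p. frechet_derivative \<psi> (at p)"])
        show "x - z + t *\<^sub>R ((y - z) - (x - z)) \<in> ?S" if "t \<in> {0..1}" for t
          using that by (auto simp: closed_segment_def algebra_simps intro!: exI[of _ t])
        show "(\<psi> has_derivative frechet_derivative \<psi> (at p)) (at p within ?S)" for p
          using D by (rule has_derivative_at_withinI)
        show "onorm (frechet_derivative \<psi> (at p) - frechet_derivative \<psi> (at (x - z))) \<le> \<eta>" if p: "p \<in> ?S" for p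
        proof (rule onorm_le)
          fix h
          have "norm ((frechet_derivative \<psi> (at p) - frechet_derivative \<psi> (at (x - z))) h) = \<bar>h \<bullet> (g p - g (x - z))\<bar>"
            by (simp add: Dg inner_diff_right)
          also have "\<dots> \<le> norm h * norm (g p - g (x - z))" by (rule Cauchy_Schwarz_ineq2)
          also have "\<dots> \<le> norm h * \<eta>"
            using \<delta>(2)[OF near(1)[of "x - z"] near(1)[OF p] near(2)[OF p]]
            by (intro mult_left_mono) (auto simp: dist_norm)
          finally show "norm ((frechet_derivative \<psi> (at p) - frechet_derivative \<psi> (at (x - z))) h) \<le> \<eta> * norm h"
            by (simp add: mult.commute)
        qed
      qed simp
      then show ?thesis by simp
    qed
    have "convolve \<psi> v y - convolve \<psi> v x - ?D (y - x) = (\<integral>z. ?r z *\<^sub>R v z \<partial>lebesgue)"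
      unfolding convolve_def scaleR_diff_left
      using convolve_integrable[OF \<psi>c] convolve_integrable[OF Dc]
      by (simp add: Bochner_Integration.integral_diff Bochner_Integration.integrable_diff)
    also have "norm \<dots> \<le> (\<integral>z. (norm (y - x) * \<eta> * C) * indicator (ball (0::'a) 1) z \<partial>lebesgue)"
    proof (rule Bochner_Integration.integral_norm_bound_integral)
      show "integrable lebesgue (\<lambda>z. ?r z *\<^sub>R v z)"
        unfolding scaleR_diff_left
        by (intro Bochner_Integration.integrable_diff convolve_integrable \<psi>c Dc)
      show "norm (?r z *\<^sub>R v z) \<le> (norm (y - x) * \<eta> * C) * indicator (ball 0 1) z" for z
      proof (cases "z \<in> ball 0 1")
        case True
        then have "norm (v z) \<le> C" using bound_v[of z] by simp
        then show ?thesis using mult_mono[OF r[OF True], of "norm (v z)" C] True \<eta> by simp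
      next
        case False
        then show ?thesis using bound_v[of z] by simp
      qed
    qed (rule indicator_ball_integral)
    also have "\<dots> = norm (y - x) * (\<eta> * (C * V))" by (simp add: indicator_ball_integral(2) V_def)
    also have "\<dots> \<le> norm (y - x) * e"
      using V e by (intro mult_left_mono) (auto simp: \<eta>_def field_simps)
    finally show "norm (convolve \<psi> v y - convolve \<psi> v x - ?D (y - x)) \<le> e * norm (y - x)"
      by (simp add: mult.commute)
  qed (use \<delta>(1) in simp)
qed

text \<open>Every directional derivative of a convolution is again a convolution of v, now with the
  derivative of \<psi>, hence the induction runs over all smooth \<psi>.\<close>

lemma Ck_on_convolve: "(\<And>k. Ck_on k UNIV \<psi>) \<Longrightarrow> Ck_on k UNIV (convolve \<psi> v)"
proof (induction k arbitrary: \<psi>)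
  case 0
  then show ?case using convolve_continuous[OF Ck_on_continuous[OF 0]] by simp
next
  case (Suc k)
  show ?case
    by (rule Ck_on_SucI[OF convolve_has_derivative[OF Suc.prems]], rule Suc.IH,
        rule Ck_on_derivative, rule Suc.prems)
qed

end

lemma (in bounded_unit_ball_function) norm_le_C: "norm (v z) \<le> C"
  using bound_v[of z] C_nonneg by (cases "z \<in> ball 0 1") auto

text \<open>The bound r \<le> 1 keeps all mollified functions inside the ball of radius 2,
  independently of r.\<close>

locale mollifier =
  fixes \<rho> :: "'a::euclidean_space \<Rightarrow> real" and r :: real
  assumes smooth: "\<And>k. Ck_on k UNIV \<rho>" and nonneg: "\<And>z. \<rho> z \<ge> 0"
    and support: "\<And>z. norm z \<ge> r \<Longrightarrow> \<rho> z = 0" and r: "0 < r" "r \<le> 1"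
    and integrable: "integrable lebesgue \<rho>" and mass: "(\<integral>z. \<rho> z \<partial>lebesgue) = 1"

lemma mollifier_exists: "\<exists>\<rho>::'a::euclidean_space \<Rightarrow> real. mollifier \<rho> (1 / (real k + 1))"
proof -
  obtain \<psi> :: "'a \<Rightarrow> real" and h where \<psi>: "\<psi> \<in> test_functions (ball 0 1)"
    and pos: "\<And>z. 0 \<le> \<psi> z" "\<psi> 0 > 0"
    using radial_test_function by metis
  have cont: "continuous_on UNIV \<psi>" using test_functionD(1)[OF \<psi>, of 0] by simp
  note m = lebesgue_measurable_continuous[OF cont]
  have off: "\<psi> z = 0" if "norm z \<ge> 1" for z
  proof -
    have "z \<notin> closure {z. \<psi> z \<noteq> 0}" using test_functionD(3)[OF \<psi>] that by auto
    then show ?thesis using closure_subset[of "{z. \<psi> z \<noteq> 0}"] by blast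
  qed
  obtain M where M: "\<And>z. norm (\<psi> z) \<le> M" using test_function_bounded[OF \<psi>] by metis
  have int: "integrable lebesgue \<psi>"
    by (rule integrable_bounded_support[OF m lmeasurable_ball[of 0 1]])
      (use M off in \<open>auto simp del: real_norm_def\<close>)
  have J: "(\<integral>z. \<psi> z \<partial>lebesgue) > 0"
  proof (rule ccontr)
    assume "\<not> (\<integral>z. \<psi> z \<partial>lebesgue) > 0"
    moreover have "(\<integral>z. \<psi> z \<partial>lebesgue) \<ge> 0" using pos(1) by (rule Bochner_Integration.integral_nonneg)
    ultimately have "(\<integral>z. \<psi> z \<partial>lebesgue) = 0" by linarith
    then have AE: "AE z in lebesgue. \<psi> z = 0"
      using integral_nonneg_eq_0_iff_AE[OF int] pos(1) by auto
    have "open {z. 0 < \<psi> z}" using cont by (intro open_Collect_less) auto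
    then have "{z. 0 < \<psi> z} \<in> sets lebesgue" by simp
    moreover have "AE z in lebesgue. z \<notin> {z. 0 < \<psi> z}" using AE by (auto elim!: eventually_mono)
    ultimately have "negligible {z. 0 < \<psi> z}" by (simp add: negligible_iff_null_sets AE_iff_null_sets)
    moreover have "{z. 0 < \<psi> z} \<noteq> {}" using pos(2) by auto
    ultimately show False using open_not_negligible \<open>open {z. 0 < \<psi> z}\<close> by blast
  qed
  define c where "c = real k + 1"
  have c: "c > 0" "c \<noteq> 0" by (auto simp: c_def)
  define I where "I = (\<integral>z. \<psi> (c *\<^sub>R z + 0) \<partial>lebesgue)"
  have "(\<integral>z. \<psi> z \<partial>lebesgue) = \<bar>c\<bar> ^ DIM('a) *\<^sub>R I"
    using integral_lebesgue_affine[OF m c(2), of 0] by (simp add: I_def)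
  then have I: "I > 0" using J c by (simp add: zero_less_mult_iff)
  have "mollifier (\<lambda>z. inverse I * \<psi> (c *\<^sub>R z + 0)) (1 / c)"
  proof
    show "Ck_on j UNIV (\<lambda>z. inverse I * \<psi> (c *\<^sub>R z + 0))" for j
      by (rule Ck_on_mult[OF Ck_on_const Ck_on_affine_compose[OF bounded_linear_scaleR_right test_functionD(1)[OF \<psi>]]])
    show "inverse I * \<psi> (c *\<^sub>R z + 0) = 0" if "norm z \<ge> 1 / c" for z
      using off[of "c *\<^sub>R z + 0"] that c by (simp add: field_simps)
    show "integrable lebesgue (\<lambda>z. inverse I * \<psi> (c *\<^sub>R z + 0))"
      using integrable_lebesgue_affine[OF int c(2), of 0] by simp
    show "(\<integral>z. inverse I * \<psi> (c *\<^sub>R z + 0) \<partial>lebesgue) = 1"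
      using I unfolding Bochner_Integration.integral_mult_right_zero by (simp add: I_def)
  qed (use pos I c in \<open>auto simp: c_def\<close>)
  then show ?thesis unfolding c_def by blast
qed

context mollifier
begin

lemma continuous: "continuous_on UNIV \<rho>"
  using smooth[of 0] by simp

lemma borel: "\<rho> \<in> borel_measurable borel"
  by (rule borel_measurable_continuous_onI[OF continuous])

lemma reflected: "integrable lebesgue (\<lambda>z. \<rho> (x - z))" "(\<integral>z. \<rho> (x - z) \<partial>lebesgue) = 1"
  using integrable_lebesgue_affine[OF integrable, of "-1" x] mass
    integral_lebesgue_affine[OF borel_measurable_integrable[OF integrable], of "-1" x] by simp_all

lemma nn_translated: "(\<integral>\<^sup>+x. ennreal (\<rho> (x - z)) \<partial>lborel) = 1"
proof -
  have int: "integrable lebesgue (\<lambda>x. \<rho> (x - z))" "(\<integral>x. \<rho> (x - z) \<partial>lebesgue) = 1"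
    using integrable_lebesgue_affine[OF integrable, of 1 "- z"] mass
      integral_lebesgue_affine[OF borel_measurable_integrable[OF integrable], of 1 "- z"] by simp_all
  have "(\<integral>\<^sup>+x. ennreal (\<rho> (x - z)) \<partial>lborel) = (\<integral>\<^sup>+x. ennreal (\<rho> (x - z)) \<partial>lebesgue)"
    by (simp add: nn_integral_completion)
  also have "\<dots> = ennreal (\<integral>x. \<rho> (x - z) \<partial>lebesgue)"
    by (rule nn_integral_eq_integral[OF int(1)]) (simp add: nonneg)
  finally show ?thesis using int(2) by simp
qed

lemma convolve_norm_bound:
  assumes "bounded_unit_ball_function v C"
  shows "norm (convolve \<rho> v x) \<le> C"
proof -
  interpret bounded_unit_ball_function v C by fact
  have "norm (convolve \<rho> v x) \<le> (\<integral>z. C * \<rho> (x - z) \<partial>lebesgue)"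
    unfolding convolve_def
  proof (rule Bochner_Integration.integral_norm_bound_integral)
    show "integrable lebesgue (\<lambda>z. \<rho> (x - z) *\<^sub>R v z)" by (rule convolve_integrable[OF continuous])
    show "integrable lebesgue (\<lambda>z. C * \<rho> (x - z))" using reflected(1) by simp
    show "norm (\<rho> (x - z) *\<^sub>R v z) \<le> C * \<rho> (x - z)" for z
    proof -
      have "\<rho> (x - z) * norm (v z) \<le> \<rho> (x - z) * C" by (rule mult_left_mono[OF norm_le_C nonneg])
      then show ?thesis by (simp add: nonneg mult.commute)
    qed
  qed
  also have "\<dots> = C" using reflected(2) by simp
  finally show ?thesis .
qed

lemma convolve_support:
  assumes "bounded_unit_ball_function v C" and "norm x \<ge> 1 + r"
  shows "convolve \<rho> v x = 0"
proof -
  interpret bounded_unit_ball_function v C by fact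
  have "\<rho> (x - z) *\<^sub>R v z = 0" for z
  proof (cases "z \<in> ball 0 1")
    case True
    then have "norm (x - z) \<ge> r" using norm_triangle_ineq2[of x z] assms(2) by simp
    then show ?thesis using support by simp
  next
    case False
    then show ?thesis using bound_v[of z] by simp
  qed
  then show ?thesis unfolding convolve_def by (simp only: Bochner_Integration.integral_zero)
qed

text \<open>Young's inequality for a kernel of mass one, by Tonelli. Tonelli is applied to Borel
  functions on the product, and so |v|, which is only Lebesgue measurable, is first replaced by a
  Borel function \<open>u\<close> equal to it almost everywhere.\<close>

lemma convolve_L1_bound:
  assumes "bounded_unit_ball_function v C"
  shows "(\<integral>\<^sup>+x. ennreal (norm (convolve \<rho> v x)) \<partial>lebesgue) \<le> (\<integral>\<^sup>+z. ennreal (norm (v z)) \<partial>lebesgue)"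
proof -
  interpret bounded_unit_ball_function v C by fact
  have "(\<lambda>z. ennreal (norm (v z))) \<in> borel_measurable lebesgue" using measurable_v by measurable
  from completion_ex_borel_measurable[OF this] obtain u where
    u [measurable]: "u \<in> borel_measurable lborel" and AE: "AE z in lborel. ennreal (norm (v z)) = u z" by blast
  note [measurable] = borel
  have "ennreal (norm (convolve \<rho> v x)) \<le> (\<integral>\<^sup>+z. ennreal (\<rho> (x - z)) * u z \<partial>lborel)" for x
  proof -
    have "ennreal (norm (convolve \<rho> v x)) \<le> (\<integral>\<^sup>+z. ennreal (norm (\<rho> (x - z) *\<^sub>R v z)) \<partial>lebesgue)"
      unfolding convolve_def by (rule integral_norm_bound_ennreal[OF convolve_integrable[OF continuous]])
    also have "\<dots> = (\<integral>\<^sup>+z. ennreal (norm (\<rho> (x - z) *\<^sub>R v z)) \<partial>lborel)"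
      by (rule nn_integral_completion)
    also have "\<dots> = (\<integral>\<^sup>+z. ennreal (\<rho> (x - z)) * u z \<partial>lborel)"
      by (rule nn_integral_cong_AE)
        (use AE in \<open>eventually_elim, simp add: nonneg ennreal_mult'\<close>)
    finally show ?thesis .
  qed
  then have "(\<integral>\<^sup>+x. ennreal (norm (convolve \<rho> v x)) \<partial>lebesgue) \<le> (\<integral>\<^sup>+x. (\<integral>\<^sup>+z. ennreal (\<rho> (x - z)) * u z \<partial>lborel) \<partial>lborel)"
    unfolding nn_integral_completion by (intro nn_integral_mono) simp
  also have "\<dots> = (\<integral>\<^sup>+z. (\<integral>\<^sup>+x. ennreal (\<rho> (x - z)) * u z \<partial>lborel) \<partial>lborel)"
    by (rule lborel_pair.Fubini'[symmetric]) measurable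
  also have "\<dots> = (\<integral>\<^sup>+z. u z \<partial>lborel)"
  proof (rule nn_integral_cong)
    fix z
    have "(\<integral>\<^sup>+x. ennreal (\<rho> (x - z)) * u z \<partial>lborel) = (\<integral>\<^sup>+x. ennreal (\<rho> (x - z)) \<partial>lborel) * u z"
      by (rule nn_integral_multc) measurable
    then show "(\<integral>\<^sup>+x. ennreal (\<rho> (x - z)) * u z \<partial>lborel) = u z" by (simp add: nn_translated)
  qed
  also have "\<dots> = (\<integral>\<^sup>+z. ennreal (norm (v z)) \<partial>lborel)"
    by (rule nn_integral_cong_AE) (use AE in \<open>eventually_elim, simp\<close>)
  finally show ?thesis by (simp add: nn_integral_completion)
qed

end

section \<open>Convergence of mollifications\<close>

context bounded_unit_ball_function
begin

lemma integrable_v: "integrable lebesgue v"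
  by (rule Bochner_Integration.integrable_bound[OF indicator_ball_integral(1)[of C 0 1] measurable_v])
    (rule AE_I2, rule order_trans[OF bound_v], simp)

lemma convolve_integrable_UNIV:
  assumes "mollifier \<rho> r"
  shows "integrable lebesgue (convolve \<rho> v)"
proof -
  interpret mollifier \<rho> r by fact
  show ?thesis
  proof (rule integrable_bounded_support[OF _ lmeasurable_ball[of 0 "1 + r"]])
    show "convolve \<rho> v \<in> borel_measurable lebesgue"
      by (rule lebesgue_measurable_continuous[OF convolve_continuous[OF continuous]])
    show "AE x in lebesgue. norm (convolve \<rho> v x) \<le> C"
      by (intro AE_I2 convolve_norm_bound bounded_unit_ball_function_axioms)
    show "AE x in lebesgue. x \<notin> ball 0 (1 + r) \<longrightarrow> convolve \<rho> v x = 0"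
      using convolve_support[OF bounded_unit_ball_function_axioms] by auto
  qed
qed

text \<open>Measurability supplies continuous functions converging almost everywhere. They are
  truncated in size and cut off towards the sphere, after which dominated convergence gives
  closeness in the mean.\<close>

lemma continuous_approximation:
  assumes "\<eta> > 0"
  obtains g where "continuous_on UNIV g" and "bounded_unit_ball_function g (C + 1)"
    and "(\<integral>z. norm (v z - g z) \<partial>lebesgue) < \<eta>"
proof -
  have "v measurable_on UNIV"
    by (rule lebesgue_measurable_imp_measurable_on[OF measurable_v]) simp
  then obtain N g0 where N: "negligible N" and g0c: "\<And>k. continuous_on UNIV (g0 k)"
    and g0: "\<And>z. z \<notin> N \<Longrightarrow> (\<lambda>k. g0 k z) \<longlonglongrightarrow> v z"
    unfolding measurable_on_def by auto
  \<comment> \<open>The first factor is 0 off the unit ball and tends to 1 inside it; the second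
    shrinks values larger than C + 1. Truncating at C + 1 instead of C keeps the denominator
    positive when C = 0, and |v| \<le> C makes the factor tend to 1.\<close>
  define g where "g k z = (max 0 (min 1 (real k * (1 - norm z))) * ((C + 1) / max (C + 1) (norm (g0 k z)))) *\<^sub>R g0 k z"
    for k :: nat and z
  have C1: "C + 1 > 0" using C_nonneg by simp
  have gc: "continuous_on UNIV (g k)" for k
  proof -
    have "max (C + 1) (norm (g0 k z)) \<noteq> 0" for z
      using C1 max.cobounded1[of "C + 1" "norm (g0 k z)"] by linarith
    then show ?thesis unfolding g_def by (intro continuous_intros g0c) auto
  qed
  have gb: "norm (g k z) \<le> (C + 1) * indicator (ball 0 1) z" for k z
  proof (cases "z \<in> ball 0 1")
    case True
    have "max (C + 1) (norm (g0 k z)) > 0" using C1 by (simp add: less_max_iff_disj)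
    then have "norm (g0 k z) / max (C + 1) (norm (g0 k z)) \<le> 1" by (simp add: divide_le_eq_1_pos)
    then have "(C + 1) * (norm (g0 k z) / max (C + 1) (norm (g0 k z))) \<le> (C + 1) * 1"
      using C1 by (intro mult_left_mono) auto
    then have "(C + 1) / max (C + 1) (norm (g0 k z)) * norm (g0 k z) \<le> C + 1" by simp
    then have "max 0 (min 1 (real k * (1 - norm z))) * ((C + 1) / max (C + 1) (norm (g0 k z)) * norm (g0 k z)) \<le> 1 * (C + 1)"
      by (intro mult_mono) (use C1 in auto)
    moreover have "norm (g k z) = max 0 (min 1 (real k * (1 - norm z))) * ((C + 1) / max (C + 1) (norm (g0 k z)) * norm (g0 k z))"
      using C1 by (simp add: g_def abs_mult mult_ac)
    ultimately show ?thesis using True by simp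
  next
    case False
    then have "real k * (1 - norm z) \<le> 0" by (simp add: mult_nonneg_nonpos)
    then show ?thesis using False by (simp add: g_def)
  qed
  have bg: "bounded_unit_ball_function (g k) (C + 1)" for k
    by unfold_locales (use gb lebesgue_measurable_continuous[OF gc] in auto)
  have glim: "(\<lambda>k. g k z) \<longlonglongrightarrow> v z" if z: "z \<notin> N" for z
  proof (cases "z \<in> ball 0 1")
    case True
    then have pos: "1 - norm z > 0" by simp
    have "\<forall>\<^sub>F k in sequentially. max 0 (min 1 (real k * (1 - norm z))) = 1"
    proof -
      obtain K :: nat where K: "real K \<ge> 1 / (1 - norm z)" using real_arch_simple by blast
      have "max 0 (min 1 (real k * (1 - norm z))) = 1" if "k \<ge> K" for k
      proof -
        have "1 / (1 - norm z) \<le> real k" using K that by linarith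
        then have "1 \<le> real k * (1 - norm z)" using pos by (simp add: field_simps)
        then show ?thesis by simp
      qed
      then show ?thesis unfolding eventually_sequentially by blast
    qed
    then have 1: "(\<lambda>k. max 0 (min 1 (real k * (1 - norm z)))) \<longlonglongrightarrow> 1" by (rule tendsto_eventually)
    have "max (C + 1) (norm (v z)) = C + 1" using norm_le_C[of z] by simp
    then have "(\<lambda>k. (C + 1) / max (C + 1) (norm (g0 k z))) \<longlonglongrightarrow> (C + 1) / (C + 1)"
      using C1 tendsto_divide[OF tendsto_const tendsto_max[OF tendsto_const tendsto_norm[OF g0[OF z]]], of "C + 1" "C + 1"]
      by simp
    then have 2: "(\<lambda>k. (C + 1) / max (C + 1) (norm (g0 k z))) \<longlonglongrightarrow> 1" using C1 by simp
    show ?thesis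
      using tendsto_scaleR[OF tendsto_mult[OF 1 2] g0[OF z]] by (simp add: g_def)
  next
    case False
    have "g k z = 0" for k using gb[of k z] False by simp
    moreover have "v z = 0" using bound_v[of z] False by simp
    ultimately show ?thesis by simp
  qed
  have "(\<lambda>k. \<integral>z. norm (v z - g k z) \<partial>lebesgue) \<longlonglongrightarrow> (\<integral>z. 0 \<partial>(lebesgue :: 'a measure))"
  proof (rule integral_dominated_convergence[OF _ _ indicator_ball_integral(1)[of "2 * C + 1" 0 1]])
    show "(\<lambda>z. norm (v z - g k z)) \<in> borel_measurable lebesgue" for k
      using measurable_v lebesgue_measurable_continuous[OF gc] by measurable
    have "N \<in> null_sets lebesgue" using N by (simp add: negligible_iff_null_sets)
    from AE_not_in[OF this] show "AE z in lebesgue. (\<lambda>k. norm (v z - g k z)) \<longlonglongrightarrow> 0"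
    proof eventually_elim
      case (elim z)
      show ?case using tendsto_norm[OF tendsto_diff[OF tendsto_const glim[OF elim]], of "v z"] by simp
    qed
    show "AE z in lebesgue. norm (norm (v z - g k z)) \<le> (2 * C + 1) * indicator (ball 0 1) z" for k
    proof (rule AE_I2)
      fix z
      show "norm (norm (v z - g k z)) \<le> (2 * C + 1) * indicator (ball 0 1) z"
        using norm_triangle_ineq4[of "v z" "g k z"] bound_v[of z] gb[of k z]
        by (cases "z \<in> ball 0 1") auto
    qed
  qed simp
  then have "(\<lambda>k. \<integral>z. norm (v z - g k z) \<partial>lebesgue) \<longlonglongrightarrow> 0" by simp
  from order_tendstoD(2)[OF this assms] obtain k where "(\<integral>z. norm (v z - g k z) \<partial>lebesgue) < \<eta>"
    unfolding eventually_sequentially by blast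
  then show thesis using that[OF gc bg] by blast
qed

end

lemma continuous_mollification:
  fixes g :: "'a::euclidean_space \<Rightarrow> 'b::euclidean_space"
  assumes g: "continuous_on UNIV g" "bounded_unit_ball_function g C" and \<eta>: "\<eta> > 0"
  obtains \<delta> where "\<delta> > 0" and "\<And>\<rho> r x. mollifier \<rho> r \<Longrightarrow> r \<le> \<delta> \<Longrightarrow>
    norm (convolve \<rho> g x - g x) \<le> \<eta> * indicator (ball 0 3) x"
proof -
  interpret bounded_unit_ball_function g C by fact
  \<comment> \<open>Contains every x with |x| < 3 together with the points z with |x - z| < r \<le>
    1.\<close>
  have "uniformly_continuous_on (cball 0 4) g"
    by (rule compact_uniformly_continuous) (use g(1) continuous_on_subset in auto)
  then obtain \<delta> where \<delta>: "\<delta> > 0" "\<And>p q. p \<in> cball 0 4 \<Longrightarrow> q \<in> cball 0 4 \<Longrightarrow> dist q p < \<delta> \<Longrightarrow> dist (g q) (g p) < \<eta>"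
    using \<eta> unfolding uniformly_continuous_on_def by metis
  have "norm (convolve \<rho> g x - g x) \<le> \<eta> * indicator (ball 0 3) x"
    if "mollifier \<rho> r" and r\<delta>: "r \<le> \<delta>" for \<rho> :: "'a \<Rightarrow> real" and r x
  proof (cases "x \<in> ball 0 3")
    case True
    interpret mollifier \<rho> r by fact
    have "convolve \<rho> g x - g x = (\<integral>z. \<rho> (x - z) *\<^sub>R g z \<partial>lebesgue) - (\<integral>z. \<rho> (x - z) *\<^sub>R g x \<partial>lebesgue)"
      by (simp add: convolve_def reflected)
    also have "\<dots> = (\<integral>z. \<rho> (x - z) *\<^sub>R g z - \<rho> (x - z) *\<^sub>R g x \<partial>lebesgue)"
      by (rule Bochner_Integration.integral_diff[symmetric])
        (use convolve_integrable[OF continuous] reflected(1) in auto)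
    also have "norm \<dots> \<le> (\<integral>z. \<eta> * \<rho> (x - z) \<partial>lebesgue)"
    proof (rule Bochner_Integration.integral_norm_bound_integral)
      show "integrable lebesgue (\<lambda>z. \<rho> (x - z) *\<^sub>R g z - \<rho> (x - z) *\<^sub>R g x)"
        using convolve_integrable[OF continuous] reflected(1) by auto
      show "integrable lebesgue (\<lambda>z. \<eta> * \<rho> (x - z))" using reflected(1) by simp
      show "norm (\<rho> (x - z) *\<^sub>R g z - \<rho> (x - z) *\<^sub>R g x) \<le> \<eta> * \<rho> (x - z)" for z
      proof (cases "norm (x - z) < r")
        case close: True
        have "norm z \<le> norm x + norm (x - z)" by (metis norm_minus_commute norm_triangle_sub)
        then have "z \<in> cball 0 4" "x \<in> cball 0 4" using True close r by simp_all
        moreover have "dist z x < \<delta>" using close r\<delta> by (simp add: dist_norm norm_minus_commute)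
        ultimately have "norm (g z - g x) \<le> \<eta>" using \<delta>(2)[of x z] by (simp add: dist_norm)
        then have "\<rho> (x - z) * norm (g z - g x) \<le> \<rho> (x - z) * \<eta>" by (rule mult_left_mono) (rule nonneg)
        then show ?thesis by (simp add: scaleR_diff_right[symmetric] nonneg mult.commute)
      next
        case False
        then show ?thesis using support[of "x - z"] by simp
      qed
    qed
    also have "\<dots> = \<eta>" using reflected(2) by simp
    finally show ?thesis using True by simp
  next
    case False
    interpret mollifier \<rho> r by fact
    have "convolve \<rho> g x = 0"
      by (rule convolve_support[OF g(2)]) (use False r in simp)
    moreover have "g x = 0" using bound_v[of x] False by (simp add: indicator_def)
    ultimately show ?thesis using False by simp
  qed
  then show thesis using that[OF \<delta>(1)] by blast
qed

text \<open>Three thirds of e: replace v by a continuous g, mollify g, and return. The mollified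
  difference v - g is no larger in the mean than v - g itself.\<close>

lemma mollification_L1:
  fixes v :: "'a::euclidean_space \<Rightarrow> 'b::euclidean_space"
  assumes v: "bounded_unit_ball_function v C" and m: "\<And>k. mollifier (\<rho> k) (1 / (real k + 1))"
  shows "(\<lambda>k. \<integral>x. norm (convolve (\<rho> k) v x - v x) \<partial>lebesgue) \<longlonglongrightarrow> 0"
proof (rule LIMSEQ_I)
  interpret bounded_unit_ball_function v C by fact
  fix e :: real assume e: "e > 0"
  define V where "V = measure lebesgue (ball (0::'a) 3)"
  have V: "V \<ge> 0" by (simp add: V_def)
  have e3: "e / 3 > 0" using e by simp
  obtain g where gc: "continuous_on UNIV g" and gb: "bounded_unit_ball_function g (C + 1)"
    and gv: "(\<integral>z. norm (v z - g z) \<partial>lebesgue) < e / 3"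
    by (rule continuous_approximation[OF e3])
  interpret g: bounded_unit_ball_function g "C + 1" by fact
  interpret d: bounded_unit_ball_function "\<lambda>z. v z - g z" "2 * C + 1"
  proof
    show "(\<lambda>z. v z - g z) \<in> borel_measurable lebesgue"
      using measurable_v g.measurable_v by measurable
    show "norm (v z - g z) \<le> (2 * C + 1) * indicator (ball 0 1) z" for z
      using norm_triangle_ineq4[of "v z" "g z"] bound_v[of z] g.bound_v[of z] by (cases "z \<in> ball 0 1") auto
  qed
  define \<eta> where "\<eta> = e / (3 * (V + 1))"
  have \<eta>: "\<eta> > 0" using e V by (simp add: \<eta>_def)
  obtain \<delta> where \<delta>: "\<delta> > 0" "\<And>\<rho> r x. mollifier \<rho> r \<Longrightarrow> r \<le> \<delta> \<Longrightarrow>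
      norm (convolve \<rho> g x - g x) \<le> \<eta> * indicator (ball 0 3) x"
    using continuous_mollification[OF gc gb \<eta>] by metis
  obtain K :: nat where K: "real K \<ge> 1 / \<delta>" using real_arch_simple by blast
  have "(\<integral>x. norm (convolve (\<rho> k) v x - v x) \<partial>lebesgue) < e" if k: "k \<ge> K" for k
  proof -
    interpret mollifier "\<rho> k" "1 / (real k + 1)" by (rule m)
    have "1 / \<delta> \<le> real k + 1" using K k by linarith
    then have rk: "1 / (real k + 1) \<le> \<delta>" using \<delta>(1) by (simp add: field_simps)
    have split: "convolve (\<rho> k) v x = convolve (\<rho> k) (\<lambda>z. v z - g z) x + convolve (\<rho> k) g x" for x
      unfolding convolve_def using d.convolve_integrable[OF continuous] g.convolve_integrable[OF continuous]
      by (subst Bochner_Integration.integral_add[symmetric]) (auto simp: scaleR_diff_right)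
    have i1: "integrable lebesgue (\<lambda>x. norm (convolve (\<rho> k) (\<lambda>z. v z - g z) x))"
      by (rule integrable_norm[OF d.convolve_integrable_UNIV[OF m]])
    have i2: "integrable lebesgue (\<lambda>x. \<eta> * indicator (ball 0 3) (x::'a) :: real)"
      by (rule indicator_ball_integral)
    have i3: "integrable lebesgue (\<lambda>x. norm (v x - g x))"
      by (rule integrable_norm[OF d.integrable_v])
    have "(\<integral>x. norm (convolve (\<rho> k) v x - v x) \<partial>lebesgue)
        \<le> (\<integral>x. norm (convolve (\<rho> k) (\<lambda>z. v z - g z) x) + \<eta> * indicator (ball 0 3) x + norm (v x - g x) \<partial>lebesgue)"
    proof (rule integral_mono)
      show "integrable lebesgue (\<lambda>x. norm (convolve (\<rho> k) v x - v x))"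
        by (intro integrable_norm Bochner_Integration.integrable_diff convolve_integrable_UNIV[OF m] integrable_v)
      show "integrable lebesgue (\<lambda>x. norm (convolve (\<rho> k) (\<lambda>z. v z - g z) x) + \<eta> * indicator (ball 0 3) x + norm (v x - g x))"
        by (intro Bochner_Integration.integrable_add i1 i2 i3)
      show "norm (convolve (\<rho> k) v x - v x)
          \<le> norm (convolve (\<rho> k) (\<lambda>z. v z - g z) x) + \<eta> * indicator (ball 0 3) x + norm (v x - g x)" for x
      proof -
        have "convolve (\<rho> k) v x - v x = convolve (\<rho> k) (\<lambda>z. v z - g z) x + (convolve (\<rho> k) g x - g x) - (v x - g x)"
          by (simp add: split)
        then have "norm (convolve (\<rho> k) v x - v x)
            \<le> norm (convolve (\<rho> k) (\<lambda>z. v z - g z) x) + norm (convolve (\<rho> k) g x - g x) + norm (v x - g x)"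
          using norm_triangle_ineq4[of "convolve (\<rho> k) (\<lambda>z. v z - g z) x + (convolve (\<rho> k) g x - g x)" "v x - g x"]
            norm_triangle_ineq[of "convolve (\<rho> k) (\<lambda>z. v z - g z) x" "convolve (\<rho> k) g x - g x"]
          by simp
        then show ?thesis using \<delta>(2)[OF m rk, of x] by linarith
      qed
    qed
    also have "\<dots> = (\<integral>x. norm (convolve (\<rho> k) (\<lambda>z. v z - g z) x) \<partial>lebesgue) + \<eta> * V + (\<integral>x. norm (v x - g x) \<partial>lebesgue)"
      by (simp only: Bochner_Integration.integral_add Bochner_Integration.integrable_add i1 i2 i3
          indicator_ball_integral(2) V_def)
    also have "(\<integral>x. norm (convolve (\<rho> k) (\<lambda>z. v z - g z) x) \<partial>lebesgue) \<le> (\<integral>x. norm (v x - g x) \<partial>lebesgue)"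
    proof -
      have "ennreal (\<integral>x. norm (convolve (\<rho> k) (\<lambda>z. v z - g z) x) \<partial>lebesgue) \<le> ennreal (\<integral>x. norm (v x - g x) \<partial>lebesgue)"
        using convolve_L1_bound[OF d.bounded_unit_ball_function_axioms]
        by (simp add: nn_integral_eq_integral[OF i1] nn_integral_eq_integral[OF i3])
      then show ?thesis by (simp add: ennreal_le_iff Bochner_Integration.integral_nonneg)
    qed
    also have "\<eta> * V \<le> e / 3" using V e by (simp add: \<eta>_def field_simps)
    finally show ?thesis using gv by simp
  qed
  then show "\<exists>K. \<forall>k\<ge>K. norm ((\<integral>x. norm (convolve (\<rho> k) v x - v x) \<partial>lebesgue) - 0) < e"
    by (intro exI[of _ K]) (simp add: Bochner_Integration.integral_nonneg)
qed

text \<open>Convergence in the mean gives convergence almost everywhere only along a subsequence,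
  and for this reason the radii are left unspecified in the conclusion.\<close>

lemma mollification_AE:
  fixes v :: "'a::euclidean_space \<Rightarrow> 'b::euclidean_space"
  assumes v: "bounded_unit_ball_function v C"
  obtains \<rho> :: "nat \<Rightarrow> 'a \<Rightarrow> real" and r where "\<And>k. mollifier (\<rho> k) (r k)"
    and "AE x in lebesgue. (\<lambda>k. convolve (\<rho> k) v x) \<longlonglongrightarrow> v x"
proof -
  interpret bounded_unit_ball_function v C by fact
  obtain \<rho> :: "nat \<Rightarrow> 'a \<Rightarrow> real" where m: "\<And>k. mollifier (\<rho> k) (1 / (real k + 1))"
    using mollifier_exists by metis
  have "integrable lebesgue (\<lambda>x. convolve (\<rho> k) v x - v x)" for k
    by (intro Bochner_Integration.integrable_diff convolve_integrable_UNIV[OF m] integrable_v)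
  from tendsto_L1_AE_subseq[OF this mollification_L1[OF v m]] obtain q where
    "strict_mono q" and q: "AE x in lebesgue. (\<lambda>k. convolve (\<rho> (q k)) v x - v x) \<longlonglongrightarrow> 0" by blast
  have "AE x in lebesgue. (\<lambda>k. convolve (\<rho> (q k)) v x) \<longlonglongrightarrow> v x"
    using q by eventually_elim (simp add: LIM_zero_cancel)
  then show thesis by (rule that[of "\<lambda>k. \<rho> (q k)", OF m])
qed

section \<open>Necessity of material stability\<close>

lemma integrable_mult_continuous:
  fixes f g :: "real^'d \<Rightarrow> real"
  assumes f: "f \<in> borel_measurable (lebesgue_on (ball 0 1))" "AE z in lebesgue_on (ball 0 1). \<bar>f z\<bar> \<le> C"
    and g: "continuous_on UNIV g"
  shows "integrable (lebesgue_on (ball 0 1)) (\<lambda>z. f z * g z)"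
proof -
  interpret finite_measure "lebesgue_on (ball (0::real^'d) 1)"
    by (rule finite_measure_lebesgue_on) simp
  obtain M where M: "\<And>z. z \<in> cball 0 1 \<Longrightarrow> norm (g z) \<le> M"
    using continuous_bounded_on_compact[OF compact_cball continuous_on_subset[OF g subset_UNIV]] by metis
  have gm: "g \<in> borel_measurable (lebesgue_on (ball 0 1))"
    using lebesgue_measurable_continuous[OF g] by (rule measurable_restrict_space1)
  show ?thesis
  proof (rule integrable_const_bound)
    have "AE z in lebesgue_on (ball 0 1). z \<in> ball (0::real^'d) 1"
      by (rule AE_I2) (simp add: space_restrict_space)
    with f(2) show "AE z in lebesgue_on (ball 0 1). norm (f z * g z) \<le> C * M"
    proof eventually_elim
      case (elim z)
      then have "\<bar>g z\<bar> \<le> M" using M by auto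
      then show ?case using elim by (auto simp: abs_mult intro!: mult_mono order_trans[OF abs_ge_zero])
    qed
    show "(\<lambda>z. f z * g z) \<in> borel_measurable (lebesgue_on (ball 0 1))"
      using f(1) gm by measurable
  qed
qed

lemma radial_cutoff_derivative:
  fixes z e :: "'a::euclidean_space"
  assumes s: "\<And>t. (s has_real_derivative s' t) (at t)"
  shows "((\<lambda>z. s ((c - 1) + (- c) * (z \<bullet> z))) has_derivative (\<lambda>v. (- 2 * c * (z \<bullet> v)) * s' ((c - 1) + (- c) * (z \<bullet> z)))) (at z)"
proof -
  have "((\<lambda>z. (c - 1) + (- c) * (z \<bullet> z)) has_derivative (\<lambda>v. - 2 * c * (z \<bullet> v))) (at z)"
    by (auto intro!: derivative_eq_intros simp: inner_commute)
  from has_derivative_compose[OF this s[unfolded has_field_derivative_def]]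
  show ?thesis by (simp add: mult.commute)
qed

text \<open>Bernoulli's inequality bounds 1 - (1 - 2/c)^d by 2d/c; the assumption c \<ge> 2 keeps
  the inner radius nonnegative.\<close>

lemma shell_measure:
  assumes "c \<ge> 2"
  shows "measure lebesgue (ball (0::'a::euclidean_space) 1 - ball 0 (1 - 2 / c))
    \<le> measure lebesgue (ball (0::'a) 1) * real DIM('a) * (2 / c)"
proof -
  have r: "0 \<le> 1 - 2 / c" "1 - 2 / c \<le> 1" using assms by (auto simp: field_simps)
  let ?V = "measure lebesgue (ball (0::'a) 1)"
  have "measure lebesgue (ball (0::'a) 1 - ball 0 (1 - 2 / c)) = ?V - measure lebesgue (ball (0::'a) (1 - 2 / c))"
    using subset_ball[OF r(2)] by (intro measurable_measure_Diff) auto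
  also have "measure lebesgue (ball (0::'a) (1 - 2 / c)) = (1 - 2 / c) ^ DIM('a) * ?V"
    using content_ball_conv_unit_ball[OF r(1), of "0::'a"] by simp
  finally have "measure lebesgue (ball (0::'a) 1 - ball 0 (1 - 2 / c)) = ?V * (1 - (1 - 2 / c) ^ DIM('a))"
    by (simp add: algebra_simps)
  also have "\<dots> \<le> ?V * (real DIM('a) * (2 / c))"
    using Bernoulli_inequality[of "- (2 / c)" "DIM('a)"] r by (intro mult_left_mono) auto
  finally show ?thesis by (simp add: mult.assoc)
qed

text \<open>
  Cutting a test function off in a shell of width \<open>2 / c\<close> creates gradients of order \<open>c\<close> there, but
  the shell has measure of order \<open>1 / c\<close> and \<open>y - F z\<close> is small on it by uniform continuity.
\<close>

lemma zero_extension_weak_gradient: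
  fixes y :: "real^'d \<Rightarrow> real^'m"
  assumes W1: "W1_infinity (ball 0 1) y G" and yc: "continuous_on (cball 0 1) y"
    and bc: "\<forall>z\<in>sphere 0 1. y z = F *v z" and \<psi>: "\<And>k. Ck_on k UNIV \<psi>"
  shows "(\<integral>z. (if z \<in> ball 0 1 then (y z - F *v z) $ i else 0) * frechet_derivative \<psi> (at z) (axis j 1) \<partial>lebesgue)
    = - (\<integral>z. (if z \<in> ball 0 1 then (G z - F) $ i $ j else 0) * \<psi> z \<partial>lebesgue)"
proof -
  let ?B = "ball (0::real^'d) 1"
  define e where "e = (axis j 1 :: real^'d)"
  have e: "norm e = 1" by (simp add: e_def)
  define u where "u z = (y z - F *v z) $ i" for z
  define V where "V z = (if z \<in> ?B then u z else 0)" for z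
  define q where "q z = (G z - F) $ i $ j" for z
  define P where "P z = (if z \<in> ?B then q z else 0)" for z
  define \<psi>' where "\<psi>' z = frechet_derivative \<psi> (at z) e" for z
  obtain s s' where s: "\<And>k. Ck_on k UNIV s" "\<And>t. (s has_real_derivative s' t) (at t)" "continuous_on UNIV s'"
    "\<And>t. t \<le> 0 \<Longrightarrow> s t = 0" "\<And>t. t \<ge> 1 \<Longrightarrow> s t = 1" "mono s" "\<And>t. s' t \<ge> 0"
    "\<And>t. t \<le> 0 \<or> t \<ge> 1 \<Longrightarrow> s' t = 0"
    using smooth_step by metis
  have s01: "0 \<le> s t" "s t \<le> 1" for t
    using monoD[OF s(6), of "min 0 t" t] monoD[OF s(6), of t "max 1 t"] s(4)[of "min 0 t"] s(5)[of "max 1 t"] by auto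
  obtain B where B: "\<And>t. s' t \<le> B"
  proof -
    obtain B where B: "\<And>t. t \<in> {0..1} \<Longrightarrow> norm (s' t) \<le> B"
      using continuous_bounded_on_compact[OF compact_Icc continuous_on_subset[OF s(3) subset_UNIV]] by metis
    have "s' t \<le> max B 0" for t
    proof (cases "t \<in> {0..1}")
      case True
      then have "norm (s' t) \<le> B" using B by blast
      then show ?thesis by simp
    next
      case False
      then show ?thesis using s(8)[of t] by auto
    qed
    then show thesis by (rule that)
  qed
  have B0: "B \<ge> 0" using s(7)[of 0] B[of 0] by linarith
  have \<psi>c: "continuous_on UNIV \<psi>" using \<psi>[of 0] by simp
  have \<psi>'c: "continuous_on UNIV \<psi>'" unfolding \<psi>'_def using \<psi>[of "Suc 0"] by simp
  have D\<psi>: "(\<psi> has_derivative frechet_derivative \<psi> (at z)) (at z)" for z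
    by (rule Ck_on_has_derivative[OF \<psi>])
  have uc: "continuous_on (cball 0 1) u"
    unfolding u_def by (intro continuous_intros yc linear_continuous_on matrix_vector_mul_bounded_linear)
  have u0: "u z = 0" if "z \<in> sphere 0 1" for z using bc that by (simp add: u_def)
  have um: "u \<in> borel_measurable (lebesgue_on ?B)"
    by (rule continuous_imp_measurable_on_sets_lebesgue) (auto intro: continuous_on_subset[OF uc])
  obtain Mu where Mu: "\<And>z. z \<in> cball 0 1 \<Longrightarrow> norm (u z) \<le> Mu"
    using continuous_bounded_on_compact[OF compact_cball uc] by metis
  have uAE: "AE z in lebesgue_on ?B. \<bar>u z\<bar> \<le> Mu"
    by (rule AE_I2) (use Mu in \<open>auto simp: space_restrict_space\<close>)
  have Gm: "G \<in> borel_measurable (lebesgue_on ?B)" using W1 by (simp add: W1_infinity_def L_infinity_def)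
  have qm: "q \<in> borel_measurable (lebesgue_on ?B)"
  proof -
    have "(\<lambda>X. (X - F) $ i $ j) \<in> borel_measurable borel"
      by (intro borel_measurable_continuous_onI continuous_intros)
    from measurable_compose[OF Gm this] show ?thesis by (simp add: q_def[abs_def])
  qed
  obtain C where C: "AE z in lebesgue_on ?B. \<bar>q z\<bar> \<le> C"
  proof -
    obtain C where "AE z in lebesgue_on ?B. norm (G z) \<le> C"
      using W1 by (auto simp: W1_infinity_def L_infinity_def)
    then have "AE z in lebesgue_on ?B. \<bar>q z\<bar> \<le> C + norm F"
    proof eventually_elim
      case (elim z)
      have "\<bar>q z\<bar> \<le> norm (G z - F)"
        unfolding q_def by (rule order_trans[OF component_le_norm_cart Finite_Cartesian_Product.norm_nth_le])
      also have "\<dots> \<le> norm (G z) + norm F" by (rule norm_triangle_ineq4)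
      finally show ?case using elim by simp
    qed
    then show thesis by (rule that)
  qed
  have to_UNIV: "integrable lebesgue (\<lambda>z. (if z \<in> ?B then f z else 0) * g z)"
      "(\<integral>z. f z * g z \<partial>lebesgue_on ?B) = (\<integral>z. (if z \<in> ?B then f z else 0) * g z \<partial>lebesgue)"
    if "integrable (lebesgue_on ?B) (\<lambda>z. f z * g z)" for f g :: "real^'d \<Rightarrow> real"
  proof -
    have eq: "(\<lambda>z. (if z \<in> ?B then f z else 0) * g z) = (\<lambda>z. indicator ?B z *\<^sub>R (f z * g z))"
      by (auto simp: indicator_def)
    show "integrable lebesgue (\<lambda>z. (if z \<in> ?B then f z else 0) * g z)"
      unfolding eq using that integrable_restrict_space[of ?B lebesgue "\<lambda>z. f z * g z"] by simp
    show "(\<integral>z. f z * g z \<partial>lebesgue_on ?B) = (\<integral>z. (if z \<in> ?B then f z else 0) * g z \<partial>lebesgue)"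
      unfolding eq using integral_restrict_space[of ?B lebesgue "\<lambda>z. f z * g z"] by simp
  qed
  have V_int: "integrable lebesgue (\<lambda>z. V z * g z)" if "continuous_on UNIV g" for g
    unfolding V_def by (rule to_UNIV(1)[OF integrable_mult_continuous[OF um uAE that]])
  have P_int: "integrable lebesgue (\<lambda>z. P z * g z)" if "continuous_on UNIV g" for g
    unfolding P_def by (rule to_UNIV(1)[OF integrable_mult_continuous[OF qm C that]])
  \<comment> \<open>For test functions of the ball the claim is the weak gradient identity of y
    minus that of the affine map. What remains is to admit a \<psi> that does not vanish at the
    sphere.\<close>
  have weak: "(\<integral>z. V z * frechet_derivative \<theta> (at z) e \<partial>lebesgue) = - (\<integral>z. P z * \<theta> z \<partial>lebesgue)"
    if \<theta>: "\<theta> \<in> test_functions ?B" for \<theta>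
  proof -
    let ?\<theta>' = "\<lambda>z. frechet_derivative \<theta> (at z) e"
    have \<theta>c: "continuous_on UNIV \<theta>" "continuous_on UNIV ?\<theta>'"
      using test_functionD(1)[OF \<theta>, of 0] test_functionD(5)[OF \<theta>] by simp_all
    let ?l = "\<lambda>z. (F *v z) $ i"
    have lc: "continuous_on UNIV ?l"
      by (intro continuous_intros linear_continuous_on matrix_vector_mul_bounded_linear)
    have lm: "?l \<in> borel_measurable (lebesgue_on ?B)"
      using lebesgue_measurable_continuous[OF lc] by (rule measurable_restrict_space1)
    obtain Ml where Ml: "AE z in lebesgue_on ?B. \<bar>?l z\<bar> \<le> Ml"
    proof -
      have "\<bar>?l z\<bar> \<le> onorm ((*v) F) * 1" if "z \<in> ?B" for z
      proof -
        have "\<bar>?l z\<bar> \<le> norm (F *v z)" by (rule component_le_norm_cart)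
        also have "\<dots> \<le> onorm ((*v) F) * norm z" using matrix_vector_lipschitz[of F z 0] by simp
        also have "\<dots> \<le> onorm ((*v) F) * 1"
          using that by (intro mult_left_mono onorm_pos_le matrix_vector_mul_bounded_linear) auto
        finally show ?thesis .
      qed
      then show thesis by (intro that AE_I2) (auto simp: space_restrict_space)
    qed
    have int_u: "integrable (lebesgue_on ?B) (\<lambda>z. u z * ?\<theta>' z)"
      by (rule integrable_mult_continuous[OF um uAE \<theta>c(2)])
    have int_l: "integrable (lebesgue_on ?B) (\<lambda>z. ?l z * ?\<theta>' z)"
      by (rule integrable_mult_continuous[OF lm Ml \<theta>c(2)])
    have int_q: "integrable (lebesgue_on ?B) (\<lambda>z. q z * \<theta> z)"
      by (rule integrable_mult_continuous[OF qm C \<theta>c(1)])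
    have int_F: "integrable (lebesgue_on ?B) (\<lambda>z. F $ i $ j * \<theta> z)"
      by (rule integrable_mult_continuous[OF _ _ \<theta>c(1)]) auto
    have "W1_infinity ?B (\<lambda>z. F *v z) (\<lambda>_. F)" by (rule W1_infinity_linear) auto
    then have 1: "(\<integral>z. ?l z * ?\<theta>' z \<partial>lebesgue_on ?B) = - (\<integral>z. F $ i $ j * \<theta> z \<partial>lebesgue_on ?B)"
      using \<theta> unfolding W1_infinity_def weak_gradient_on_def e_def by blast
    have 2: "(\<integral>z. y z $ i * ?\<theta>' z \<partial>lebesgue_on ?B) = - (\<integral>z. G z $ i $ j * \<theta> z \<partial>lebesgue_on ?B)"
      using W1 \<theta> unfolding W1_infinity_def weak_gradient_on_def e_def by blast
    have "(\<integral>z. y z $ i * ?\<theta>' z \<partial>lebesgue_on ?B) = (\<integral>z. u z * ?\<theta>' z + ?l z * ?\<theta>' z \<partial>lebesgue_on ?B)"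
      by (intro Bochner_Integration.integral_cong) (auto simp: u_def algebra_simps)
    also have "\<dots> = (\<integral>z. u z * ?\<theta>' z \<partial>lebesgue_on ?B) + (\<integral>z. ?l z * ?\<theta>' z \<partial>lebesgue_on ?B)"
      by (rule Bochner_Integration.integral_add[OF int_u int_l])
    finally have 3: "(\<integral>z. y z $ i * ?\<theta>' z \<partial>lebesgue_on ?B) = \<dots>" .
    have "(\<integral>z. G z $ i $ j * \<theta> z \<partial>lebesgue_on ?B) = (\<integral>z. q z * \<theta> z + F $ i $ j * \<theta> z \<partial>lebesgue_on ?B)"
      by (intro Bochner_Integration.integral_cong) (auto simp: q_def algebra_simps)
    also have "\<dots> = (\<integral>z. q z * \<theta> z \<partial>lebesgue_on ?B) + (\<integral>z. F $ i $ j * \<theta> z \<partial>lebesgue_on ?B)"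
      by (rule Bochner_Integration.integral_add[OF int_q int_F])
    finally have "(\<integral>z. u z * ?\<theta>' z \<partial>lebesgue_on ?B) = - (\<integral>z. q z * \<theta> z \<partial>lebesgue_on ?B)"
      using 1 2 3 by linarith
    then show ?thesis
      unfolding to_UNIV(2)[OF int_u] to_UNIV(2)[OF int_q] V_def P_def .
  qed
  define c where "c k = real k + 2" for k :: nat
  have c: "c k \<ge> 2" for k by (simp add: c_def)
  \<comment> \<open>With c = c k, this is at least 1 for |z|^2 \<le> 1 - 2/c and at most 0 for |z|^2
    \<ge> 1 - 1/c. The cutoff is thus 1 on the inner region and has compact support in the open
    ball.\<close>
  define arg where "arg k z = (c k - 1) + (- c k) * (z \<bullet> z)" for k and z :: "real^'d"
  define cut where "cut k z = s (arg k z)" for k z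
  define dcut where "dcut k z = (- 2 * c k * (z \<bullet> e)) * s' (arg k z)" for k z
  have cut_smooth: "Ck_on l UNIV (cut k)" for l k
    unfolding cut_def[abs_def] arg_def
    by (rule Ck_on_real_compose[OF s(1) Ck_on_add[OF Ck_on_const Ck_on_mult[OF Ck_on_const Ck_on_norm_square]]])
  have cut_cont: "continuous_on UNIV (cut k)" for k using cut_smooth[of 0 k] by simp
  have dcut_cont: "continuous_on UNIV (dcut k)" for k
    unfolding dcut_def arg_def by (intro continuous_intros continuous_on_compose2[OF s(3)]) auto
  have test: "(\<lambda>z. cut k z * \<psi> z) \<in> test_functions ?B" for k
  proof (rule test_functionsI)
    show "Ck_on l UNIV (\<lambda>z. cut k z * \<psi> z)" for l by (intro Ck_on_mult cut_smooth \<psi>)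
    let ?K = "{z::real^'d. 0 \<le> arg k z}"
    show sub: "?K \<subseteq> ?B"
    proof
      fix z assume "z \<in> ?K"
      then have "c k * (z \<bullet> z) < c k * 1" by (simp add: arg_def)
      then have "z \<bullet> z < 1" using c[of k] by (subst (asm) mult_less_cancel_left_pos) auto
      then show "z \<in> ?B" by (simp add: norm_lt_square[of z 1] flip: power2_norm_eq_inner)
    qed
    show "compact ?K"
      unfolding compact_eq_bounded_closed using bounded_subset[OF bounded_ball sub]
      by (auto simp: arg_def intro!: closed_Collect_le continuous_intros)
    show "cut k z * \<psi> z = 0" if "z \<notin> ?K" for z using s(4)[of "arg k z"] that by (simp add: cut_def)
  qed
  have prod: "frechet_derivative (\<lambda>z. cut k z * \<psi> z) (at z) e = cut k z * \<psi>' z + dcut k z * \<psi> z" for k z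
  proof -
    have "(cut k has_derivative (\<lambda>v. (- 2 * c k * (z \<bullet> v)) * s' (arg k z))) (at z)"
      unfolding cut_def[abs_def] arg_def by (rule radial_cutoff_derivative[OF s(2)])
    from frechet_derivative_at[OF has_derivative_mult[OF this D\<psi>[of z]]]
    show ?thesis by (simp add: \<psi>'_def dcut_def fun_eq_iff)
  qed
  have split: "(\<integral>z. V z * (cut k z * \<psi>' z) \<partial>lebesgue) + (\<integral>z. V z * (dcut k z * \<psi> z) \<partial>lebesgue)
      = - (\<integral>z. P z * (cut k z * \<psi> z) \<partial>lebesgue)" for k
  proof -
    have "(\<integral>z. V z * (cut k z * \<psi>' z) \<partial>lebesgue) + (\<integral>z. V z * (dcut k z * \<psi> z) \<partial>lebesgue)
        = (\<integral>z. V z * (cut k z * \<psi>' z) + V z * (dcut k z * \<psi> z) \<partial>lebesgue)"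
      by (rule Bochner_Integration.integral_add[symmetric])
        (intro V_int continuous_on_mult cut_cont dcut_cont \<psi>c \<psi>'c)+
    also have "\<dots> = (\<integral>z. V z * frechet_derivative (\<lambda>z. cut k z * \<psi> z) (at z) e \<partial>lebesgue)"
      by (simp only: prod distrib_left)
    also have "\<dots> = - (\<integral>z. P z * (cut k z * \<psi> z) \<partial>lebesgue)" by (rule weak[OF test])
    finally show ?thesis .
  qed
  have cut_one: "(\<lambda>k. cut k z) \<longlonglongrightarrow> 1" if "z \<in> ?B" for z
  proof (rule tendsto_eventually)
    have "z \<bullet> z < 1" using that by (simp add: norm_lt_square[of z 1] flip: power2_norm_eq_inner)
    then have pos: "1 - z \<bullet> z > 0" by simp
    obtain K :: nat where K: "real K \<ge> 2 / (1 - z \<bullet> z)" using real_arch_simple by blast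
    have "cut k z = 1" if "k \<ge> K" for k
    proof -
      have "2 / (1 - z \<bullet> z) \<le> c k" using K that by (simp add: c_def)
      then have "2 \<le> c k * (1 - z \<bullet> z)" using pos by (simp add: field_simps)
      then show ?thesis unfolding cut_def by (intro s(5)) (simp add: arg_def algebra_simps)
    qed
    then show "\<forall>\<^sub>F k in sequentially. cut k z = 1" unfolding eventually_sequentially by blast
  qed
  have cut_lim: "(\<lambda>k. \<integral>z. f z * (cut k z * g z) \<partial>lebesgue) \<longlonglongrightarrow> (\<integral>z. f z * g z \<partial>lebesgue)"
    if int: "\<And>g. continuous_on UNIV g \<Longrightarrow> integrable lebesgue (\<lambda>z. f z * g z)"
      and off: "\<And>z. z \<notin> ?B \<Longrightarrow> f z = 0" and g: "continuous_on UNIV g" for f g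
  proof (rule integral_dominated_convergence[OF _ _ integrable_norm[OF int[OF g]]])
    show "(\<lambda>z. f z * g z) \<in> borel_measurable lebesgue"
      "(\<lambda>z. f z * (cut k z * g z)) \<in> borel_measurable lebesgue" for k
      by (intro borel_measurable_integrable int g continuous_on_mult cut_cont)+
    show "AE z in lebesgue. (\<lambda>k. f z * (cut k z * g z)) \<longlonglongrightarrow> f z * g z"
    proof (rule AE_I2)
      fix z
      show "(\<lambda>k. f z * (cut k z * g z)) \<longlonglongrightarrow> f z * g z"
      proof (cases "z \<in> ?B")
        case True
        from tendsto_mult[OF tendsto_const tendsto_mult[OF cut_one[OF True] tendsto_const], of "f z" "g z"]
        show ?thesis by simp
      qed (simp add: off)
    qed
    show "AE z in lebesgue. norm (f z * (cut k z * g z)) \<le> norm (f z * g z)" for k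
    proof (rule AE_I2)
      fix z
      have "cut k z * (\<bar>f z\<bar> * \<bar>g z\<bar>) \<le> 1 * (\<bar>f z\<bar> * \<bar>g z\<bar>)"
        unfolding cut_def by (intro mult_right_mono s01) auto
      then show "norm (f z * (cut k z * g z)) \<le> norm (f z * g z)"
        using s01[of "arg k z"] by (simp add: abs_mult mult_ac cut_def)
    qed
  qed
  obtain M where M0: "M \<ge> 0" and "\<And>z. z \<in> cball 0 1 \<Longrightarrow> norm (\<psi> z) \<le> M"
    using continuous_bounded_on_compact[OF compact_cball continuous_on_subset[OF \<psi>c subset_UNIV]] by metis
  then have M: "M \<ge> 0" "\<And>z. z \<in> ?B \<Longrightarrow> \<bar>\<psi> z\<bar> \<le> M" by auto
  \<comment> \<open>Collects the factors of the shell estimate: the gradient bound 2 c B, the bound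
    M for \<psi>, and the shell measure with its factor 2/c, in which c cancels.\<close>
  define T where "T = 4 * B * M * measure lebesgue ?B * real DIM(real^'d)"
  have T0: "T \<ge> 0" using B0 M(1) by (simp add: T_def)
  have shell_lim: "(\<lambda>k. \<integral>z. V z * (dcut k z * \<psi> z) \<partial>lebesgue) \<longlonglongrightarrow> 0"
  proof (rule LIMSEQ_I)
    fix r :: real assume r: "r > 0"
    define \<eta> where "\<eta> = r / (T + 1)"
    have \<eta>: "\<eta> > 0" using r T0 by (simp add: \<eta>_def)
    have "uniformly_continuous_on (cball 0 1) u"
      by (rule compact_uniformly_continuous[OF uc compact_cball])
    then obtain \<delta> where \<delta>: "\<delta> > 0" "\<And>p q. p \<in> cball 0 1 \<Longrightarrow> q \<in> cball 0 1 \<Longrightarrow> dist q p < \<delta> \<Longrightarrow> dist (u q) (u p) < \<eta>"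
      using \<eta> unfolding uniformly_continuous_on_def by metis
    have near: "\<bar>u z\<bar> \<le> \<eta>" if z: "z \<in> ?B" "1 - norm z < \<delta>" "z \<noteq> 0" for z
    proof -
      \<comment> \<open>The radial projection to the sphere, where u vanishes by the boundary
        condition; its distance from z is 1 - |z|.\<close>
      let ?p = "(1 / norm z) *\<^sub>R z"
      have "z - ?p = (1 - 1 / norm z) *\<^sub>R z" by (simp add: algebra_simps)
      then have "norm (z - ?p) = \<bar>1 - 1 / norm z\<bar> * norm z" by simp
      also have "\<dots> = 1 - norm z" using z by (simp add: abs_if field_simps)
      finally have "dist z ?p < \<delta>" using z by (simp add: dist_norm)
      then have "dist (u z) (u ?p) < \<eta>" using \<delta>(2)[of ?p z] z by simp
      moreover have "u ?p = 0" using z(3) by (intro u0) simp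
      ultimately show ?thesis by (simp add: dist_norm)
    qed
    obtain K :: nat where K: "real K \<ge> 2 / \<delta>" using real_arch_simple by blast
    have "\<bar>\<integral>z. V z * (dcut k z * \<psi> z) \<partial>lebesgue\<bar> < r" if k: "k \<ge> K" for k
    proof -
      let ?S = "?B - ball 0 (1 - 2 / c k)"
      have "2 / \<delta> < c k" using K k by (simp add: c_def)
      then have ck: "2 / c k < \<delta>" using \<delta>(1) c[of k] by (simp add: field_simps)
      let ?b = "\<eta> * ((2 * c k * B) * M)"
      have bound: "norm (V z * (dcut k z * \<psi> z)) \<le> ?b * indicator ?S z" for z
      proof (cases "z \<in> ?B")
        case z: True
        show ?thesis
        proof (cases "dcut k z = 0")
          case True
          have "0 \<le> ?b * indicator ?S z" using \<eta> c[of k] B0 M(1) by simp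
          then show ?thesis using True by simp
        next
          case False
          then have "s' (arg k z) \<noteq> 0" "z \<noteq> 0" by (auto simp: dcut_def)
          then have "arg k z < 1" using s(8)[of "arg k z"] by force
          then have "c k * (1 - z \<bullet> z) < 2" by (simp add: arg_def algebra_simps)
          then have "1 - z \<bullet> z < 2 / c k" using c[of k] by (simp add: field_simps)
          \<comment> \<open>In the unit ball 1 - |z| \<le> 1 - |z|^2, so a bound for the argument of
            the step function places z in the shell of width 2/c.\<close>
          moreover have "z \<bullet> z \<le> norm z"
            using z mult_left_le[of "norm z" "norm z"] by (simp add: power2_norm_eq_inner[symmetric] power2_eq_square)
          ultimately have nz: "1 - 2 / c k < norm z" by linarith
          then have S: "z \<in> ?S" using z by simp
          have "1 - norm z < \<delta>" using nz ck by linarith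
          then have Vz: "\<bar>V z\<bar> \<le> \<eta>" using near[OF z _ \<open>z \<noteq> 0\<close>] z by (simp add: V_def)
          have "\<bar>z \<bullet> e\<bar> \<le> 1" using Cauchy_Schwarz_ineq2[of z e] e z by simp
          then have "\<bar>dcut k z\<bar> \<le> 2 * c k * 1 * B"
            unfolding dcut_def abs_mult using c[of k] B[of "arg k z"] s(7)[of "arg k z"]
            by (intro mult_mono) auto
          then have "\<bar>dcut k z\<bar> \<le> 2 * c k * B" by simp
          then have "\<bar>V z\<bar> * (\<bar>dcut k z\<bar> * \<bar>\<psi> z\<bar>) \<le> ?b"
            using Vz M z \<eta> B0 c[of k] by (intro mult_mono) auto
          then show ?thesis using S by (simp add: abs_mult)
        qed
      next
        case False
        then show ?thesis by (simp add: V_def)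
      qed
      have Sm: "?S \<in> lmeasurable" by (rule fmeasurable.Diff) auto
      have "\<bar>\<integral>z. V z * (dcut k z * \<psi> z) \<partial>lebesgue\<bar> \<le> (\<integral>z. ?b * indicator ?S z \<partial>lebesgue)"
        unfolding real_norm_def[symmetric]
      proof (rule Bochner_Integration.integral_norm_bound_integral)
        show "integrable lebesgue (\<lambda>z. V z * (dcut k z * \<psi> z))" by (intro V_int continuous_on_mult dcut_cont \<psi>c)
        show "integrable lebesgue (\<lambda>z. ?b * indicator ?S z)"
          using Sm by (intro integrable_mult_right integrable_real_indicator) (auto simp: fmeasurable_def)
      qed (rule bound)
      also have "\<dots> = ?b * measure lebesgue ?S" using Sm by (simp add: fmeasurableD)
      also have "\<dots> \<le> ?b * (measure lebesgue ?B * real DIM(real^'d) * (2 / c k))"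
        using shell_measure[where 'a = "real^'d", OF c[of k]] \<eta> c[of k] B0 M(1) by (intro mult_left_mono) auto
      also have "\<dots> = \<eta> * T" using c[of k] by (simp add: T_def)
      also have "\<dots> < r" using r T0 by (simp add: \<eta>_def field_simps)
      finally show ?thesis .
    qed
    then show "\<exists>K. \<forall>k\<ge>K. norm ((\<integral>z. V z * (dcut k z * \<psi> z) \<partial>lebesgue) - 0) < r" by auto
  qed
  have "(\<lambda>k. (\<integral>z. V z * (cut k z * \<psi>' z) \<partial>lebesgue) + (\<integral>z. V z * (dcut k z * \<psi> z) \<partial>lebesgue))
      \<longlonglongrightarrow> (\<integral>z. V z * \<psi>' z \<partial>lebesgue) + 0"
    by (intro tendsto_add shell_lim cut_lim V_int \<psi>'c) (simp_all add: V_def)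
  moreover have "(\<lambda>k. - (\<integral>z. P z * (cut k z * \<psi> z) \<partial>lebesgue)) \<longlonglongrightarrow> - (\<integral>z. P z * \<psi> z \<partial>lebesgue)"
    by (intro tendsto_minus cut_lim P_int \<psi>c) (simp_all add: P_def)
  ultimately have "(\<integral>z. V z * \<psi>' z \<partial>lebesgue) + 0 = - (\<integral>z. P z * \<psi> z \<partial>lebesgue)"
    unfolding split by (rule LIMSEQ_unique)
  then show ?thesis unfolding V_def P_def u_def q_def \<psi>'_def e_def by simp
qed

text \<open>Differentiation falls on the mollifier, and z -> \<rho>(x - z) takes the role of the
  test function. Its support may leave the ball when x is near the sphere, hence the need for the
  integration by parts of the zero extension against arbitrary smooth functions.\<close>

lemma convolve_gradient:
  fixes y :: "real^'d \<Rightarrow> real^'m"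
  assumes W1: "W1_infinity (ball 0 1) y G" and yc: "continuous_on (cball 0 1) y"
    and bc: "\<forall>z\<in>sphere 0 1. y z = F *v z"
    and v: "bounded_unit_ball_function (\<lambda>z. if z \<in> ball 0 1 then y z - F *v z else 0) Cv"
    and H: "bounded_unit_ball_function H CH"
    and HG: "AE z in lebesgue. H z = (if z \<in> ball 0 1 then G z - F else 0)"
    and \<rho>: "mollifier \<rho> r"
  shows "jacobian (convolve \<rho> (\<lambda>z. if z \<in> ball 0 1 then y z - F *v z else 0)) (at x) = convolve \<rho> H x"
proof -
  let ?v = "\<lambda>z. if z \<in> ball 0 1 then y z - F *v z else 0"
  interpret mollifier \<rho> r by fact
  interpret v: bounded_unit_ball_function ?v Cv by fact
  interpret H: bounded_unit_ball_function H CH by fact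
  have D: "(convolve \<rho> ?v has_derivative (\<lambda>h. convolve (\<lambda>p. frechet_derivative \<rho> (at p) h) ?v x)) (at x)"
    by (rule v.convolve_has_derivative[OF smooth])
  have jac: "jacobian (convolve \<rho> ?v) (at x) *v h = convolve (\<lambda>p. frechet_derivative \<rho> (at p) h) ?v x" for h
  proof -
    have "(convolve \<rho> ?v has_derivative (\<lambda>h. jacobian (convolve \<rho> ?v) (at x) *v h)) (at x)"
      using D by (intro has_derivative_jacobian) (auto simp: differentiable_def)
    from has_derivative_unique[OF this D] show ?thesis by metis
  qed
  have D\<rho>c: "continuous_on UNIV (\<lambda>p. frechet_derivative \<rho> (at p) h)" for h
    using smooth[of "Suc 0"] by simp
  have "jacobian (convolve \<rho> ?v) (at x) $ i $ j = convolve \<rho> H x $ i $ j" for i j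
  proof -
    let ?e = "axis j 1 :: real^'d"
    let ?\<psi> = "\<lambda>z. \<rho> (x - z)"
    have \<psi>: "Ck_on k UNIV ?\<psi>" for k
      using Ck_on_affine_compose[OF bounded_linear_minus[OF bounded_linear_ident] smooth, of k x]
      by (simp add: algebra_simps)
    have D\<psi>: "frechet_derivative ?\<psi> (at z) ?e = - frechet_derivative \<rho> (at (x - z)) ?e" for z
    proof -
      have "((\<lambda>z. x - z) has_derivative (\<lambda>h. - h)) (at z)" by (auto intro!: derivative_eq_intros)
      from has_derivative_compose[OF this Ck_on_has_derivative[OF smooth]]
      have "(?\<psi> has_derivative (\<lambda>h. frechet_derivative \<rho> (at (x - z)) (- h))) (at z)" .
      then have "frechet_derivative ?\<psi> (at z) ?e = frechet_derivative \<rho> (at (x - z)) (- ?e)"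
        by (metis frechet_derivative_at)
      then show ?thesis
        using linear_neg[OF has_derivative_linear[OF Ck_on_has_derivative[OF smooth]], of "x - z" ?e] by simp
    qed
    have "jacobian (convolve \<rho> ?v) (at x) $ i $ j = convolve (\<lambda>p. frechet_derivative \<rho> (at p) ?e) ?v x $ i"
      unfolding jac[of ?e, symmetric] matrix_vector_mult_axis column_def by simp
    also have "\<dots> = (\<integral>z. (frechet_derivative \<rho> (at (x - z)) ?e *\<^sub>R ?v z) $ i \<partial>lebesgue)"
      unfolding convolve_def
      by (rule integral_bounded_linear[OF bounded_linear_vec_nth v.convolve_integrable[OF D\<rho>c], symmetric])
    also have "\<dots> = (\<integral>z. - ((if z \<in> ball 0 1 then (y z - F *v z) $ i else 0) * frechet_derivative ?\<psi> (at z) ?e) \<partial>lebesgue)"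
      by (intro Bochner_Integration.integral_cong) (auto simp: D\<psi>)
    also have "\<dots> = (\<integral>z. (if z \<in> ball 0 1 then (G z - F) $ i $ j else 0) * ?\<psi> z \<partial>lebesgue)"
      using zero_extension_weak_gradient[OF W1 yc bc \<psi>, of i j] by simp
    also have "\<dots> = (\<integral>z. (\<rho> (x - z) *\<^sub>R H z) $ i $ j \<partial>lebesgue)"
    proof -
      have int: "integrable lebesgue (\<lambda>z. (\<rho> (x - z) *\<^sub>R H z) $ i $ j)"
        by (intro integrable_bounded_linear[OF bounded_linear_vec_nth] H.convolve_integrable[OF continuous])
      have AE: "AE z in lebesgue. (if z \<in> ball 0 1 then (G z - F) $ i $ j else 0) * ?\<psi> z = (\<rho> (x - z) *\<^sub>R H z) $ i $ j"
        using HG by eventually_elim auto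
      have m: "(\<lambda>z. (if z \<in> ball 0 1 then (G z - F) $ i $ j else 0) * ?\<psi> z) \<in> borel_measurable lebesgue"
        by (rule borel_measurable_AE[OF borel_measurable_integrable[OF int]])
          (use AE in \<open>auto elim!: eventually_mono\<close>)
      show ?thesis by (rule integral_cong_AE[OF m borel_measurable_integrable[OF int] AE])
    qed
    also have "\<dots> = convolve \<rho> H x $ i $ j"
    proof -
      have int: "integrable lebesgue (\<lambda>z. \<rho> (x - z) *\<^sub>R H z)" by (rule H.convolve_integrable[OF continuous])
      show ?thesis
        unfolding convolve_def
        by (simp only: integral_bounded_linear[OF bounded_linear_vec_nth int, symmetric]
            integral_bounded_linear[OF bounded_linear_vec_nth integrable_bounded_linear[OF bounded_linear_vec_nth int], symmetric])
    qed
    finally show ?thesis .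
  qed
  then show ?thesis by (simp add: vec_eq_iff)
qed

text \<open>The zero extension of y - F z is mollified. Its gradients stay bounded and converge
  almost everywhere, so the energies converge. Each mollified function is scaled down and translated
  into the given ball, which does not change the values of its gradient; the inequality is
  insensitive to the resulting volume factor.\<close>

lemma quasiconvex_at_of_test_functions:
  fixes W :: "real^'d^'m \<Rightarrow> real"
  assumes W: "continuous_on UNIV W" "bdd_below (range W)" and r0: "r0 > 0"
    and test: "\<And>\<phi> :: real^'d \<Rightarrow> real^'m. \<phi> \<in> test_functions (ball c r0) \<Longrightarrow>
      0 \<le> (\<integral>z. W (F + jacobian \<phi> (at z)) - W F \<partial>lebesgue)"
  shows "quasiconvex_envelope W F = W F"
  unfolding quasiconvex_envelope_eq_iff[OF W]
proof (intro allI impI, elim conjE)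
  fix y :: "real^'d \<Rightarrow> real^'m" and G
  assume W1: "W1_infinity (ball 0 1) y G" and yc: "continuous_on (cball 0 1) y"
    and bc: "\<forall>z\<in>sphere 0 1. y z = F *v z"
  let ?B = "ball (0::real^'d) 1"
  define v where "v z = (if z \<in> ball 0 1 then y z - F *v z else 0)" for z
  have GL: "G \<in> L_infinity ?B" using W1 by (simp add: W1_infinity_def)
  then have Gm: "G \<in> borel_measurable (lebesgue_on ?B)" by (simp add: L_infinity_def)
  obtain C0 where "AE z in lebesgue_on ?B. norm (G z) \<le> C0" using GL by (auto simp: L_infinity_def)
  then have GC: "AE z in lebesgue. z \<in> ?B \<longrightarrow> norm (G z) \<le> C0" by (simp add: AE_restrict_space_iff)
  define C where "C = \<bar>C0\<bar> + norm F"
  define H0 where "H0 z = (if z \<in> ?B then G z - F else 0)" for z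
  \<comment> \<open>A representative of the extended gradient that is bounded everywhere: on the
    null set where the essential bound fails it is set to zero.\<close>
  define H where "H z = (if norm (H0 z) \<le> C then H0 z else 0)" for z
  have H0m: "H0 \<in> borel_measurable lebesgue"
    unfolding H0_def using Gm by (intro borel_measurable_if_I borel_measurable_diff) auto
  have HH0: "AE z in lebesgue. H z = H0 z"
    using GC
  proof eventually_elim
    case (elim z)
    have "norm (H0 z) \<le> C"
    proof (cases "z \<in> ?B")
      case True
      then have "norm (G z - F) \<le> C"
        using elim norm_triangle_ineq4[of "G z" F] unfolding C_def by linarith
      then show ?thesis using True by (simp add: H0_def)
    qed (simp add: H0_def C_def)
    then show ?case by (simp add: H_def)
  qed
  have H: "bounded_unit_ball_function H C"
  proof
    show "H \<in> borel_measurable lebesgue" unfolding H_def using H0m by measurable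
    show "norm (H z) \<le> C * indicator (ball 0 1) z" for z
      by (auto simp: H_def H0_def C_def)
  qed
  have HG: "AE z in lebesgue. H z = (if z \<in> ball 0 1 then G z - F else 0)"
    using HH0 unfolding H0_def .
  have vc: "continuous_on (cball 0 1) (\<lambda>z. y z - F *v z)"
    by (intro continuous_intros yc linear_continuous_on matrix_vector_mul_bounded_linear)
  obtain Cv where v: "bounded_unit_ball_function v Cv"
  proof -
    obtain Cv where Cv: "\<And>z. z \<in> cball 0 1 \<Longrightarrow> norm (y z - F *v z) \<le> Cv"
      using continuous_bounded_on_compact[OF compact_cball vc] by metis
    have "bounded_unit_ball_function v Cv"
    proof
      have "(\<lambda>z. y z - F *v z) \<in> borel_measurable (lebesgue_on ?B)"
        by (rule continuous_imp_measurable_on_sets_lebesgue) (auto intro: continuous_on_subset[OF vc])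
      then show "v \<in> borel_measurable lebesgue" unfolding v_def by (rule borel_measurable_if_I) simp
      show "norm (v z) \<le> Cv * indicator (ball 0 1) z" for z using Cv by (auto simp: v_def)
    qed
    then show thesis by (rule that)
  qed
  interpret v: bounded_unit_ball_function v Cv by fact
  interpret H: bounded_unit_ball_function H C by fact
  obtain \<rho> :: "nat \<Rightarrow> real^'d \<Rightarrow> real" and r where \<rho>: "\<And>k. mollifier (\<rho> k) (r k)"
    and lim: "AE x in lebesgue. (\<lambda>k. convolve (\<rho> k) H x) \<longlonglongrightarrow> H x"
    by (rule mollification_AE[OF H]) (rule that, assumption+)
  have jac: "jacobian (convolve (\<rho> k) v) (at x) = convolve (\<rho> k) H x" for k x
    using convolve_gradient[OF W1 yc bc v[unfolded v_def] H HG \<rho>] unfolding v_def by simp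
  define f where "f k x = W (F + convolve (\<rho> k) H x) - W F" for k x
  have conv_c: "continuous_on UNIV (convolve (\<rho> k) H)" for k
    by (rule H.convolve_continuous[OF mollifier.continuous[OF \<rho>]])
  have fc: "continuous_on UNIV (f k)" for k
    unfolding f_def by (intro continuous_intros continuous_on_compose2[OF W(1)] conv_c) auto
  have nonneg: "0 \<le> (\<integral>x. f k x \<partial>lebesgue)" for k
  proof -
    \<comment> \<open>Mollified functions vanish outside radius 2, so scaling by r0/4 leaves a
      support of radius r0/2, compactly inside the open ball.\<close>
    define t where "t = r0 / 4"
    have t: "t > 0" "t \<noteq> 0" using r0 by (auto simp: t_def)
    define w where "w = convolve (\<rho> k) v"
    have wsm: "Ck_on l UNIV w" for l
      unfolding w_def by (rule v.Ck_on_convolve) (rule mollifier.smooth[OF \<rho>])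
    define b where "b = - ((1 / t) *\<^sub>R c)"
    define \<phi> where "\<phi> z = t *\<^sub>R w ((1 / t) *\<^sub>R z + b)" for z
    have arg: "(1 / t) *\<^sub>R z + b = (1 / t) *\<^sub>R (z - c)" for z by (simp add: b_def scaleR_diff_right)
    have "\<phi> \<in> test_functions (ball c r0)"
    proof (rule test_functionsI)
      show "Ck_on l UNIV \<phi>" for l
        unfolding \<phi>_def
        by (rule Ck_on_linear_compose[OF bounded_linear_scaleR_right Ck_on_affine_compose[OF bounded_linear_scaleR_right wsm]])
      show "compact (cball c (2 * t))" by (rule compact_cball)
      show "cball c (2 * t) \<subseteq> ball c r0" using r0 by (auto simp: t_def)
      show "\<phi> z = 0" if "z \<notin> cball c (2 * t)" for z
      proof -
        have "norm (z - c) > 2 * t" using that by (simp add: dist_norm norm_minus_commute)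
        then have "\<bar>1 / t\<bar> * norm (z - c) \<ge> 2" using t by (simp add: field_simps)
        then have "norm ((1 / t) *\<^sub>R (z - c)) \<ge> 2" by (simp only: norm_scaleR)
        then have "norm ((1 / t) *\<^sub>R z + b) \<ge> 1 + r k"
          unfolding arg using mollifier.r(2)[OF \<rho>, of k] by linarith
        then show ?thesis
          unfolding \<phi>_def w_def using mollifier.convolve_support[OF \<rho> v] by simp
      qed
    qed
    from test[OF this] have "0 \<le> (\<integral>z. W (F + jacobian \<phi> (at z)) - W F \<partial>lebesgue)" .
    also have "(\<lambda>z. W (F + jacobian \<phi> (at z)) - W F) = (\<lambda>z. f k (b + (1 / t) *\<^sub>R z))"
    proof
      fix z
      have "((\<lambda>z. (1 / t) *\<^sub>R z + b) has_derivative (\<lambda>h. (1 / t) *\<^sub>R h)) (at z)"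
        by (auto intro!: derivative_eq_intros)
      moreover have "(w has_derivative (\<lambda>h. jacobian w (at p) *v h)) (at p)" for p
        using Ck_on_has_derivative[OF wsm] by (intro has_derivative_jacobian) (auto simp: differentiable_def)
      ultimately have "((\<lambda>z. w ((1 / t) *\<^sub>R z + b)) has_derivative
          (\<lambda>h. jacobian w (at ((1 / t) *\<^sub>R z + b)) *v ((1 / t) *\<^sub>R h))) (at z)"
        by (rule has_derivative_compose)
      from has_derivative_scaleR_right[OF this, of t]
      have "jacobian \<phi> (at z) = jacobian w (at ((1 / t) *\<^sub>R z + b))"
        using t by (intro jacobian_eqI) (simp add: \<phi>_def[abs_def] matrix_vector_mult_scaleR)
      then show "W (F + jacobian \<phi> (at z)) - W F = f k (b + (1 / t) *\<^sub>R z)"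
        by (simp add: w_def jac f_def add.commute)
    qed
    finally have "0 \<le> \<bar>1 / t\<bar> ^ DIM(real^'d) *\<^sub>R (\<integral>z. f k (b + (1 / t) *\<^sub>R z) \<partial>lebesgue)"
      by simp
    then show ?thesis
      using integral_lebesgue_affine[OF lebesgue_measurable_continuous[OF fc], of "1 / t" k b] t by simp
  qed
  obtain K where K: "\<And>X. norm X \<le> norm F + C \<Longrightarrow> \<bar>W X\<bar> \<le> K"
    using continuous_bounded_on_cball[OF W(1)] by blast
  have bound: "norm (f k x) \<le> (2 * K) * indicator (ball 0 3) x" for k x
  proof (cases "x \<in> ball 0 3")
    case True
    have "norm (convolve (\<rho> k) H x) \<le> C" by (rule mollifier.convolve_norm_bound[OF \<rho> H])
    then have "norm (F + convolve (\<rho> k) H x) \<le> norm F + C"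
      using norm_triangle_ineq[of F "convolve (\<rho> k) H x"] by linarith
    then have "\<bar>W (F + convolve (\<rho> k) H x)\<bar> \<le> K" by (rule K)
    moreover have "\<bar>W F\<bar> \<le> K" using H.C_nonneg by (intro K) simp
    ultimately show ?thesis using True by (simp add: f_def)
  next
    case False
    then have "norm x \<ge> 1 + r k" using mollifier.r(2)[OF \<rho>, of k] by simp
    then have "convolve (\<rho> k) H x = 0" by (rule mollifier.convolve_support[OF \<rho> H])
    then show ?thesis using False by (simp add: f_def)
  qed
  have Wm: "W \<in> borel_measurable borel" using W(1) by (rule borel_measurable_continuous_onI)
  have "(\<lambda>k. \<integral>x. f k x \<partial>lebesgue) \<longlonglongrightarrow> (\<integral>x. W (F + H x) - W F \<partial>lebesgue)"
  proof (rule integral_dominated_convergence[OF _ _ indicator_ball_integral(1)[of "2 * K" 0 3]])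
    show "(\<lambda>x. W (F + H x) - W F) \<in> borel_measurable lebesgue"
      using H.measurable_v Wm by measurable
    show "f k \<in> borel_measurable lebesgue" for k by (rule lebesgue_measurable_continuous[OF fc])
    show "AE x in lebesgue. (\<lambda>k. f k x) \<longlonglongrightarrow> W (F + H x) - W F"
      using lim
    proof eventually_elim
      case (elim x)
      have "isCont W (F + H x)" using W(1) by (simp add: continuous_on_eq_continuous_at)
      from isCont_tendsto_compose[OF this tendsto_add[OF tendsto_const elim]]
      show ?case unfolding f_def by (intro tendsto_diff tendsto_const)
    qed
  qed (use bound in auto)
  then have "0 \<le> (\<integral>x. W (F + H x) - W F \<partial>lebesgue)"
    by (rule LIMSEQ_le_const) (use nonneg in auto)
  also have "\<dots> = (\<integral>x. (if x \<in> ?B then W (G x) - W F else 0) \<partial>lebesgue)"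
  proof -
    have m: "(\<lambda>x. W (F + H x) - W F) \<in> borel_measurable lebesgue"
      using H.measurable_v Wm by measurable
    have AE: "AE x in lebesgue. W (F + H x) - W F = (if x \<in> ?B then W (G x) - W F else 0)"
      using HG by eventually_elim auto
    show ?thesis by (rule integral_cong_AE[OF m borel_measurable_AE[OF m AE] AE])
  qed
  also have "\<dots> = (\<integral>x. W (G x) - W F \<partial>lebesgue_on ?B)"
    by (rule Lebesgue_Measure.integral_restrict_UNIV) simp
  finally show "W F \<le> average ?B (\<lambda>z. W (G z))"
    using average_eq_excess[OF _ _ L_infinity_compose_integrable[OF W(1) GL], of "W F"]
      measure_unit_ball_pos[where 'd = 'd] by simp
qed

text \<open>The balls of radius 1/2 around n/2 and -n/2 each lie in one half of the unit ball. For
  test functions supported in one of them the excess involves a single phase.\<close>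

lemma material_stability_necessary:
  fixes W :: "real^'d^'m \<Rightarrow> real" and n :: "real^'d"
  assumes W: "continuous_on UNIV W" "bdd_below (range W)" and n: "norm n = 1"
    and stable: "strongly_locally_stable W Fp Fm n"
  shows "quasiconvex_envelope W Fp = W Fp" and "quasiconvex_envelope W Fm = W Fm"
proof -
  have nn: "n \<bullet> n = 1" using n by (simp add: norm_eq_1)
  \<comment> \<open>The sign \<sigma> treats both halves at once.\<close>
  have sub: "ball ((\<sigma> / 2) *\<^sub>R n) (1/2) \<subseteq> ball 0 1"
    and side: "z \<in> ball ((\<sigma> / 2) *\<^sub>R n) (1/2) \<Longrightarrow> \<sigma> * (z \<bullet> n) > 0" if \<sigma>: "\<bar>\<sigma>\<bar> = 1" for \<sigma> z
  proof -
    let ?c = "(\<sigma> / 2) *\<^sub>R n"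
    have c: "norm ?c = 1/2" using n \<sigma> by simp
    show "ball ?c (1/2) \<subseteq> ball 0 1"
    proof
      fix x assume "x \<in> ball ?c (1/2)"
      then have "norm (x - ?c) < 1/2" by (simp add: dist_norm norm_minus_commute)
      moreover have "norm x \<le> norm (x - ?c) + norm ?c" by (metis diff_add_cancel norm_triangle_ineq)
      ultimately show "x \<in> ball 0 1" using c by simp
    qed
    assume "z \<in> ball ?c (1/2)"
    then have "norm (z - ?c) < 1/2" by (simp add: dist_norm norm_minus_commute)
    moreover have "\<bar>(z - ?c) \<bullet> n\<bar> \<le> norm (z - ?c)" using Cauchy_Schwarz_ineq2[of "z - ?c" n] n by simp
    ultimately have "\<bar>z \<bullet> n - \<sigma> / 2\<bar> < 1/2" using nn by (simp add: inner_diff_left)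
    then show "\<sigma> * (z \<bullet> n) > 0" using \<sigma> by (auto simp: abs_if split: if_splits)
  qed
  have mono: "\<phi> \<in> test_functions (ball 0 1)" if "\<phi> \<in> test_functions (ball ((\<sigma> / 2) *\<^sub>R n) (1/2))" "\<bar>\<sigma>\<bar> = 1"
    for \<phi> :: "real^'d \<Rightarrow> real^'m" and \<sigma>
    using that(1) sub[OF that(2)] unfolding test_functions_def by blast
  have excess: "0 \<le> (\<integral>z. interface_excess W Fp Fm n \<phi> z \<partial>lebesgue)"
    if "\<phi> \<in> test_functions (ball 0 1)" for \<phi>
    using stable that strongly_locally_stable_iff[OF W(1) n] by blast
  show "quasiconvex_envelope W Fp = W Fp"
  proof (rule quasiconvex_at_of_test_functions[OF W, of "1/2" "(1 / 2) *\<^sub>R n"])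
    fix \<phi> :: "real^'d \<Rightarrow> real^'m" assume \<phi>: "\<phi> \<in> test_functions (ball ((1 / 2) *\<^sub>R n) (1/2))"
    have "interface_excess W Fp Fm n \<phi> z = W (Fp + jacobian \<phi> (at z)) - W Fp" for z
    proof (cases "z \<bullet> n < 0")
      case True
      then have "z \<notin> ball ((1 / 2) *\<^sub>R n) (1/2)" using side[of 1 z] by auto
      from test_function_jacobian(4)[OF \<phi> this] show ?thesis by (simp add: interface_excess_def)
    qed (simp add: interface_excess_def)
    then show "0 \<le> (\<integral>z. W (Fp + jacobian \<phi> (at z)) - W Fp \<partial>lebesgue)"
      using excess[OF mono[of \<phi> 1]] \<phi> by simp
  qed simp
  show "quasiconvex_envelope W Fm = W Fm"
  proof (rule quasiconvex_at_of_test_functions[OF W, of "1/2" "(- 1 / 2) *\<^sub>R n"])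
    fix \<phi> :: "real^'d \<Rightarrow> real^'m" assume \<phi>: "\<phi> \<in> test_functions (ball ((- 1 / 2) *\<^sub>R n) (1/2))"
    have "interface_excess W Fp Fm n \<phi> z = W (Fm + jacobian \<phi> (at z)) - W Fm" for z
    proof (cases "z \<bullet> n < 0")
      case False
      then have "z \<notin> ball ((- 1 / 2) *\<^sub>R n) (1/2)" using side[of "- 1" z] by auto
      from test_function_jacobian(4)[OF \<phi> this] show ?thesis by (simp add: interface_excess_def)
    qed (simp add: interface_excess_def)
    then show "0 \<le> (\<integral>z. W (Fm + jacobian \<phi> (at z)) - W Fm \<partial>lebesgue)"
      using excess[OF mono[of \<phi> "- 1"]] \<phi> by simp
  qed simp
qed

text \<open>The adjoint of the derivative, applied to 1, is the vector representing it.\<close>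

lemma differentiable_imp_gderiv:
  fixes W :: "'a::euclidean_space \<Rightarrow> real"
  assumes "W differentiable (at F)"
  shows "GDERIV W F :> gradient W F"
proof -
  obtain D where D: "(W has_derivative D) (at F)" using assms unfolding differentiable_def by blast
  have "D h = h \<bullet> adjoint D 1" for h
    using adjoint_works[OF has_derivative_linear[OF D], of h 1] by simp
  then have "D = (\<lambda>h. h \<bullet> adjoint D 1)" by blast
  then have "GDERIV W F :> adjoint D 1" unfolding gderiv_def using D by metis
  then show ?thesis using gradient_eqI by metis
qed

theorem theorem2p2:
  fixes W :: "real^'d^'m \<Rightarrow> real" and Fp Fm :: "real^'d^'m"
    and a :: "real^'m" and n :: "real^'d"
  assumes "continuous_on UNIV W"
    and "bdd_below (range W)"
    and "\<exists>U. open U \<and> {Fp, Fm} \<subseteq> U \<and> Ck_on 2 U W"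
    and "norm n = 1"
    and "Fp - Fm = a \<otimes> n"
  shows "strongly_locally_stable W Fp Fm n \<longleftrightarrow>
    (quasiconvex_envelope W Fp = W Fp \<and> quasiconvex_envelope W Fm = W Fm) \<and>
    (gradient W Fp - gradient W Fm) \<bullet> (Fp - Fm) \<le> 0"
proof -
  obtain U where U: "{Fp, Fm} \<subseteq> U" "Ck_on 2 U W" using assms(3) by blast
  then have "W differentiable (at Fp)" "W differentiable (at Fm)" by (auto simp: numeral_2_eq_2)
  note P = this[THEN differentiable_imp_gderiv]
  show ?thesis
    using interface_stability_sufficient[OF assms(1,2,4,5) P]
      interchange_stability_necessary[OF assms(1,4,5) P]
      material_stability_necessary[OF assms(1,2,4)]
    by blast
qed

end
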